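(* Let $n,m,r,s,r'$ be integers with $r+s\le n$, $r'\le m$ and $1\le r'\le r<s$, and let $U\subset\mathbb P^n$ be a connected open set such that $U\cap\partial\mathbb B^n_{r,s}\neq\emptyset$. If $f:U\to\mathbb P^m$ is a holomorphic map such that $f(U\cap\mathbb B^n_{r,s})\subset\mathbb B^m_{r'}$ and $f(U\cap\partial\mathbb B^n_{r,s})\subset\partial\mathbb B^m_{r'}$, then $r=r'$ and there exists $\Phi\in\mathrm{Aut}(\mathbb B^m_{r'})$ such that $\Phi\circ f([z_0,\ldots,z_n])=[z_0,\ldots,z_{r+s},0,\ldots,0]$ for all $[z_0,\dots,z_n]\in U$.
   Context: $\mathbb P^n$ is complex projective space with homogeneous coordinates $[z_0,\dots,z_n]$. For nonnegative integers $r,s$ with $r+s\le n$, $$\mathbb B^n_{r,s}=\Big\{[z_0,\dots,z_n]\in\mathbb P^n:\ \sum_{i=0}^r|z_i|^2>\sum_{j=r+1}^{r+s}|z_j|^2\Big\},$$ and $\partial\mathbb B^n_{r,s}$ is its topological boundary in $\mathbb P^n$. For $0\le r\le n$, $\mathbb B^n_r:=\mathbb B^n_{r,n-r}$, i.e. $\mathbb B^n_r=\{[z]\in\mathbb P^n:\sum_{i=0}^r|z_i|^2>\sum_{j=r+1}^n|z_j|^2\}$. $\mathrm{Aut}(\mathbb B^m_{r'})$ denotes the group of automorphisms of $\mathbb B^m_{r'}$ given by projective linear transformations of $\mathbb P^m$ that map $\mathbb B^m_{r'}$ onto itself (so they are defined on all of $\mathbb P^m$). *)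

theory Defs
  imports "HOL-Analysis.Analysis"
begin

text \<open>
  The dimensions are natural numbers, so \<open>\<complex>\<^sup>N\<close> is the carrier set of all sequences
  supported on the indices below \<open>N\<close>, with the subspace topology of the product topology
  on \<^typ>\<open>nat \<Rightarrow> complex\<close> (this is the Euclidean topology).
\<close>

definition cvec :: "nat \<Rightarrow> (nat \<Rightarrow> complex) set" where
  "cvec N = {z. \<forall>i\<ge>N. z i = 0}"

definition cnorm :: "nat \<Rightarrow> (nat \<Rightarrow> complex) \<Rightarrow> real" where
  "cnorm N z = L2_set (\<lambda>i. cmod (z i)) {..<N}"

text \<open>
  Holomorphy in several variables, i.e. complex Frechet differentiability at every point;
  meant for sets \<open>D\<close> that are open in \<^term>\<open>cvec N\<close>.
\<close>

definition holo_fun :: "nat \<Rightarrow> (nat \<Rightarrow> complex) set \<Rightarrow> ((nat \<Rightarrow> complex) \<Rightarrow> complex) \<Rightarrow> bool" where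
  "holo_fun N D g \<longleftrightarrow>
     (\<forall>z\<in>D. \<exists>a :: nat \<Rightarrow> complex.
        ((\<lambda>w. cmod (g w - g z - (\<Sum>i<N. a i * (w i - z i))) / cnorm N (\<lambda>i. w i - z i))
           \<longlongrightarrow> 0) (at z within D))"

text \<open>
  \<^term>\<open>hpt z\<close> is the point \<open>[z\<^sub>0, z\<^sub>1, \<dots>]\<close>, the class of \<open>z\<close> under rescaling.
  The class of the zero vector is \<open>{0}\<close>, which is not a point of any projective space.
\<close>

type_synonym ppoint = "(nat \<Rightarrow> complex) set"

definition hpt :: "(nat \<Rightarrow> complex) \<Rightarrow> ppoint" where
  "hpt z = {(\<lambda>i. c * z i) | c. c \<noteq> 0}"

definition hcoords :: "nat \<Rightarrow> (nat \<Rightarrow> complex) set" where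
  "hcoords n = cvec (Suc n) - {\<lambda>_. 0}"

text \<open>Complex projective \<open>n\<close>-space with the quotient topology
  of \<open>\<complex>\<^sup>n\<^sup>+\<^sup>1 - {0}\<close>.\<close>

definition pspace :: "nat \<Rightarrow> ppoint topology" where
  "pspace n = topology (\<lambda>W. W \<subseteq> hpt ` hcoords n \<and>
     openin (top_of_set (hcoords n)) {z \<in> hcoords n. hpt z \<in> W})"

text \<open>
  \<^term>\<open>aff_pt k\<close> maps \<open>w \<in> \<complex>\<^sup>n\<close> to \<open>[w\<^sub>0, \<dots>, w\<^bsub>k-1\<^esub>, 1, w\<^sub>k, \<dots>, w\<^bsub>n-1\<^esub>]\<close>; it is the inverse of
  the standard affine chart on \<open>{z\<^sub>k \<noteq> 0}\<close>.
\<close>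

definition aff_pt :: "nat \<Rightarrow> (nat \<Rightarrow> complex) \<Rightarrow> ppoint" where
  "aff_pt k w = hpt (\<lambda>i. if i < k then w i else if i = k then 1 else w (i - 1))"

definition aff_chart :: "nat \<Rightarrow> nat \<Rightarrow> ppoint \<Rightarrow> nat \<Rightarrow> complex" where
  "aff_chart n k = the_inv_into (cvec n) (aff_pt k)"

definition holo_map :: "nat \<Rightarrow> nat \<Rightarrow> ppoint set \<Rightarrow> (ppoint \<Rightarrow> ppoint) \<Rightarrow> bool" where
  "holo_map n m U f \<longleftrightarrow>
     continuous_map (subtopology (pspace n) U) (pspace m) f \<and>
     (\<forall>k\<le>n. \<forall>l\<le>m. \<forall>i<m.
        holo_fun n {w \<in> cvec n. aff_pt k w \<in> U \<and> f (aff_pt k w) \<in> aff_pt l ` cvec m}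
          (\<lambda>w. aff_chart m l (f (aff_pt k w)) i))"

definition gball :: "nat \<Rightarrow> nat \<Rightarrow> nat \<Rightarrow> ppoint set" where
  "gball n r s = {hpt z | z. z \<in> hcoords n \<and>
     (\<Sum>i=0..r. (cmod (z i))\<^sup>2) > (\<Sum>j=r+1..r+s. (cmod (z j))\<^sup>2)}"

definition gball_bd :: "nat \<Rightarrow> nat \<Rightarrow> nat \<Rightarrow> ppoint set" where
  "gball_bd n r s = pspace n frontier_of gball n r s"

abbreviation gball1 :: "nat \<Rightarrow> nat \<Rightarrow> ppoint set" where
  "gball1 n r \<equiv> gball n r (n - r)"

abbreviation gball1_bd :: "nat \<Rightarrow> nat \<Rightarrow> ppoint set" where
  "gball1_bd n r \<equiv> gball_bd n r (n - r)"

definition mat_app :: "nat \<Rightarrow> (nat \<Rightarrow> nat \<Rightarrow> complex) \<Rightarrow> (nat \<Rightarrow> complex) \<Rightarrow> nat \<Rightarrow> complex" where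
  "mat_app N A z = (\<lambda>i. if i < N then \<Sum>j<N. A i j * z j else 0)"

text \<open>Bijectivity on \<^term>\<open>cvec (Suc m)\<close> says that the matrix is invertible.\<close>

definition proj_linear :: "nat \<Rightarrow> (ppoint \<Rightarrow> ppoint) \<Rightarrow> bool" where
  "proj_linear m \<Phi> \<longleftrightarrow>
     (\<exists>A. bij_betw (mat_app (Suc m) A) (cvec (Suc m)) (cvec (Suc m)) \<and>
          (\<forall>z\<in>hcoords m. \<Phi> (hpt z) = hpt (mat_app (Suc m) A z)))"

text \<open>Only the values on projective space matter, so they are made \<^const>\<open>undefined\<close> elsewhere.\<close>

definition Aut_gball1 :: "nat \<Rightarrow> nat \<Rightarrow> (ppoint \<Rightarrow> ppoint) set" where
  "Aut_gball1 m r = {\<Phi> \<in> extensional (topspace (pspace m)).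
     proj_linear m \<Phi> \<and> \<Phi> ` gball1 m r = gball1 m r}"


lemma hpt_self: "z \<in> hpt z"
  unfolding hpt_def by (auto intro: exI[of _ 1])

lemma hpt_eq_iff: "hpt z = hpt w \<longleftrightarrow> (\<exists>c. c \<noteq> 0 \<and> w = (\<lambda>i. c * z i))"
proof
  assume "hpt z = hpt w"
  then have "w \<in> hpt z" using hpt_self by blast
  then show "\<exists>c. c \<noteq> 0 \<and> w = (\<lambda>i. c * z i)" by (auto simp: hpt_def)
next
  assume "\<exists>c. c \<noteq> 0 \<and> w = (\<lambda>i. c * z i)"
  then obtain c where c: "c \<noteq> 0" "w = (\<lambda>i. c * z i)" by blast
  have 1: "(\<lambda>i. d * z i) = (\<lambda>i. (d / c) * w i)" for d using c by auto
  have 2: "(\<lambda>i. d * w i) = (\<lambda>i. (d * c) * z i)" for d using c by (auto simp: mult.assoc)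
  show "hpt z = hpt w"
  proof
    show "hpt z \<subseteq> hpt w"
    proof
      fix v assume "v \<in> hpt z"
      then obtain d where d: "d \<noteq> 0" "v = (\<lambda>i. d * z i)" by (auto simp: hpt_def)
      have "v = (\<lambda>i. (d / c) * w i)" "d / c \<noteq> 0" using d c(1) 1 by simp_all
      then show "v \<in> hpt w" unfolding hpt_def by blast
    qed
    show "hpt w \<subseteq> hpt z"
    proof
      fix v assume "v \<in> hpt w"
      then obtain d where d: "d \<noteq> 0" "v = (\<lambda>i. d * w i)" by (auto simp: hpt_def)
      have "v = (\<lambda>i. (d * c) * z i)" "d * c \<noteq> 0" using d c(1) 2 by simp_all
      then show "v \<in> hpt z" unfolding hpt_def by blast
    qed
  qed
qed

lemma openin_pspace:
  "openin (pspace n) W \<longleftrightarrow> W \<subseteq> hpt ` hcoords n \<and>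
     openin (top_of_set (hcoords n)) {z \<in> hcoords n. hpt z \<in> W}"
proof -
  have "istopology (\<lambda>W. W \<subseteq> hpt ` hcoords n \<and>
     openin (top_of_set (hcoords n)) {z \<in> hcoords n. hpt z \<in> W})"
    unfolding istopology_def
  proof (intro conjI allI impI)
    fix S T
    assume S: "S \<subseteq> hpt ` hcoords n \<and> openin (top_of_set (hcoords n)) {z \<in> hcoords n. hpt z \<in> S}"
      and T: "T \<subseteq> hpt ` hcoords n \<and> openin (top_of_set (hcoords n)) {z \<in> hcoords n. hpt z \<in> T}"
    show "S \<inter> T \<subseteq> hpt ` hcoords n" using S by blast
    have "{z \<in> hcoords n. hpt z \<in> S \<inter> T} = {z \<in> hcoords n. hpt z \<in> S} \<inter> {z \<in> hcoords n. hpt z \<in> T}"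
      by blast
    then show "openin (top_of_set (hcoords n)) {z \<in> hcoords n. hpt z \<in> S \<inter> T}"
      using S T by (simp only: openin_Int)
  next
    fix K
    assume K: "\<forall>S\<in>K. S \<subseteq> hpt ` hcoords n \<and> openin (top_of_set (hcoords n)) {z \<in> hcoords n. hpt z \<in> S}"
    show "\<Union>K \<subseteq> hpt ` hcoords n" using K by blast
    have "{z \<in> hcoords n. hpt z \<in> \<Union>K} = (\<Union>S\<in>K. {z \<in> hcoords n. hpt z \<in> S})" by blast
    then show "openin (top_of_set (hcoords n)) {z \<in> hcoords n. hpt z \<in> \<Union>K}"
      using K by (simp only:) (rule openin_Union, blast)
  qed
  then show ?thesis by (simp add: pspace_def topology_inverse')
qed

lemma topspace_pspace: "topspace (pspace n) = hpt ` hcoords n"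
proof
  show "topspace (pspace n) \<subseteq> hpt ` hcoords n"
    using openin_topspace[of "pspace n"] unfolding openin_pspace by blast
  have "{z \<in> hcoords n. hpt z \<in> hpt ` hcoords n} = hcoords n" by blast
  then have "openin (pspace n) (hpt ` hcoords n)" by (simp add: openin_pspace)
  then show "hpt ` hcoords n \<subseteq> topspace (pspace n)" by (rule openin_subset)
qed

lemma quotient_map_hpt: "quotient_map (top_of_set (hcoords n)) (pspace n) hpt"
  unfolding quotient_map_def by (auto simp: topspace_pspace openin_pspace)

lemma hpt_in_gball_iff:
  assumes "z \<in> hcoords n"
  shows "hpt z \<in> gball n r s \<longleftrightarrow>
    (\<Sum>i=0..r. (cmod (z i))\<^sup>2) > (\<Sum>j=r+1..r+s. (cmod (z j))\<^sup>2)"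
proof
  assume "hpt z \<in> gball n r s"
  then obtain w c where w: "(\<Sum>i=0..r. (cmod (w i))\<^sup>2) > (\<Sum>j=r+1..r+s. (cmod (w j))\<^sup>2)"
    and c: "c \<noteq> 0" "w = (\<lambda>i. c * z i)"
    by (auto simp: gball_def hpt_eq_iff)
  have "(cmod c)\<^sup>2 * (\<Sum>i=0..r. (cmod (z i))\<^sup>2) > (cmod c)\<^sup>2 * (\<Sum>j=r+1..r+s. (cmod (z j))\<^sup>2)"
    using w by (simp add: c(2) norm_mult power_mult_distrib sum_distrib_left)
  then show "(\<Sum>i=0..r. (cmod (z i))\<^sup>2) > (\<Sum>j=r+1..r+s. (cmod (z j))\<^sup>2)"
    by (simp add: c(1))
qed (use assms in \<open>auto simp: gball_def\<close>)

lemma inj_on_aff_pt: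
  assumes "k \<le> n"
  shows "inj_on (aff_pt k) (cvec n)"
proof (rule inj_onI)
  fix v w
  assume "aff_pt k v = aff_pt k w"
  then obtain c where
    eq: "(\<lambda>i. if i < k then w i else if i = k then 1 else w (i - 1)) =
         (\<lambda>i. c * (if i < k then v i else if i = k then 1 else v (i - 1)))"
    unfolding aff_pt_def hpt_eq_iff by blast
  from fun_cong[OF eq, of k] have "c = 1" by simp
  show "v = w"
  proof
    fix i
    show "v i = w i"
    proof (cases "i < k")
      case True
      then show ?thesis using fun_cong[OF eq, of i] \<open>c = 1\<close> by simp
    next
      case False
      then show ?thesis using fun_cong[OF eq, of "Suc i"] \<open>c = 1\<close> by simp
    qed
  qed
qed

lemma aff_pt_image:
  assumes "k \<le> n"
  shows "aff_pt k ` cvec n = {hpt z | z. z \<in> hcoords n \<and> z k \<noteq> 0}"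
proof
  show "aff_pt k ` cvec n \<subseteq> {hpt z | z. z \<in> hcoords n \<and> z k \<noteq> 0}"
  proof
    fix p assume "p \<in> aff_pt k ` cvec n"
    then obtain w where w: "w \<in> cvec n" "p = aff_pt k w" by blast
    let ?z = "\<lambda>i. if i < k then w i else if i = k then 1 else w (i - 1)"
    have "?z \<in> cvec (Suc n)" using w(1) assms by (auto simp: cvec_def)
    moreover have "?z k \<noteq> 0" by simp
    moreover have "?z \<noteq> (\<lambda>_. 0)" using \<open>?z k \<noteq> 0\<close> by (auto dest: fun_cong[of _ _ k])
    ultimately show "p \<in> {hpt z | z. z \<in> hcoords n \<and> z k \<noteq> 0}"
      using w(2) unfolding aff_pt_def hcoords_def by blast
  qed
  show "{hpt z | z. z \<in> hcoords n \<and> z k \<noteq> 0} \<subseteq> aff_pt k ` cvec n"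
  proof clarify
    fix z assume z: "z \<in> hcoords n" "z k \<noteq> 0"
    let ?w = "\<lambda>i. (if i < k then z i else z (Suc i)) / z k"
    have "?w \<in> cvec n" using z assms by (auto simp: hcoords_def cvec_def)
    moreover have "hpt z = aff_pt k ?w"
      unfolding aff_pt_def hpt_eq_iff
      by (rule exI[of _ "1 / z k"]) (use z in \<open>auto simp: fun_eq_iff\<close>)
    ultimately show "hpt z \<in> aff_pt k ` cvec n" by blast
  qed
qed

end

theory Submission
  imports Defs "HOL-Complex_Analysis.Complex_Analysis"
begin

text \<open>
  Lift \<open>f\<close> locally to a holomorphic map \<open>F\<close> between vector spaces with Hermitian forms of \<open>r + 1\<close> and
  \<open>r' + 1\<close> positive squares. By polarization \<open>F\<close> maps orthogonal vectors to orthogonal vectors, since it maps null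
  vectors to null vectors. There are \<open>r + 1\<close> mutually orthogonal positive vectors near any nonradical null
  vector, hence \<open>r' = r\<close>; and \<open>r - 1\<close> such vectors orthogonal to a given totally null line, hence \<open>F\<close> maps totally null
  lines to lines.

  Write \<open>\<langle>F y, F w\<rangle> = Q(y, w) \<langle>y, w\<rangle>\<close>. The Hopf lemma gives \<open>Q(b, b) \<noteq> 0\<close> at null vectors \<open>b\<close>, and the
  dependence of \<open>F b\<close>, \<open>F y\<close>, \<open>F z\<close> for \<open>z\<close> on a totally null line through \<open>b\<close> and \<open>y\<close> shows that \<open>Q(y, \<cdot>)\<close> is a
  multiple of \<open>Q(b, \<cdot>)\<close>. Connecting vectors by chains of such lines makes \<open>Q(y, w)\<close> a product
  \<open>c(y) \<kappa>(w)\<close>. So \<open>F\<close> divided by a scalar function preserves the Hermitian form up to a constant factor, which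
  forces it to be linear; the identity theorem carries this to all of \<open>U\<close>.
\<close>

section \<open>Indefinite Hermitian forms\<close>

text \<open>Let \<open>K y w\<close> be the form of \<open>F y\<close> and \<open>F w\<close>, and
  \<open>h\<close> the form of the source. A lift is determined only up to a holomorphic unit, so Q
  is known only up to factors \<open>u y * cnj (u w)\<close>. The most one can ask is that Q has
  rank one; dividing F by \<open>K w p / h w p\<close> then removes the factor. Q is a quotient
  where \<open>h y w\<close> is nonzero and a derivative elsewhere. To avoid this split Q is never
  formed: relations read \<open>K y w * h b w = c * K b w * h y w\<close>, and the places where a
  division fails are reached by continuation along lines. K is holomorphic in its first argument
  only, so whatever varies is moved there by conjugation.

  The main obstacle is that F lives only near p, while orthogonal frames are usually far away. Since
  b is null, adding to it small multiples of vectors orthogonal to it gives vectors near b whose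
  mutual products change only by scale. If r + s < n the form has a radical; a coordinate i0 <= r
  without zeros on the box keeps every vector of the box out of it. Two negative directions leave
  one orthogonal to a given null vector, which moves a positive vector onto the null cone.\<close>

text \<open>Coordinates from \<open>k\<close> on span the radical; they model the case r + s < n.
  With \<open>a = r + 1\<close> and \<open>k = r + s + 1\<close>, positivity of
  \<open>hf a k z z\<close> describes the ball.\<close>

definition hf :: "nat \<Rightarrow> nat \<Rightarrow> (nat \<Rightarrow> complex) \<Rightarrow> (nat \<Rightarrow> complex) \<Rightarrow> complex" where
  "hf a k x y = (\<Sum>i<k. (if i < a then 1 else - 1) * (x i * cnj (y i)))"

lemma hf_add_left: "hf a k (\<lambda>i. x i + y i) z = hf a k x z + hf a k y z"
  unfolding hf_def by (simp add: sum.distrib[symmetric] algebra_simps)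
lemma hf_diff_left: "hf a k (\<lambda>i. x i - y i) z = hf a k x z - hf a k y z"
  unfolding hf_def by (simp add: sum_subtractf[symmetric] algebra_simps)
lemma hf_scale_left: "hf a k (\<lambda>i. c * x i) z = c * hf a k x z"
  unfolding hf_def by (simp add: sum_distrib_left mult_ac)
lemma hf_divide_left: "hf a k (\<lambda>i. x i / c) z = hf a k x z / c"
  unfolding hf_def by (simp add: sum_divide_distrib)
lemma hf_zero_left: "hf a k (\<lambda>i. 0) z = 0"
  unfolding hf_def by simp
lemma hf_sum_left: "hf a k (\<lambda>i. \<Sum>j\<in>J. f j i) z = (\<Sum>j\<in>J. hf a k (f j) z)"
  unfolding hf_def by (subst sum.swap) (simp add: sum_distrib_left sum_distrib_right)

lemma hf_cnj: "cnj (hf a k x y) = hf a k y x"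
  unfolding hf_def by (simp, rule sum.cong) (auto simp: mult_ac)

lemma hf_add_right: "hf a k z (\<lambda>i. x i + y i) = hf a k z x + hf a k z y"
  by (metis hf_cnj hf_add_left complex_cnj_add)
lemma hf_diff_right: "hf a k z (\<lambda>i. x i - y i) = hf a k z x - hf a k z y"
  by (metis hf_cnj hf_diff_left complex_cnj_diff)
lemma hf_scale_right: "hf a k z (\<lambda>i. c * x i) = cnj c * hf a k z x"
  by (metis hf_cnj hf_scale_left complex_cnj_mult)
lemma hf_divide_right: "hf a k z (\<lambda>i. x i / c) = hf a k z x / cnj c"
  by (metis hf_cnj hf_divide_left complex_cnj_divide)
lemma hf_zero_right: "hf a k z (\<lambda>i. 0) = 0"
  unfolding hf_def by simp
lemma hf_sum_right: "hf a k z (\<lambda>i. \<Sum>j\<in>J. f j i) = (\<Sum>j\<in>J. hf a k z (f j))"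
  unfolding hf_cnj[of a k _ z, symmetric] hf_sum_left by simp

lemmas hf_linear = hf_add_left hf_diff_left hf_scale_left hf_divide_left hf_zero_left hf_sum_left
  hf_add_right hf_diff_right hf_scale_right hf_divide_right hf_zero_right hf_sum_right

lemma hf_zero_sym: "hf a k x y = 0 \<Longrightarrow> hf a k y x = 0"
  by (metis hf_cnj complex_cnj_zero_iff)

lemma hf_self_real: "Im (hf a k x x) = 0"
  by (metis hf_cnj cnj.simps(2) neg_equal_zero)

lemma hf_self_eq: "hf a k x x = of_real (Re (hf a k x x))"
  by (simp add: complex_eq_iff hf_self_real)

lemma Re_hf_self: "Re (hf a k x x) = (\<Sum>i<k. (if i < a then 1 else - 1) * (cmod (x i))\<^sup>2)"
  unfolding hf_def Re_sum by (rule sum.cong) (auto simp: complex_norm_square[symmetric])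

lemma hf_cong: "(\<And>i. i < k \<Longrightarrow> x i = x' i) \<Longrightarrow> (\<And>i. i < k \<Longrightarrow> y i = y' i) \<Longrightarrow> hf a k x y = hf a k x' y'"
  unfolding hf_def by (rule sum.cong) auto

lemma hf_unit_left:
  assumes "j < k"
  shows "hf a k (\<lambda>i. if i = j then 1 else 0) y = (if j < a then cnj (y j) else - cnj (y j))"
proof -
  have "hf a k (\<lambda>i. if i = j then 1 else 0) y
      = (\<Sum>i<k. if i = j then (if j < a then cnj (y j) else - cnj (y j)) else 0)"
    unfolding hf_def by (rule sum.cong) auto
  then show ?thesis using assms by simp
qed

section \<open>Linear dependence and orthonormal families\<close>

text \<open>Elimination of one unknown per equation, by induction on \<open>M\<close>. The dimension
  counts below rest on this lemma, so no subspaces or bases of sequence spaces are set up.\<close>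

lemma homogeneous_system:
  fixes c :: "nat \<Rightarrow> nat \<Rightarrow> complex"
  assumes "M < card S" "finite S"
  shows "\<exists>x. (\<exists>i\<in>S. x i \<noteq> 0) \<and> (\<forall>i. i \<notin> S \<longrightarrow> x i = 0) \<and> (\<forall>j<M. (\<Sum>i\<in>S. c j i * x i) = 0)"
  using assms
proof (induction M arbitrary: c S)
  case 0
  then obtain i0 where "i0 \<in> S" by (metis card.empty equals0I less_irrefl)
  then show ?case by (intro exI[of _ "\<lambda>i. if i = i0 then 1 else 0"]) auto
next
  case (Suc M)
  show ?case
  proof (cases "\<forall>i\<in>S. c M i = 0")
    case True
    from Suc.IH[of S c] Suc.prems obtain x where x: "\<exists>i\<in>S. x i \<noteq> 0" "\<forall>i. i \<notin> S \<longrightarrow> x i = 0"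
       "\<forall>j<M. (\<Sum>i\<in>S. c j i * x i) = 0" by auto
    have "(\<Sum>i\<in>S. c j i * x i) = 0" if "j < Suc M" for j
      using that x(3) True by (cases "j = M") auto
    then show ?thesis using x by blast
  next
    case False
    then obtain l where l: "l \<in> S" "c M l \<noteq> 0" by blast
    define S' where "S' = S - {l}"
    have S': "finite S'" "M < card S'" "S = insert l S'" "l \<notin> S'"
      using Suc.prems l by (auto simp: S'_def)
    \<comment> \<open>Coefficients left after equation \<open>M\<close> is solved for the pivot
      unknown \<open>l\<close>; \<open>y\<close> below puts the solved value back in.\<close>
    define d where "d j i = c j i - c j l * c M i / c M l" for j i
    from Suc.IH[OF S'(2,1), of d] obtain x where x: "\<exists>i\<in>S'. x i \<noteq> 0" "\<forall>i. i \<notin> S' \<longrightarrow> x i = 0"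
       "\<forall>j<M. (\<Sum>i\<in>S'. d j i * x i) = 0" by blast
    define y where "y = x(l := - (\<Sum>i\<in>S'. c M i * x i) / c M l)"
    have y: "y i = x i" if "i \<in> S'" for i using that S'(4) by (auto simp: y_def)
    have eq: "(\<Sum>i\<in>S. c j i * y i) = (\<Sum>i\<in>S'. d j i * x i)" for j
    proof -
      have "(\<Sum>i\<in>S. c j i * y i) = c j l * y l + (\<Sum>i\<in>S'. c j i * x i)"
        using S' y by (simp)
      also have "\<dots> = (\<Sum>i\<in>S'. c j i * x i) - (\<Sum>i\<in>S'. c j l * c M i / c M l * x i)"
        by (simp add: y_def sum_distrib_left sum_divide_distrib mult_ac)
      finally show ?thesis by (simp add: d_def sum_subtractf left_diff_distrib)
    qed
    have "(\<Sum>i\<in>S. c j i * y i) = 0" if "j < Suc M" for j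
    proof (cases "j = M")
      case True
      then show ?thesis unfolding eq using l by (simp add: d_def)
    next
      case False
      then show ?thesis unfolding eq using x(3) that by auto
    qed
    moreover have "\<exists>i\<in>S. y i \<noteq> 0" using x(1) y S'(3) by auto
    moreover have "\<forall>i. i \<notin> S \<longrightarrow> y i = 0" using x(2) S'(3) by (auto simp: y_def)
    ultimately show ?thesis by blast
  qed
qed

text \<open>Since \<^term>\<open>a\<close> is the dimension of a maximal positive subspace, some combination of more than
  \<^term>\<open>a\<close> vectors lies in the negative definite span of the last coordinates.\<close>

lemma orthogonal_nonneg_dependent:
  assumes "a < L"
    and orth: "\<And>i j. i < L \<Longrightarrow> j < L \<Longrightarrow> i \<noteq> j \<Longrightarrow> hf a k (x i) (x j) = 0"
    and nonneg: "\<And>j. j < L \<Longrightarrow> 0 \<le> Re (hf a k (x j) (x j))"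
  shows "\<exists>c. (\<exists>j<L. c j \<noteq> 0) \<and> (\<forall>i<k. (\<Sum>j<L. c j * x j i) = 0) \<and>
    (\<forall>j<L. 0 < Re (hf a k (x j) (x j)) \<longrightarrow> c j = 0)"
proof -
  from homogeneous_system[of a "{..<L}" "\<lambda>i j. x j i"] assms(1)
  obtain c where c: "\<exists>j<L. c j \<noteq> 0" "\<forall>i<a. (\<Sum>j<L. x j i * c j) = 0"
    by (auto simp: Bex_def)
  define y where "y = (\<lambda>i. \<Sum>j<L. c j * x j i)"
  have "Re (hf a k y y) = (\<Sum>i<k. (if i < a then 1 else - 1) * (cmod (y i))\<^sup>2)"
    by (rule Re_hf_self)
  also have "\<dots> = (\<Sum>i<k. - ((cmod (y i))\<^sup>2))"
    by (rule sum.cong) (use c(2) in \<open>auto simp: y_def mult.commute\<close>)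
  finally have neg: "Re (hf a k y y) = - (\<Sum>i<k. (cmod (y i))\<^sup>2)" by (simp add: sum_negf)
  \<comment> \<open>Computed through orthogonality the same number is nonnegative, against the
    nonpositive value just found. So both vanish, which gives the relation and kills
    \<open>c j\<close> wherever \<open>x j\<close> is positive.\<close>
  have "hf a k y y = (\<Sum>i<L. c i * (\<Sum>j<L. cnj (c j) * hf a k (x i) (x j)))"
    unfolding y_def by (simp add: hf_linear sum_distrib_left)
  also have "\<dots> = (\<Sum>i<L. c i * (\<Sum>j<L. if j = i then cnj (c i) * hf a k (x i) (x i) else 0))"
    by (intro sum.cong refl arg_cong2[of _ _ _ _ "(*)"]) (auto simp: orth)
  also have "\<dots> = (\<Sum>i<L. c i * cnj (c i) * hf a k (x i) (x i))"
    by (intro sum.cong) (auto simp: mult_ac)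
  also have "\<dots> = (\<Sum>i<L. of_real ((cmod (c i))\<^sup>2 * Re (hf a k (x i) (x i))))"
    by (intro sum.cong) (auto simp: complex_norm_square[symmetric] simp flip: hf_self_eq)
  finally have pos: "Re (hf a k y y) = (\<Sum>i<L. (cmod (c i))\<^sup>2 * Re (hf a k (x i) (x i)))"
    by simp
  have 1: "(\<Sum>i<L. (cmod (c i))\<^sup>2 * Re (hf a k (x i) (x i))) \<ge> 0"
    by (intro sum_nonneg mult_nonneg_nonneg nonneg) auto
  have 2: "(\<Sum>i<k. (cmod (y i))\<^sup>2) \<ge> 0" by (intro sum_nonneg) auto
  have z: "(\<Sum>i<k. (cmod (y i))\<^sup>2) = 0" "(\<Sum>i<L. (cmod (c i))\<^sup>2 * Re (hf a k (x i) (x i))) = 0"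
    using 1 2 neg pos by linarith+
  have "\<forall>i<k. y i = 0"
    using z(1) by (subst (asm) sum_nonneg_eq_0_iff) auto
  moreover have "\<forall>i<L. (cmod (c i))\<^sup>2 * Re (hf a k (x i) (x i)) = 0"
    using z(2) by (subst (asm) sum_nonneg_eq_0_iff) (auto intro: nonneg mult_nonneg_nonneg)
  ultimately show ?thesis using c(1) by (intro exI[of _ c]) (auto simp: y_def)
qed

text \<open>Together with \<open>x\<close> the family has \<open>a + 1\<close> members, hence a
  linear relation; its coefficients on the positive vectors vanish, so \<open>x\<close> alone
  carries it. This is how vectors are shown to be zero later on.\<close>

lemma orthogonal_positive_nonneg_zero:
  assumes pos: "\<And>j. j < a \<Longrightarrow> 0 < Re (hf a k (e j) (e j))"
    and orth: "\<And>i j. i < a \<Longrightarrow> j < a \<Longrightarrow> i \<noteq> j \<Longrightarrow> hf a k (e i) (e j) = 0"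
    and x: "\<And>j. j < a \<Longrightarrow> hf a k x (e j) = 0" "0 \<le> Re (hf a k x x)"
    and i: "i < k"
  shows "x i = 0"
proof -
  define X where "X j = (if j < a then e j else x)" for j
  have "\<exists>c. (\<exists>j<Suc a. c j \<noteq> 0) \<and> (\<forall>i<k. (\<Sum>j<Suc a. c j * X j i) = 0) \<and>
    (\<forall>j<Suc a. 0 < Re (hf a k (X j) (X j)) \<longrightarrow> c j = 0)"
  proof (rule orthogonal_nonneg_dependent)
    fix i j assume "i < Suc a" "j < Suc a" "i \<noteq> j"
    moreover have "hf a k (e l) x = 0" if "l < a" for l
      by (rule hf_zero_sym[OF x(1)[OF that]])
    ultimately show "hf a k (X i) (X j) = 0"
      using orth x by (auto simp: X_def less_Suc_eq)
  next
    fix j assume "j < Suc a"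
    then show "0 \<le> Re (hf a k (X j) (X j))"
      using pos x by (auto simp: X_def less_Suc_eq intro: less_imp_le)
  qed simp
  then obtain c where c: "\<exists>j<Suc a. c j \<noteq> 0" "\<forall>i<k. (\<Sum>j<Suc a. c j * X j i) = 0"
    "\<forall>j<Suc a. 0 < Re (hf a k (X j) (X j)) \<longrightarrow> c j = 0" by blast
  have z: "c j = 0" if "j < a" for j using c(3) pos that by (auto simp: X_def)
  then have "c a \<noteq> 0" using c(1) by (auto simp: less_Suc_eq)
  moreover have "(\<Sum>j<Suc a. c j * X j i) = c a * x i" using z by (simp add: X_def)
  ultimately show ?thesis using c(2) i by auto
qed

text \<open>Reversed Cauchy--Schwarz: the combination \<^term>\<open>\<lambda>i. hf a k y e * x i - hf a k x e * y i\<close> is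
  orthogonal to all \<^term>\<open>a\<close> positive vectors, so it cannot be positive.\<close>

lemma triple_product_nonneg:
  assumes a: "0 < a"
    and pos: "\<And>j. j < a \<Longrightarrow> 0 < Re (hf a k (e j) (e j))"
    and orth: "\<And>i j. i < a \<Longrightarrow> j < a \<Longrightarrow> i \<noteq> j \<Longrightarrow> hf a k (e i) (e j) = 0"
    and x: "\<And>j. 0 < j \<Longrightarrow> j < a \<Longrightarrow> hf a k x (e j) = 0" "0 \<le> Re (hf a k x x)"
    and y: "\<And>j. 0 < j \<Longrightarrow> j < a \<Longrightarrow> hf a k y (e j) = 0" "0 \<le> Re (hf a k y y)"
  shows "0 \<le> Re (hf a k x y * hf a k y (e 0) * hf a k (e 0) x)"
proof (rule ccontr)
  assume neg: "\<not> ?thesis"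
  define u where "u = (\<lambda>i. hf a k y (e 0) * x i - hf a k x (e 0) * y i)"
  let ?A = "hf a k y (e 0)" and ?B = "hf a k x (e 0)"
  have "hf a k u u = ?A * cnj ?A * hf a k x x + ?B * cnj ?B * hf a k y y
      - (?A * cnj ?B * hf a k x y + cnj (?A * cnj ?B * hf a k x y))"
    unfolding u_def by (simp only: hf_linear) (simp add: hf_cnj algebra_simps)
  also have "\<dots> = of_real ((cmod ?A)\<^sup>2 * Re (hf a k x x) + (cmod ?B)\<^sup>2 * Re (hf a k y y)
      - 2 * Re (hf a k x y * ?A * hf a k (e 0) x))"
    unfolding complex_add_cnj complex_norm_square[symmetric]
    by (subst (1 2) hf_self_eq) (simp add: hf_cnj mult_ac)
  finally have "Re (hf a k u u) = (cmod ?A)\<^sup>2 * Re (hf a k x x) + (cmod ?B)\<^sup>2 * Re (hf a k y y)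
      - 2 * Re (hf a k x y * ?A * hf a k (e 0) x)" by (simp only: Re_complex_of_real)
  moreover have "0 \<le> (cmod ?A)\<^sup>2 * Re (hf a k x x)" "0 \<le> (cmod ?B)\<^sup>2 * Re (hf a k y y)"
    using x(2) y(2) by simp_all
  ultimately have upos: "0 < Re (hf a k u u)" using neg by linarith
  have ue: "hf a k u (e j) = 0" if "j < a" for j
    unfolding u_def using x(1)[of j] y(1)[of j] that by (cases "j = 0") (auto simp: hf_linear)
  have "u i = 0" if "i < k" for i
    using orthogonal_positive_nonneg_zero[of a k e u i] pos orth ue upos that by simp
  then have "hf a k u u = hf a k (\<lambda>i. 0) (\<lambda>i. 0)" by (intro hf_cong) auto
  then show False using upos by (simp add: hf_linear)
qed

text \<open>Gram-Schmidt within the coordinates of \<open>S\<close>: the next vector solves the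
  \<open>M\<close> given equations and the \<open>L\<close> orthogonality conditions to its
  predecessors, which is still fewer equations than unknowns.\<close>

lemma orthonormal_vectors:
  fixes c :: "nat \<Rightarrow> nat \<Rightarrow> complex"
  assumes "finite S" "M + L \<le> card S"
  shows "\<exists>u. (\<forall>j<L. (\<forall>i. i \<notin> S \<longrightarrow> u j i = 0) \<and> (\<forall>l<M. (\<Sum>i\<in>S. c l i * u j i) = 0)) \<and>
     (\<forall>j<L. \<forall>l<L. (\<Sum>i\<in>S. u j i * cnj (u l i)) = (if j = l then 1 else 0))"
  using assms(2)
proof (induction L)
  case 0
  then show ?case by simp
next
  case (Suc L)
  then obtain u where "\<forall>j<L. (\<forall>i. i \<notin> S \<longrightarrow> u j i = 0) \<and> (\<forall>l<M. (\<Sum>i\<in>S. c l i * u j i) = 0)"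
     "\<forall>j<L. \<forall>l<L. (\<Sum>i\<in>S. u j i * cnj (u l i)) = (if j = l then 1 else 0)"
    by auto
  then have u: "\<And>j i. j < L \<Longrightarrow> i \<notin> S \<Longrightarrow> u j i = 0"
     "\<And>j l. j < L \<Longrightarrow> l < M \<Longrightarrow> (\<Sum>i\<in>S. c l i * u j i) = 0"
     "\<And>j l. j < L \<Longrightarrow> l < L \<Longrightarrow> (\<Sum>i\<in>S. u j i * cnj (u l i)) = (if j = l then 1 else 0)"
    by blast+
  define d where "d l i = (if l < M then c l i else cnj (u (l - M) i))" for l i
  from homogeneous_system[of "M + L" S d] assms Suc.prems
  obtain x where x: "\<exists>i\<in>S. x i \<noteq> 0" "\<forall>i. i \<notin> S \<longrightarrow> x i = 0"
    "\<forall>j<M + L. (\<Sum>i\<in>S. d j i * x i) = 0" by auto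
  have x1: "(\<Sum>i\<in>S. c l i * x i) = 0" if "l < M" for l
    using x(3) that by (auto simp: d_def dest: spec[of _ l])
  have x2: "(\<Sum>i\<in>S. x i * cnj (u l i)) = 0" if "l < L" for l
    using x(3) that by (auto simp: d_def mult.commute dest: spec[of _ "M + l"])
  then have x3: "(\<Sum>i\<in>S. u l i * cnj (x i)) = 0" if "l < L" for l
    using arg_cong[OF x2[OF that], of cnj] by (simp add: mult.commute)
  define N where "N = (\<Sum>i\<in>S. (cmod (x i))\<^sup>2)"
  obtain i0 where i0: "i0 \<in> S" "x i0 \<noteq> 0" using x(1) by blast
  have N: "N > 0" unfolding N_def
    by (rule sum_pos2[OF assms(1) i0(1)]) (use i0 in auto)
  have xx: "(\<Sum>i\<in>S. x i * cnj (x i)) = of_real N"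
    unfolding N_def of_real_sum complex_norm_square ..
  define s where "s = complex_of_real (1 / sqrt N)"
  define u' where "u' = u(L := (\<lambda>i. s * x i))"
  have s: "s * (cnj s * of_real N) = 1"
    using N by (simp add: s_def flip: of_real_mult)
  have [simp]: "u' j = u j" if "j < L" for j using that by (simp add: u'_def)
  have [simp]: "u' L = (\<lambda>i. s * x i)" by (simp add: u'_def)
  have pull: "(\<Sum>i\<in>S. f i * (s * x i)) = s * (\<Sum>i\<in>S. f i * x i)"
     "(\<Sum>i\<in>S. s * x i * f i) = s * (\<Sum>i\<in>S. x i * f i)"
     "(\<Sum>i\<in>S. f i * (cnj s * cnj (x i))) = cnj s * (\<Sum>i\<in>S. f i * cnj (x i))"
     "(\<Sum>i\<in>S. s * x i * (cnj s * cnj (x i))) = s * cnj s * (\<Sum>i\<in>S. x i * cnj (x i))" for f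
    by (simp_all add: sum_distrib_left mult_ac)
  have "(\<forall>i. i \<notin> S \<longrightarrow> u' j i = 0) \<and> (\<forall>l<M. (\<Sum>i\<in>S. c l i * u' j i) = 0)" if "j < Suc L" for j
    using that u x(2) x1 by (cases "j = L") (auto simp: pull)
  moreover have "(\<Sum>i\<in>S. u' j i * cnj (u' l i)) = (if j = l then 1 else 0)"
    if "j < Suc L" "l < Suc L" for j l
    using that u(3) x2 x3 s xx by (cases "j = L"; cases "l = L") (auto simp: pull)
  ultimately show ?case by (intro exI[of _ u']) blast
qed

lemma hf_pos_support:
  assumes "a \<le> k" "\<And>i. i \<notin> {..<a} \<Longrightarrow> u i = 0"
  shows "hf a k u w = (\<Sum>i<a. u i * cnj (w i))" "hf a k w u = (\<Sum>i<a. w i * cnj (u i))"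
proof -
  show "hf a k u w = (\<Sum>i<a. u i * cnj (w i))"
    unfolding hf_def by (rule sum.mono_neutral_cong_right) (use assms in auto)
  show "hf a k w u = (\<Sum>i<a. w i * cnj (u i))"
    unfolding hf_def by (rule sum.mono_neutral_cong_right) (use assms in auto)
qed

lemma hf_neg_support:
  assumes "\<And>i. i \<notin> {a..<k} \<Longrightarrow> u i = 0"
  shows "hf a k u w = - (\<Sum>i=a..<k. u i * cnj (w i))" "hf a k w u = - (\<Sum>i=a..<k. w i * cnj (u i))"
proof -
  have "hf a k u w = (\<Sum>i=a..<k. - (u i * cnj (w i)))"
    unfolding hf_def by (rule sum.mono_neutral_cong_right) (use assms in auto)
  then show "hf a k u w = - (\<Sum>i=a..<k. u i * cnj (w i))" by (simp add: sum_negf)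
  have "hf a k w u = (\<Sum>i=a..<k. - (w i * cnj (u i)))"
    unfolding hf_def by (rule sum.mono_neutral_cong_right) (use assms in auto)
  then show "hf a k w u = - (\<Sum>i=a..<k. w i * cnj (u i))" by (simp add: sum_negf)
qed

text \<open>On vectors supported in the first \<open>a\<close> coordinates the form is the Euclidean
  product, and orthogonality to each \<open>b l\<close> is one linear equation. The negative block
  below behaves in the same way with the opposite sign.\<close>

lemma positive_orthonormal_vectors:
  assumes "a \<le> k" "M + L \<le> a"
  obtains u where "\<And>j i. j < L \<Longrightarrow> a \<le> i \<Longrightarrow> u j i = 0"
    "\<And>j l. j < L \<Longrightarrow> l < M \<Longrightarrow> hf a k (u j) (b l) = 0"
    "\<And>j l. j < L \<Longrightarrow> l < L \<Longrightarrow> hf a k (u j) (u l) = (if j = l then 1 else 0)"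
proof -
  from orthonormal_vectors[of "{..<a}" M L "\<lambda>l i. cnj (b l i)"] assms(2)
  obtain u where u: "\<forall>j<L. (\<forall>i. i \<notin> {..<a} \<longrightarrow> u j i = 0) \<and> (\<forall>l<M. (\<Sum>i<a. cnj (b l i) * u j i) = 0)"
     "\<forall>j<L. \<forall>l<L. (\<Sum>i<a. u j i * cnj (u l i)) = (if j = l then 1 else 0)" by auto
  have "hf a k (u j) w = (\<Sum>i<a. u j i * cnj (w i))" if "j < L" for j w
    using hf_pos_support(1)[OF assms(1)] u(1) that by simp
  then show ?thesis using u by (intro that[of u]) (auto simp: mult.commute)
qed

lemma negative_orthonormal_vectors:
  assumes "M + L \<le> k - a"
  obtains u where "\<And>j i. j < L \<Longrightarrow> i \<notin> {a..<k} \<Longrightarrow> u j i = 0"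
    "\<And>j l. j < L \<Longrightarrow> l < M \<Longrightarrow> hf a k (u j) (b l) = 0"
    "\<And>j l. j < L \<Longrightarrow> l < L \<Longrightarrow> hf a k (u j) (u l) = (if j = l then - 1 else 0)"
proof -
  from orthonormal_vectors[of "{a..<k}" M L "\<lambda>l i. cnj (b l i)"] assms
  obtain u where u: "\<forall>j<L. (\<forall>i. i \<notin> {a..<k} \<longrightarrow> u j i = 0) \<and> (\<forall>l<M. (\<Sum>i=a..<k. cnj (b l i) * u j i) = 0)"
     "\<forall>j<L. \<forall>l<L. (\<Sum>i=a..<k. u j i * cnj (u l i)) = (if j = l then 1 else 0)" by auto
  have "hf a k (u j) w = - (\<Sum>i=a..<k. u j i * cnj (w i))" if "j < L" for j w
    using hf_neg_support(1)[of a k "u j"] u(1) that by simp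
  then show ?thesis using u by (intro that[of u]) (auto simp: mult.commute)
qed

section \<open>Holomorphy along curves\<close>

text \<open>Polydiscs form a base of the topology of \<open>cvec N\<close> and meet every complex
  line in a convex open set. This reduces the identity theorem to one variable.\<close>

definition box_nbhd :: "nat \<Rightarrow> (nat \<Rightarrow> complex) \<Rightarrow> real \<Rightarrow> (nat \<Rightarrow> complex) set" where
  "box_nbhd N p d = {z \<in> cvec N. \<forall>i<N. cmod (z i - p i) < d}"

lemma box_nbhd_cvec: "z \<in> box_nbhd N p d \<Longrightarrow> z \<in> cvec N"
  by (simp add: box_nbhd_def)

lemma box_nbhd_center: "p \<in> cvec N \<Longrightarrow> 0 < d \<Longrightarrow> p \<in> box_nbhd N p d"
  by (simp add: box_nbhd_def)

lemma cvec_line: "b \<in> cvec N \<Longrightarrow> v \<in> cvec N \<Longrightarrow> (\<lambda>i. b i + t * v i) \<in> cvec N"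
  by (simp add: cvec_def)

lemma open_line_box:
  assumes "b \<in> cvec N" "v \<in> cvec N"
  shows "open {t. (\<lambda>i. b i + t * v i) \<in> box_nbhd N p d}"
proof -
  have "{t. (\<lambda>i. b i + t * v i) \<in> box_nbhd N p d} = (\<Inter>i\<in>{..<N}. {t. cmod (b i + t * v i - p i) < d})"
    using cvec_line[OF assms] by (auto simp: box_nbhd_def)
  also have "open \<dots>"
    by (intro open_INT ballI open_Collect_less continuous_intros) auto
  finally show ?thesis .
qed

lemma convex_line_box:
  assumes "b \<in> cvec N" "v \<in> cvec N"
  shows "convex {t. (\<lambda>i. b i + t * v i) \<in> box_nbhd N p d}"
proof -
  have "{t. (\<lambda>i. b i + t * v i) \<in> box_nbhd N p d} = (\<Inter>i\<in>{..<N}. {t. cmod (b i + t * v i - p i) < d})"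
    using cvec_line[OF assms] by (auto simp: box_nbhd_def)
  moreover have "convex {t. cmod (b i + t * v i - p i) < d}" for i
  proof -
    have "{t. cmod (b i + t * v i - p i) < d} = (\<lambda>t. t * v i) -` ball (p i - b i) d"
      by (auto simp: dist_norm norm_minus_commute algebra_simps)
    moreover have "linear (\<lambda>t. t * v i)"
      by (simp add: bounded_linear.linear bounded_linear_mult_left)
    ultimately show ?thesis by (simp add: convex_linear_vimage)
  qed
  ultimately show ?thesis by (simp add: convex_INT)
qed

lemma line_box_ball:
  assumes "b \<in> box_nbhd N p d" "v \<in> cvec N"
  obtains e where "e > 0" "\<And>t. cmod t < e \<Longrightarrow> (\<lambda>i. b i + t * v i) \<in> box_nbhd N p d"
proof -
  have "0 \<in> {t. (\<lambda>i. b i + t * v i) \<in> box_nbhd N p d}" using assms(1) by simp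
  with open_line_box[OF box_nbhd_cvec[OF assms(1)] assms(2)]
  obtain e where "e > 0" "ball 0 e \<subseteq> {t. (\<lambda>i. b i + t * v i) \<in> box_nbhd N p d}"
    by (meson open_contains_ball)
  then show ?thesis using that[of e] by (auto simp: subset_iff)
qed

lemma openin_box_nbhd: "openin (top_of_set (cvec N)) (box_nbhd N p d)"
proof -
  have "box_nbhd N p d = cvec N \<inter> (\<Inter>i\<in>{..<N}. {z. cmod (z i - p i) < d})"
    by (auto simp: box_nbhd_def)
  moreover have "open (\<Inter>i\<in>{..<N}. {z. cmod (z i - p i) < d})"
    by (intro open_INT ballI open_Collect_less continuous_intros continuous_on_product_coordinates) auto
  ultimately show ?thesis by (simp only: openin_open_Int)
qed

lemma openin_cvec_contains_box:
  assumes "openin (top_of_set (cvec N)) S" "p \<in> S"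
  obtains d where "d > 0" "box_nbhd N p d \<subseteq> S"
proof -
  obtain T where T: "open T" "S = cvec N \<inter> T" using assms(1) by (auto simp: openin_open)
  have "openin (product_topology (\<lambda>_. euclidean) UNIV) T"
    using T(1) by (simp add: open_fun_def)
  moreover have "p \<in> T" using T(2) assms(2) by simp
  ultimately have "\<exists>X. p \<in> (\<Pi>\<^sub>E i\<in>UNIV. X i) \<and> (\<forall>i. openin euclidean (X i)) \<and> (\<Pi>\<^sub>E i\<in>UNIV. X i) \<subseteq> T"
    using product_topology_open_contains_basis[of "\<lambda>_. euclidean" UNIV T p] by blast
  then obtain X where X: "p \<in> (\<Pi>\<^sub>E i\<in>UNIV. X i)" "\<And>i. openin euclidean (X i)"
     "(\<Pi>\<^sub>E i\<in>UNIV. X i) \<subseteq> T"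
    by auto
  have "\<exists>e>0. ball (p i) e \<subseteq> X i" for i
    using X(1) X(2)[of i] by (auto simp: PiE_iff open_contains_ball)
  then obtain e where e: "\<And>i. e i > 0" "\<And>i. ball (p i) (e i) \<subseteq> X i" by metis
  \<comment> \<open>Only the first \<open>N\<close> factors constrain members of
    \<open>cvec N\<close>; the \<open>1\<close> keeps the set nonempty for
    \<open>N = 0\<close>.\<close>
  define d where "d = Min (insert 1 (e ` {..<N}))"
  have d: "d > 0" unfolding d_def using e(1) by (subst Min_gr_iff) auto
  have de: "d \<le> e i" if "i < N" for i unfolding d_def using that by (intro Min_le) auto
  have pc: "p i = 0" if "i \<ge> N" for i using assms(2) T(2) that by (auto simp: cvec_def)
  have "z \<in> S" if z: "z \<in> box_nbhd N p d" for z
  proof -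
    have "z i \<in> X i" for i
    proof (cases "i < N")
      case True
      then have "z i \<in> ball (p i) (e i)"
        using z de[OF True] by (auto simp: box_nbhd_def dist_norm norm_minus_commute)
      then show ?thesis using e(2) by blast
    next
      case False
      then have "z i = p i" using z pc[of i] by (auto simp: box_nbhd_def cvec_def)
      then show ?thesis using X(1) by (auto simp: PiE_iff)
    qed
    then have "z \<in> T" using X(3) by (auto simp: PiE_iff)
    then show ?thesis using T(2) z by (auto simp: box_nbhd_def)
  qed
  then show ?thesis using that[of d] d by blast
qed

text \<open>A chain rule along holomorphic curves is all that is needed of holomorphy in several variables.\<close>

definition has_curve_derivative ::
  "nat \<Rightarrow> (nat \<Rightarrow> complex) set \<Rightarrow> ((nat \<Rightarrow> complex) \<Rightarrow> complex) \<Rightarrow> (nat \<Rightarrow> complex) \<Rightarrow> (nat \<Rightarrow> complex) \<Rightarrow> bool" where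
  "has_curve_derivative N D \<phi> z a \<longleftrightarrow> (\<forall>g g' t\<^sub>0.
     (\<forall>i<N. ((\<lambda>t::complex. g t i) has_field_derivative g' i) (at t\<^sub>0)) \<longrightarrow> g t\<^sub>0 = z \<longrightarrow>
     (\<forall>\<^sub>F t in nhds t\<^sub>0. g t \<in> D) \<longrightarrow>
     ((\<lambda>t. \<phi> (g t)) has_field_derivative (\<Sum>i<N. a i * g' i)) (at t\<^sub>0))"

definition hol_on :: "nat \<Rightarrow> (nat \<Rightarrow> complex) set \<Rightarrow> ((nat \<Rightarrow> complex) \<Rightarrow> complex) \<Rightarrow> bool" where
  "hol_on N D \<phi> \<longleftrightarrow> (\<forall>z\<in>D. \<exists>a. has_curve_derivative N D \<phi> z a)"

lemma has_curve_derivativeD: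
  assumes "has_curve_derivative N D \<phi> z a"
    and "\<And>i. i < N \<Longrightarrow> ((\<lambda>t. g t i) has_field_derivative g' i) (at t\<^sub>0)" "g t\<^sub>0 = z" "\<forall>\<^sub>F t in nhds t\<^sub>0. g t \<in> D"
  shows "((\<lambda>t. \<phi> (g t)) has_field_derivative (\<Sum>i<N. a i * g' i)) (at t\<^sub>0)"
  using assms unfolding has_curve_derivative_def by blast

lemma has_curve_derivativeI:
  assumes "\<And>g g' t\<^sub>0. (\<And>i. i < N \<Longrightarrow> ((\<lambda>t. g t i) has_field_derivative g' i) (at t\<^sub>0)) \<Longrightarrow> g t\<^sub>0 = z \<Longrightarrow>
    \<forall>\<^sub>F t in nhds t\<^sub>0. g t \<in> D \<Longrightarrow> ((\<lambda>t. \<phi> (g t)) has_field_derivative (\<Sum>i<N. a i * g' i)) (at t\<^sub>0)"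
  shows "has_curve_derivative N D \<phi> z a"
  using assms unfolding has_curve_derivative_def by simp

lemma hol_on_subset:
  assumes "hol_on N D \<phi>" "D' \<subseteq> D"
  shows "hol_on N D' \<phi>"
  unfolding hol_on_def
proof
  fix z assume "z \<in> D'"
  then obtain a where a: "has_curve_derivative N D \<phi> z a" using assms unfolding hol_on_def by blast
  have "has_curve_derivative N D' \<phi> z a"
  proof (rule has_curve_derivativeI)
    fix g g' t\<^sub>0
    assume g: "\<And>i. i < N \<Longrightarrow> ((\<lambda>t. g t i) has_field_derivative g' i) (at t\<^sub>0)" "g t\<^sub>0 = z"
      "\<forall>\<^sub>F t in nhds t\<^sub>0. g t \<in> D'"
    have "\<forall>\<^sub>F t in nhds t\<^sub>0. g t \<in> D"
      by (rule eventually_mono[OF g(3)]) (use assms(2) in blast)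
    then show "((\<lambda>t. \<phi> (g t)) has_field_derivative (\<Sum>i<N. a i * g' i)) (at t\<^sub>0)"
      using has_curve_derivativeD[OF a, of g g' t\<^sub>0] g(1,2) by blast
  qed
  then show "\<exists>a. has_curve_derivative N D' \<phi> z a" by blast
qed

lemma hol_on_curve:
  assumes "hol_on N D \<phi>" "open T" "\<And>i. i < N \<Longrightarrow> (\<lambda>t. g t i) holomorphic_on T"
    "\<And>t. t \<in> T \<Longrightarrow> g t \<in> D"
  shows "(\<lambda>t. \<phi> (g t)) holomorphic_on T"
proof -
  have "\<exists>d. ((\<lambda>t. \<phi> (g t)) has_field_derivative d) (at t)" if t: "t \<in> T" for t
  proof -
    have 1: "((\<lambda>t. g t i) has_field_derivative deriv (\<lambda>t. g t i) t) (at t)" if "i < N" for i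
      by (rule holomorphic_derivI[OF assms(3)[OF that] assms(2) t])
    have 2: "\<forall>\<^sub>F t in nhds t. g t \<in> D"
      using eventually_nhds_in_open[OF assms(2) t] by (rule eventually_mono) (use assms(4) in auto)
    obtain a where "has_curve_derivative N D \<phi> (g t) a"
      using assms(1) assms(4)[OF t] unfolding hol_on_def by blast
    from has_curve_derivativeD[OF this 1 refl 2] show ?thesis by blast
  qed
  then show ?thesis by (meson assms(2) field_differentiable_def holomorphic_on_open)
qed

lemma hol_on_line:
  assumes "hol_on N (box_nbhd N p d) \<phi>" "b \<in> cvec N" "v \<in> cvec N"
  shows "(\<lambda>t. \<phi> (\<lambda>i. b i + t * v i)) holomorphic_on {t. (\<lambda>i. b i + t * v i) \<in> box_nbhd N p d}"
  by (rule hol_on_curve[OF assms(1) open_line_box[OF assms(2,3)]]) (auto intro!: holomorphic_intros)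

lemma hol_on_linear_derivative:
  assumes "hol_on N (box_nbhd N p d) \<phi>" "b \<in> box_nbhd N p d"
  obtains a where "\<And>v. v \<in> cvec N \<Longrightarrow>
    ((\<lambda>t. \<phi> (\<lambda>i. b i + t * v i)) has_field_derivative (\<Sum>i<N. a i * v i)) (at 0)"
proof -
  obtain a where a: "has_curve_derivative N (box_nbhd N p d) \<phi> b a"
    using assms unfolding hol_on_def by blast
  show ?thesis
  proof (rule that)
    fix v :: "nat \<Rightarrow> complex" assume v: "v \<in> cvec N"
    have "open {t. (\<lambda>i. b i + t * v i) \<in> box_nbhd N p d}"
      using open_line_box box_nbhd_cvec[OF assms(2)] v by blast
    from eventually_nhds_in_open[OF this, of 0]
    have "\<forall>\<^sub>F t in nhds 0. (\<lambda>i. b i + t * v i) \<in> box_nbhd N p d" using assms(2) by simp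
    then show "((\<lambda>t. \<phi> (\<lambda>i. b i + t * v i)) has_field_derivative (\<Sum>i<N. a i * v i)) (at 0)"
      by (intro has_curve_derivativeD[OF a]) (auto intro!: derivative_eq_intros)
  qed
qed

lemma holo_fun_imp_hol_on:
  assumes T: "T \<subseteq> cvec N" and "holo_fun N T \<phi>"
  shows "hol_on N T \<phi>"
  unfolding hol_on_def
proof
  fix z assume z: "z \<in> T"
  from assms(2) z obtain a where a: "((\<lambda>w. cmod (\<phi> w - \<phi> z - (\<Sum>i<N. a i * (w i - z i))) / cnorm N (\<lambda>i. w i - z i))
           \<longlongrightarrow> 0) (at z within T)" unfolding holo_fun_def by blast
  define E where "E w = cmod (\<phi> w - \<phi> z - (\<Sum>i<N. a i * (w i - z i))) / cnorm N (\<lambda>i. w i - z i)" for w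
  \<comment> \<open>This value makes the remainder quotient continuous at \<open>z\<close>, so its
    limit can be composed with a curve that may return to \<open>z\<close>.\<close>
  have E0: "E z = 0" by (simp add: E_def)
  have Ez: "(E \<longlongrightarrow> E z) (at z within T)" using a unfolding E0 unfolding E_def .
  then have Ec: "continuous (at z within T) E" by (simp add: continuous_within)
  have "has_curve_derivative N T \<phi> z a"
  proof (rule has_curve_derivativeI)
    fix g g' t\<^sub>0
    assume g: "\<And>i. i < N \<Longrightarrow> ((\<lambda>t. g t i) has_field_derivative g' i) (at t\<^sub>0)" "g t\<^sub>0 = z"
      "\<forall>\<^sub>F t in nhds t\<^sub>0. g t \<in> T"
    have gT: "\<forall>\<^sub>F t in at t\<^sub>0. g t \<in> T"
      using g(3) by (auto simp: eventually_at_filter elim: eventually_mono)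
    have lim_i: "((\<lambda>t. g t i) \<longlongrightarrow> z i) (at t\<^sub>0)" for i
    proof (cases "i < N")
      case True
      then have "isCont (\<lambda>t. g t i) t\<^sub>0" using g(1) DERIV_isCont by blast
      then show ?thesis using g(2) by (simp add: isCont_def)
    next
      case False
      have "\<forall>\<^sub>F t in at t\<^sub>0. g t i = z i"
        using gT
      proof (rule eventually_mono)
        fix t assume "g t \<in> T"
        then have "g t \<in> cvec N" "z \<in> cvec N" using T z by auto
        then show "g t i = z i" using False by (simp add: cvec_def)
      qed
      then show ?thesis by (rule tendsto_eventually)
    qed
    have "(g \<longlongrightarrow> z) (at t\<^sub>0)"
      using lim_i limitin_componentwise[of "\<lambda>_. euclidean" UNIV g z "at t\<^sub>0"]
      by (simp add: euclidean_product_topology)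
    then have "((\<lambda>t. E (g t)) \<longlongrightarrow> E z) (at t\<^sub>0)"
      by (rule continuous_within_tendsto_compose[OF Ec gT])
    then have E: "((\<lambda>t. E (g t)) \<longlongrightarrow> 0) (at t\<^sub>0)" by (simp add: E0)
    have q: "((\<lambda>t. (g t i - z i) / (t - t\<^sub>0)) \<longlongrightarrow> g' i) (at t\<^sub>0)" if "i < N" for i
      using g(1,2) that unfolding has_field_derivative_iff by auto
    have B: "((\<lambda>t. E (g t) * (\<Sum>i<N. cmod ((g t i - z i) / (t - t\<^sub>0)))) \<longlongrightarrow> 0 * (\<Sum>i<N. cmod (g' i))) (at t\<^sub>0)"
      by (intro tendsto_intros E q) auto
    have R: "((\<lambda>t. (\<phi> (g t) - \<phi> z - (\<Sum>i<N. a i * (g t i - z i))) / (t - t\<^sub>0)) \<longlongrightarrow> 0) (at t\<^sub>0)"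
    proof (rule Lim_null_comparison)
      show "((\<lambda>t. E (g t) * (\<Sum>i<N. cmod ((g t i - z i) / (t - t\<^sub>0)))) \<longlongrightarrow> 0) (at t\<^sub>0)"
        using B by simp
      show "\<forall>\<^sub>F t in at t\<^sub>0. cmod ((\<phi> (g t) - \<phi> z - (\<Sum>i<N. a i * (g t i - z i))) / (t - t\<^sub>0))
          \<le> E (g t) * (\<Sum>i<N. cmod ((g t i - z i) / (t - t\<^sub>0)))"
        using gT
      proof (rule eventually_mono)
        fix t assume t: "g t \<in> T"
        let ?c = "cnorm N (\<lambda>i. g t i - z i)"
        have c: "?c \<le> (\<Sum>i<N. cmod (g t i - z i))"
          unfolding cnorm_def using L2_set_le_sum_abs[of "\<lambda>i. cmod (g t i - z i)" "{..<N}"] by simp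
        have c0: "?c \<ge> 0" by (simp add: cnorm_def)
        have E1: "cmod (\<phi> (g t) - \<phi> z - (\<Sum>i<N. a i * (g t i - z i))) = E (g t) * ?c"
        proof (cases "?c = 0")
          case True
          then have "\<forall>i<N. g t i = z i" unfolding cnorm_def by (simp add: L2_set_eq_0_iff)
          then have "g t = z" using t z T by (auto simp: fun_eq_iff cvec_def subset_iff) (metis not_le)
          then show ?thesis using E0 by simp
        next
          case False
          then show ?thesis by (simp add: E_def)
        qed
        have "E (g t) \<ge> 0" using c0 by (simp add: E_def)
        then have "cmod (\<phi> (g t) - \<phi> z - (\<Sum>i<N. a i * (g t i - z i))) \<le> E (g t) * (\<Sum>i<N. cmod (g t i - z i))"
          unfolding E1 using c by (rule mult_left_mono[rotated])
        then have "cmod (\<phi> (g t) - \<phi> z - (\<Sum>i<N. a i * (g t i - z i))) / cmod (t - t\<^sub>0)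
            \<le> E (g t) * (\<Sum>i<N. cmod (g t i - z i)) / cmod (t - t\<^sub>0)"
          by (rule divide_right_mono) simp
        then show "cmod ((\<phi> (g t) - \<phi> z - (\<Sum>i<N. a i * (g t i - z i))) / (t - t\<^sub>0))
          \<le> E (g t) * (\<Sum>i<N. cmod ((g t i - z i) / (t - t\<^sub>0)))"
          by (simp add: norm_divide sum_divide_distrib[symmetric])
      qed
    qed
    have S: "((\<lambda>t. \<Sum>i<N. a i * ((g t i - z i) / (t - t\<^sub>0))) \<longlongrightarrow> (\<Sum>i<N. a i * g' i)) (at t\<^sub>0)"
      by (intro tendsto_intros q) auto
    have "((\<lambda>t. (\<phi> (g t) - \<phi> z - (\<Sum>i<N. a i * (g t i - z i))) / (t - t\<^sub>0)
        + (\<Sum>i<N. a i * ((g t i - z i) / (t - t\<^sub>0)))) \<longlongrightarrow> 0 + (\<Sum>i<N. a i * g' i)) (at t\<^sub>0)"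
      by (intro tendsto_add R S)
    moreover have "(\<phi> (g t) - \<phi> z - (\<Sum>i<N. a i * (g t i - z i))) / (t - t\<^sub>0)
        + (\<Sum>i<N. a i * ((g t i - z i) / (t - t\<^sub>0))) = (\<phi> (g t) - \<phi> (g t\<^sub>0)) / (t - t\<^sub>0)" for t
      by (simp only: g(2) times_divide_eq_right sum_divide_distrib[symmetric] add_divide_distrib[symmetric] diff_add_cancel)
    ultimately show "((\<lambda>t. \<phi> (g t)) has_field_derivative (\<Sum>i<N. a i * g' i)) (at t\<^sub>0)"
      unfolding has_field_derivative_iff by simp
  qed
  then show "\<exists>a. has_curve_derivative N T \<phi> z a" by blast
qed

section \<open>The Hopf lemma and polarization, by functions of one variable\<close>

text \<open>At a zero of order \<open>n \<ge> 2\<close> the leading term spreads the right half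
  plane over an angle of at least a full turn, so the real part becomes negative in some direction.
  Hence the zero is simple; \<open>t1\<close> excludes that \<open>H\<close> vanishes
  identically.\<close>

lemma hopf_half_plane:
  assumes hol: "H holomorphic_on ball 0 \<rho>" and "\<rho> > 0" "H 0 = 0"
    and nonneg: "\<And>t. t \<in> ball 0 \<rho> \<Longrightarrow> 0 < Re t \<Longrightarrow> 0 \<le> Re (H t)"
    and t1: "t1 \<in> ball 0 \<rho>" "H t1 \<noteq> 0"
  shows "\<not> (H has_field_derivative 0) (at 0)"
proof -
  have nc: "\<not> H constant_on ball 0 \<rho>"
    unfolding constant_on_def using assms(2,3) t1 by (metis centre_in_ball)
  have 0: "0 \<in> ball 0 \<rho>" using assms(2) by simp
  obtain g r n where g: "0 < n" "0 < r" "ball 0 r \<subseteq> ball (0::complex) \<rho>" "g holomorphic_on ball 0 r"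
      "\<And>w. w \<in> ball 0 r \<Longrightarrow> H w = w ^ n * g w" "\<And>w. w \<in> ball 0 r \<Longrightarrow> g w \<noteq> 0"
    by (rule holomorphic_factor_zero_nonconstant[OF hol open_ball connected_ball 0 assms(3) nc, unfolded diff_zero])
      blast
  have gc: "isCont g 0"
    using g(2,4) holomorphic_on_imp_continuous_on continuous_on_interior
    by (metis centre_in_ball interior_ball)
  have "n = 1"
  proof (rule ccontr)
    assume "n \<noteq> 1"
    then have n: "n \<ge> 2" using g(1) by simp
    define \<theta> where "\<theta> = Arg (g 0)"
    have g0: "g 0 = of_real (cmod (g 0)) * cis \<theta>" "g 0 \<noteq> 0"
      using g(2,6) by (auto simp: \<theta>_def rcis_def[symmetric] rcis_cmod_Arg)
    have \<theta>: "-pi < \<theta>" "\<theta> \<le> pi" using Arg_bounded unfolding \<theta>_def by auto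
    \<comment> \<open>\<open>n * \<psi> + \<theta>\<close> goes nine tenths of the way from
      \<open>\<theta>\<close> to the nearer of \<open>pi\<close> and \<open>- pi\<close>: far enough
      for a negative cosine, while stopping short keeps \<open>\<psi>\<close> strictly inside the
      half plane even for \<open>n = 2\<close> and \<open>\<theta> = 0\<close>.\<close>
    define \<psi> where "\<psi> = (if \<theta> \<ge> 0 then (pi - \<theta>) * (9 / 10) / n else - ((pi + \<theta>) * (9 / 10) / n))"
    have psi: "n * \<psi> = (if \<theta> \<ge> 0 then (pi - \<theta>) * (9 / 10) else - ((pi + \<theta>) * (9 / 10)))"
      using n by (simp add: \<psi>_def)
    have "\<bar>\<psi>\<bar> < pi / 2"
    proof -
      have "2 * \<bar>\<psi>\<bar> \<le> n * \<bar>\<psi>\<bar>" using n by (intro mult_right_mono) auto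
      also have "\<dots> = \<bar>n * \<psi>\<bar>" by (simp add: abs_mult)
      also have "\<dots> < pi" unfolding psi using \<theta> pi_gt_zero by (auto simp: abs_if)
      finally show ?thesis by simp
    qed
    then have cpos: "cos \<psi> > 0" by (intro cos_gt_zero_pi) auto
    have "cos (n * \<psi> + \<theta>) < 0"
    proof (cases "\<theta> \<ge> 0")
      case True
      have "cos (pi - (n * \<psi> + \<theta>)) > 0"
        unfolding psi if_P[OF True] left_diff_distrib
        by (intro cos_gt_zero_pi) (use True \<theta> pi_gt_zero in linarith)+
      then show ?thesis by simp
    next
      case False
      have "cos (pi + (n * \<psi> + \<theta>)) > 0"
        unfolding psi using False \<theta> pi_gt_zero by (intro cos_gt_zero_pi) (auto simp: field_simps)
      then show ?thesis by simp
    qed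
    moreover have "cis \<psi> ^ n * (of_real c * cis \<theta>) = of_real c * cis (n * \<psi> + \<theta>)" for c
      by (simp add: Complex.DeMoivre cis_mult mult.left_commute)
    from this[of "cmod (g 0)"] have "Re (cis \<psi> ^ n * g 0) = cmod (g 0) * cos (n * \<psi> + \<theta>)"
      unfolding g0(1)[symmetric] by simp
    ultimately have neg: "Re (cis \<psi> ^ n * g 0) < 0"
      using g0(2) by (simp add: mult_pos_neg)
    have "((\<lambda>s::real. Re (cis \<psi> ^ n * g (of_real s * cis \<psi>))) \<longlongrightarrow> Re (cis \<psi> ^ n * g (of_real 0 * cis \<psi>))) (at_right 0)"
    proof (intro tendsto_intros isCont_tendsto_compose[of _ g])
      show "isCont g (of_real 0 * cis \<psi>)" using gc by simp
    qed
    then have "((\<lambda>s::real. Re (cis \<psi> ^ n * g (of_real s * cis \<psi>))) \<longlongrightarrow> Re (cis \<psi> ^ n * g 0)) (at_right 0)"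
      by simp
    from order_tendstoD(2)[OF this neg]
    have ev: "\<forall>\<^sub>F s in at_right (0::real). Re (cis \<psi> ^ n * g (of_real s * cis \<psi>)) < 0" .
    have ev2: "\<forall>\<^sub>F s in at_right (0::real). 0 < s \<and> s < r"
      using g(2) by (auto simp: eventually_at_right_field)
    from eventually_happens[OF eventually_conj[OF ev ev2]]
    obtain s where s: "Re (cis \<psi> ^ n * g (of_real s * cis \<psi>)) < 0" "0 < s" "s < r" by auto
    let ?t = "of_real s * cis \<psi>"
    have t: "?t \<in> ball 0 r" using s by (simp add: norm_mult)
    have "Re (H ?t) = s ^ n * Re (cis \<psi> ^ n * g ?t)"
      unfolding g(5)[OF t] power_mult_distrib mult.assoc of_real_power[symmetric] Re_complex_of_real
      by (simp del: of_real_power)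
    also have "\<dots> < 0" using s by (simp add: mult_pos_neg)
    finally have "Re (H ?t) < 0" .
    moreover have "0 < Re ?t" using s cpos by simp
    ultimately show False using nonneg[of ?t] t g(3) by (auto simp: subset_iff)
  qed
  show ?thesis
  proof
    assume "(H has_field_derivative 0) (at 0)"
    then have "((\<lambda>t. (H t - H 0) / (t - 0)) \<longlongrightarrow> 0) (at 0)" unfolding has_field_derivative_iff .
    moreover have "\<forall>\<^sub>F t in at 0. (H t - H 0) / (t - 0) = g t"
      unfolding eventually_at using g(2,5) \<open>n = 1\<close> assms(3)
      by (intro exI[of _ r]) auto
    ultimately have "(g \<longlongrightarrow> 0) (at 0)" by (rule Lim_transform_eventually)
    then have "g 0 = 0" using gc unfolding isCont_def using LIM_unique by blast
    then show False using g(2,6) by simp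
  qed
qed

lemma hol_on_hf_left:
  assumes "\<And>j. j < N' \<Longrightarrow> hol_on N D (\<lambda>z. F z j)"
  shows "hol_on N D (\<lambda>z. hf a' N' (F z) y)"
  unfolding hol_on_def
proof
  fix z assume z: "z \<in> D"
  have "\<exists>A. \<forall>j<N'. has_curve_derivative N D (\<lambda>z. F z j) z (A j)"
    using assms z unfolding hol_on_def by (intro choice) blast
  then obtain A where A: "\<And>j. j < N' \<Longrightarrow> has_curve_derivative N D (\<lambda>z. F z j) z (A j)" by blast
  define \<sigma> where "\<sigma> j = (if j < a' then 1 else - 1) * cnj (y j)" for j
  have eq: "hf a' N' x y = (\<Sum>j<N'. \<sigma> j * x j)" for x
    unfolding hf_def \<sigma>_def by (rule sum.cong) auto
  have "has_curve_derivative N D (\<lambda>z. hf a' N' (F z) y) z (\<lambda>i. \<Sum>j<N'. \<sigma> j * A j i)"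
  proof (rule has_curve_derivativeI)
    fix g g' t\<^sub>0
    assume g: "\<And>i. i < N \<Longrightarrow> ((\<lambda>t. g t i) has_field_derivative g' i) (at t\<^sub>0)" "g t\<^sub>0 = z"
      "\<forall>\<^sub>F t in nhds t\<^sub>0. g t \<in> D"
    have "((\<lambda>t. \<Sum>j<N'. \<sigma> j * F (g t) j) has_field_derivative (\<Sum>j<N'. \<sigma> j * (\<Sum>i<N. A j i * g' i))) (at t\<^sub>0)"
      by (intro DERIV_sum DERIV_cmult has_curve_derivativeD[OF A] g) auto
    also have "(\<Sum>j<N'. \<sigma> j * (\<Sum>i<N. A j i * g' i)) = (\<Sum>i<N. (\<Sum>j<N'. \<sigma> j * A j i) * g' i)"
      unfolding sum_distrib_left sum_distrib_right by (subst sum.swap) (simp add: mult.assoc)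
    finally show "((\<lambda>t. hf a' N' (F (g t)) y) has_field_derivative (\<Sum>i<N. (\<Sum>j<N'. \<sigma> j * A j i) * g' i)) (at t\<^sub>0)"
      unfolding eq .
  qed
  then show "\<exists>a. has_curve_derivative N D (\<lambda>z. hf a' N' (F z) y) z a" by blast
qed

lemma norm_hf_le: "cmod (hf a k x y) \<le> (\<Sum>i<k. cmod (x i) * cmod (y i))"
  unfolding hf_def by (rule order_trans[OF norm_sum]) (auto intro!: sum_mono simp: norm_mult)

lemma norm_hf_le_bound:
  assumes "\<And>i. i < k \<Longrightarrow> cmod (x i) \<le> A" "\<And>i. i < k \<Longrightarrow> cmod (y i) \<le> B" "0 \<le> A"
  shows "cmod (hf a k x y) \<le> real k * A * B"
proof -
  have "cmod (hf a k x y) \<le> (\<Sum>i<k. cmod (x i) * cmod (y i))" by (rule norm_hf_le)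
  also have "\<dots> \<le> (\<Sum>i<k. A * B)" by (intro sum_mono mult_mono assms) (auto simp: assms)
  finally show ?thesis by (simp add: mult.assoc)
qed

text \<open>Polarization: if \<^term>\<open>z\<close> and \<^term>\<open>w\<close> are orthogonal, there is a holomorphic curve \<open>g\<close> with \<open>g(\<i>) = z\<close> and
  \<open>g(-\<i>) = w\<close> whose points at real parameters are null. So \<open>hf (F (g t)) (F (g (cnj t)))\<close>, being holomorphic
  in \<open>t\<close> and zero on the real axis, vanishes at \<open>t = \<i>\<close>.\<close>

lemma polarization:
  assumes F: "\<And>j. j < N' \<Longrightarrow> hol_on N (box_nbhd N p d) (\<lambda>z. F z j)"
    and null: "\<And>z. z \<in> box_nbhd N p d \<Longrightarrow> hf a k z z = 0 \<Longrightarrow> hf a' N' (F z) (F z) = 0"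
    and p: "p \<in> cvec N" "hf a k p p = 0" "i0 < k" "p i0 \<noteq> 0" and "d > 0" "k \<le> N"
  shows "\<exists>d'>0. d' \<le> d \<and> (\<forall>z\<in>box_nbhd N p d'. \<forall>w\<in>box_nbhd N p d'.
    hf a k z w = 0 \<longrightarrow> hf a' N' (F z) (F w) = 0)"
proof -
  \<comment> \<open>\<open>p\<close> with its negative part reflected and the radical part dropped:
    a null vector with \<open>hf a k q p\<close> positive. Subtracting multiples of it brings nearby
    vectors back to the null cone.\<close>
  define q where "q = (\<lambda>i. if i < a then p i else if i < k then - p i else 0)"
  have q_cvec: "q \<in> cvec N" using p(1) assms(6) by (auto simp: q_def cvec_def)
  have qq: "hf a k q q = 0"
    using p(2) unfolding hf_def by (subst (asm) sum.cong[OF refl]) (auto simp: q_def)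
  have qp: "hf a k q p = of_real (\<Sum>i<k. (cmod (p i))\<^sup>2)"
    unfolding hf_def of_real_sum by (intro sum.cong) (auto simp: q_def complex_norm_square[symmetric])
  define c0 where "c0 = cmod (hf a k q p)"
  have "0 < (\<Sum>i<k. (cmod (p i))\<^sup>2)" by (rule sum_pos2[of _ i0]) (use p in auto)
  then have c0: "c0 > 0" unfolding c0_def qp norm_of_real by simp
  define M where "M = 1 + (\<Sum>i<N. cmod (p i))"
  have M1: "M \<ge> 1" unfolding M_def by (simp add: sum_nonneg)
  have pM: "cmod (p i) \<le> M" for i
  proof (cases "i < N")
    case True
    then have "cmod (p i) \<le> (\<Sum>i<N. cmod (p i))" by (intro member_le_sum) auto
    then show ?thesis by (simp add: M_def)
  next
    case False
    then show ?thesis using p(1) M1 by (simp add: cvec_def)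
  qed
  have qM: "cmod (q i) \<le> M" for i using pM[of i] M1 by (auto simp: q_def)
  have k: "real k \<ge> 1" using p(3) by linarith
  \<comment> \<open>The bound 1 controls the size of \<open>\<alpha>\<close>, the second keeps
    \<open>den\<close> above \<open>c0 / 2\<close> for \<open>cmod t < 2\<close>, and the third
    keeps the curve in the box of radius \<open>d\<close>. The 15 is 3 from the bound on
    \<open>A\<close> times 5 from that on \<open>1 + t^2\<close>.\<close>
  define d' where "d' = min 1 (min (c0 / (6 * k * M)) (d / (4 + 15 * k * M\<^sup>2 / c0)))"
  have den4: "4 + 15 * k * M\<^sup>2 / c0 > 0" using c0 k M1 by (intro add_pos_nonneg) auto
  have d': "d' > 0" "d' \<le> 1" "d' \<le> c0 / (6 * k * M)" "d' \<le> d / (4 + 15 * k * M\<^sup>2 / c0)"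
    using c0 k M1 den4 \<open>d > 0\<close> by (auto simp: d'_def)
  have d'2: "6 * k * M * d' \<le> c0" using d'(3) k M1 by (simp add: field_simps)
  have d'3: "d' * (4 + 15 * k * M\<^sup>2 / c0) \<le> d" using d'(4) den4 by (simp add: pos_le_divide_eq)
  have "d' * 1 \<le> d' * (4 + 15 * k * M\<^sup>2 / c0)" 
    using d'(1) c0 k M1 by (intro mult_left_mono) auto
  then have d'd: "d' \<le> d" using d'3 by linarith
  have "hf a' N' (F z) (F w) = 0"
    if z: "z \<in> box_nbhd N p d'" and w: "w \<in> box_nbhd N p d'" and zw: "hf a k z w = 0" for z w
  proof -
    \<comment> \<open>The line \<open>\<alpha> + t * \<beta>\<close> passes through \<open>z\<close>
      and \<open>w\<close> at \<open>\<i>\<close> and \<open>- \<i>\<close>. Orthogonality of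
      \<open>z\<close> and \<open>w\<close> is what makes its form \<open>A * (1 + t^2)\<close> at
      real \<open>t\<close>.\<close>
    define \<alpha> where "\<alpha> = (\<lambda>i. (z i + w i) / 2)"
    define \<beta> where "\<beta> = (\<lambda>i. (z i - w i) / (2 * \<i>))"
    define A where "A = hf a k \<alpha> \<alpha>"
    have zw_cvec: "z \<in> cvec N" "w \<in> cvec N" using z w by (auto simp: box_nbhd_def)
    have cv: "\<alpha> \<in> cvec N" "\<beta> \<in> cvec N" using zw_cvec by (auto simp: \<alpha>_def \<beta>_def cvec_def)
    have zd: "cmod (z i - p i) \<le> d'" "cmod (w i - p i) \<le> d'" for i
      using z w p(1) d'(1) by (cases "i < N"; force simp: box_nbhd_def cvec_def)+
    have wz0: "hf a k w z = 0" by (rule hf_zero_sym[OF zw])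
    have zi: "\<alpha> i + \<i> * \<beta> i = z i" "\<alpha> i - \<i> * \<beta> i = w i" for i
      by (simp_all add: \<alpha>_def \<beta>_def field_simps)
    have \<beta>\<beta>: "hf a k \<beta> \<beta> = A"
      unfolding A_def \<alpha>_def \<beta>_def hf_linear zw wz0 by (simp add: field_simps)
    have \<alpha>\<beta>: "hf a k \<alpha> \<beta> + hf a k \<beta> \<alpha> = 0"
      unfolding A_def \<alpha>_def \<beta>_def hf_linear zw wz0 by (simp add: field_simps)
    have a_p: "cmod (\<alpha> i - p i) \<le> d'" for i
    proof -
      have "\<alpha> i - p i = ((z i - p i) + (w i - p i)) / 2" by (simp add: \<alpha>_def field_simps)
      then have "cmod (\<alpha> i - p i) = cmod ((z i - p i) + (w i - p i)) / 2" by (simp only: norm_divide) simp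
      then show ?thesis using norm_triangle_ineq[of "z i - p i" "w i - p i"] zd[of i] by linarith
    qed
    have b_d: "cmod (\<beta> i) \<le> d'" for i
    proof -
      have "cmod (\<beta> i) = cmod ((z i - p i) - (w i - p i)) / 2"
        by (simp add: \<beta>_def norm_divide norm_mult)
      then show ?thesis using norm_triangle_ineq4[of "z i - p i" "w i - p i"] zd[of i] by linarith
    qed
    have aM: "cmod (\<alpha> i) \<le> M + 1" for i
      using norm_triangle_ineq[of "\<alpha> i - p i" "p i"] a_p[of i] pM[of i] d'(2) by simp
    have "A = hf a k (\<lambda>i. \<alpha> i - p i) \<alpha> + hf a k p (\<lambda>i. \<alpha> i - p i)"
      by (simp only: A_def hf_linear p(2)) simp
    then have "cmod A \<le> cmod (hf a k (\<lambda>i. \<alpha> i - p i) \<alpha>) + cmod (hf a k p (\<lambda>i. \<alpha> i - p i))"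
      by (simp only: norm_triangle_ineq)
    also have "\<dots> \<le> real k * d' * (M + 1) + real k * M * d'"
      by (intro add_mono norm_hf_le_bound a_p aM pM) (use d'(1) M1 in auto)
    also have "\<dots> = real k * d' * (2 * M + 1)" by (simp add: algebra_simps)
    also have "\<dots> \<le> real k * d' * (3 * M)" using M1 k d'(1) by (intro mult_left_mono) auto
    finally have Ab: "cmod A \<le> 3 * k * M * d'" by (simp add: mult_ac)
    define den where "den t = hf a k q \<alpha> + t * hf a k q \<beta>" for t
    have den: "cmod (den t) \<ge> c0 / 2" if "cmod t < 2" for t
    proof -
      have "hf a k q p = den t - hf a k q (\<lambda>i. \<alpha> i - p i) - t * hf a k q \<beta>"
        by (simp only: den_def hf_linear) (simp add: algebra_simps)
      then have "c0 \<le> cmod (den t) + cmod (hf a k q (\<lambda>i. \<alpha> i - p i)) + cmod (t * hf a k q \<beta>)"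
        unfolding c0_def using norm_triangle_ineq4[of "den t - hf a k q (\<lambda>i. \<alpha> i - p i)" "t * hf a k q \<beta>"]
          norm_triangle_ineq4[of "den t" "hf a k q (\<lambda>i. \<alpha> i - p i)"] by simp
      moreover have "cmod (hf a k q (\<lambda>i. \<alpha> i - p i)) \<le> real k * M * d'"
        by (intro norm_hf_le_bound a_p qM) (use M1 in auto)
      moreover have "cmod (t * hf a k q \<beta>) \<le> 2 * (real k * M * d')"
        unfolding norm_mult by (intro mult_mono norm_hf_le_bound b_d qM) (use M1 that in auto)
      ultimately show ?thesis using d'2 by linarith
    qed
    \<comment> \<open>Subtracting \<open>c t * q\<close> cancels the form at real \<open>t\<close>,
      as \<open>q\<close> is null. The numerator vanishes at \<open>\<i>\<close> and
      \<open>- \<i>\<close>, so the end points stay fixed, and \<open>den\<close>, being linear in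
      \<open>t\<close>, keeps \<open>c\<close> holomorphic.\<close>
    define c where "c t = A * (1 + t\<^sup>2) / (2 * den t)" for t
    define g where "g t = (\<lambda>i. \<alpha> i + t * \<beta> i - c t * q i)" for t
    have cb: "cmod (c t) \<le> 15 * k * M * d' / c0" if t: "cmod t < 2" for t
    proof -
      have "cmod (1 + t\<^sup>2) \<le> 1 + (cmod t)\<^sup>2"
        using norm_triangle_ineq[of 1 "t\<^sup>2"] by (simp add: norm_power)
      also have "\<dots> \<le> 1 + 2\<^sup>2" using t by (intro add_left_mono power_mono) auto
      finally have t2: "cmod (1 + t\<^sup>2) \<le> 5" by simp
      have "cmod (c t) = cmod A * cmod (1 + t\<^sup>2) / (2 * cmod (den t))"
        by (simp add: c_def norm_divide norm_mult)
      also have "\<dots> \<le> (3 * k * M * d' * 5) / (2 * (c0 / 2))"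
        using Ab t2 den[OF t] c0 d'(1) M1 k
        by (intro frac_le mult_mono mult_nonneg_nonneg) auto
      finally show ?thesis by simp
    qed
    have g_in: "g t \<in> box_nbhd N p d" if t: "cmod t < 2" for t
      unfolding box_nbhd_def
    proof safe
      show "g t \<in> cvec N" using cv q_cvec by (auto simp: g_def cvec_def)
      fix i assume "i < N"
      have geq: "g t i - p i = (\<alpha> i - p i) + t * \<beta> i - c t * q i" by (simp add: g_def)
      have "cmod (g t i - p i) \<le> cmod (\<alpha> i - p i) + cmod (t * \<beta> i) + cmod (c t * q i)"
        unfolding geq using norm_triangle_ineq4[of "(\<alpha> i - p i) + t * \<beta> i" "c t * q i"]
          norm_triangle_ineq[of "\<alpha> i - p i" "t * \<beta> i"] by linarith
      also have "\<dots> \<le> d' + 2 * d' + (15 * k * M * d' / c0) * M"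
        unfolding norm_mult using d'(1) c0 k M1 t
        by (intro add_mono a_p mult_mono b_d cb qM) auto
      also have "\<dots> < d' * (4 + 15 * k * M\<^sup>2 / c0)"
        using d'(1) by (simp add: algebra_simps power2_eq_square)
      also have "\<dots> \<le> d" by (rule d'3)
      finally show "cmod (g t i - p i) < d" .
    qed
    have den0: "den t \<noteq> 0" if "t \<in> ball 0 2" for t
      using den[of t] that c0 by auto
    have "den holomorphic_on ball 0 2" unfolding den_def by (intro holomorphic_intros)
    then have chol: "c holomorphic_on ball 0 2"
      unfolding c_def using den0 by (intro holomorphic_intros) auto
    have ghol: "(\<lambda>t. g t i) holomorphic_on ball 0 2" for i
      unfolding g_def by (intro holomorphic_intros chol)
    have Fg: "(\<lambda>t. F (g t) j) holomorphic_on ball 0 2" if "j < N'" for j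
      by (rule hol_on_curve[OF F[OF that]]) (use g_in ghol in auto)
    have cb2: "cnj ` ball 0 2 = ball (0::complex) 2"
    proof -
      have "x \<in> cnj ` ball 0 2" if "x \<in> ball (0::complex) 2" for x
        using that by (intro image_eqI[of _ _ "cnj x"]) auto
      then show ?thesis by auto
    qed
    have Fg': "(\<lambda>t. cnj (F (g (cnj t)) j)) holomorphic_on ball 0 2" if "j < N'" for j
      using holomorphic_on_compose_cnj_cnj[of "\<lambda>t. F (g t) j" "ball 0 2"] Fg[OF that] cb2
      by (simp add: o_def)
    define \<phi> where "\<phi> t = hf a' N' (F (g t)) (F (g (cnj t)))" for t
    have hol: "\<phi> holomorphic_on ball 0 2"
      unfolding \<phi>_def hf_def by (intro holomorphic_intros Fg Fg') auto
    have zero: "\<phi> t = 0" if t: "t \<in> ball 0 2 \<inter> \<real>" for t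
    proof -
      have ct: "cnj t = t" using t by (simp add: Reals_cnj_iff)
      have Ar: "cnj A = A" by (simp add: A_def hf_cnj)
      have 1: "hf a k q (\<lambda>i. \<alpha> i + t * \<beta> i) = den t"
        by (simp add: hf_linear den_def ct)
      then have 2: "hf a k (\<lambda>i. \<alpha> i + t * \<beta> i) q = cnj (den t)" using hf_cnj by metis
      have "hf a k (\<lambda>i. \<alpha> i + t * \<beta> i) (\<lambda>i. \<alpha> i + t * \<beta> i)
          = A + t * (hf a k \<alpha> \<beta> + hf a k \<beta> \<alpha>) + t\<^sup>2 * A"
        by (simp only: hf_linear \<beta>\<beta> ct) (simp add: A_def algebra_simps power2_eq_square)
      then have 3: "hf a k (\<lambda>i. \<alpha> i + t * \<beta> i) (\<lambda>i. \<alpha> i + t * \<beta> i) = A * (1 + t\<^sup>2)"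
        unfolding \<alpha>\<beta> by (simp add: algebra_simps)
      have cc: "c t * den t = A * (1 + t\<^sup>2) / 2" using den0 t by (simp add: c_def)
      then have cc': "cnj (c t) * cnj (den t) = A * (1 + t\<^sup>2) / 2"
        using arg_cong[OF cc, of cnj] by (simp add: Ar ct)
      have "hf a k (g t) (g t) = A * (1 + t\<^sup>2) - c t * den t - cnj (c t) * cnj (den t)"
        unfolding g_def hf_diff_left hf_diff_right hf_scale_left[of a k "c t"] hf_scale_right[of a k _ "c t"]
          1 2 3 qq by simp
      also have "\<dots> = 0" by (simp add: cc cc')
      finally have "hf a k (g t) (g t) = 0" .
      then show ?thesis unfolding \<phi>_def ct using null g_in t by auto
    qed
    have "\<phi> \<i> = 0"
    proof (rule analytic_continuation[of \<phi> "ball 0 2" "ball 0 2 \<inter> \<real>" 0])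
      show "0 islimpt ball 0 2 \<inter> (\<real> :: complex set)"
        unfolding islimpt_approachable
      proof (intro allI impI)
        fix e :: real assume "e > 0"
        then show "\<exists>x'\<in>ball 0 2 \<inter> (\<real> :: complex set). x' \<noteq> 0 \<and> dist x' 0 < e"
          by (intro bexI[of _ "of_real (min 1 (e / 2))"]) auto
      qed
    qed (use hol zero in auto)
    moreover have "g \<i> = z" "g (- \<i>) = w"
      by (simp_all add: g_def c_def fun_eq_iff zi)
    ultimately show ?thesis by (simp add: \<phi>_def)
  qed
  then show ?thesis using d'(1) d'd by blast
qed

section \<open>Orthogonality-preserving holomorphic maps\<close>

lemma eventually_line_box:
  assumes "b \<in> box_nbhd N p d" "v \<in> cvec N"
  shows "\<forall>\<^sub>F t in nhds 0. (\<lambda>i. b i + t * v i) \<in> box_nbhd N p d"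
  using line_box_ball[OF assms] unfolding eventually_nhds_metric dist_norm
  by (metis diff_zero)

lemma DERIV_eventually_zero:
  fixes f :: "complex \<Rightarrow> complex"
  assumes "(f has_field_derivative D) (at x)" "\<forall>\<^sub>F t in nhds x. f t = 0"
  shows "D = 0"
proof -
  have "((\<lambda>_. 0) has_field_derivative D) (at x)"
    using assms by (subst DERIV_cong_ev[symmetric]) auto
  then show ?thesis using DERIV_unique DERIV_const by blast
qed

text \<open>\<open>v\<close> is the positive part of \<open>y\<close> divided by its squared length.
  So vectors of the positive block that are orthogonal to \<open>y\<close> are orthogonal to
  \<open>v\<close> as well, which \<open>tangent_frame\<close> uses.\<close>

lemma dual_vector:
  assumes "i0 < a" "a \<le> k" "k \<le> N" "y i0 \<noteq> 0"
  obtains v where "v \<in> cvec N" "hf a k v y = 1" "\<And>i. a \<le> i \<Longrightarrow> v i = 0"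
    "\<forall>u. (\<forall>i\<ge>a. u i = 0) \<longrightarrow> hf a k y u = 0 \<longrightarrow> hf a k v u = 0"
proof -
  define S where "S = (\<Sum>i<a. y i * cnj (y i))"
  have "S = of_real (\<Sum>i<a. (cmod (y i))\<^sup>2)" by (simp add: S_def complex_norm_square del: of_real_power)
  moreover have "0 < (\<Sum>i<a. (cmod (y i))\<^sup>2)" by (rule sum_pos2[of _ i0]) (use assms in auto)
  ultimately have S: "S \<noteq> 0" by (metis of_real_eq_0_iff less_irrefl)
  define v where "v = (\<lambda>i. if i < a then y i / S else 0)"
  have "hf a k v y = (\<Sum>i<a. v i * cnj (y i))"
    by (rule hf_pos_support) (use assms in \<open>auto simp: v_def\<close>)
  also have "\<dots> = (\<Sum>i<a. y i * cnj (y i) / S)" by (rule sum.cong) (auto simp: v_def)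
  also have "\<dots> = S / S" unfolding sum_divide_distrib[symmetric] S_def ..
  finally have "hf a k v y = 1" using S by simp
  moreover have "hf a k v u = 0" if u: "\<forall>i\<ge>a. u i = 0" "hf a k y u = 0" for u
  proof -
    have "hf a k v u = (\<Sum>i<a. y i * cnj (u i)) / S"
      by (subst hf_pos_support(2)[OF assms(2)]) (use u(1) in \<open>auto simp: v_def sum_divide_distrib\<close>)
    also have "(\<Sum>i<a. y i * cnj (u i)) = hf a k y u"
      by (rule hf_pos_support[OF assms(2), symmetric]) (use u(1) in auto)
    finally show ?thesis using u(2) by simp
  qed
  ultimately show ?thesis using that[of v] assms by (auto simp: v_def cvec_def)
qed

text \<open>The situation after lifting and polarizing. The coordinate \<open>i0\<close> gives every
  vector of the box a nonzero positive part, so each of them has a dual vector and lies outside the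
  radical.\<close>

locale orthogonal_map =
  fixes a k N a' N' i0 :: nat and p :: "nat \<Rightarrow> complex" and d :: real
    and F :: "(nat \<Rightarrow> complex) \<Rightarrow> nat \<Rightarrow> complex"
  assumes a2: "2 \<le> a" and ka: "a + 2 \<le> k" and kN: "k \<le> N" and a'a: "a' \<le> a" and a': "0 < a'"
    and p: "p \<in> cvec N" "hf a k p p = 0" and d: "d > 0"
    and i0: "i0 < a" "\<And>z. z \<in> box_nbhd N p d \<Longrightarrow> z i0 \<noteq> 0"
    and F: "\<And>j. j < N' \<Longrightarrow> hol_on N (box_nbhd N p d) (\<lambda>z. F z j)"
    and F_nonzero: "\<And>z. z \<in> box_nbhd N p d \<Longrightarrow> \<exists>j<N'. F z j \<noteq> 0"
    and F_pos: "\<And>z. z \<in> box_nbhd N p d \<Longrightarrow> 0 < Re (hf a k z z) \<Longrightarrow> 0 < Re (hf a' N' (F z) (F z))"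
    and F_orth: "\<And>z w. z \<in> box_nbhd N p d \<Longrightarrow> w \<in> box_nbhd N p d \<Longrightarrow> hf a k z w = 0 \<Longrightarrow>
      hf a' N' (F z) (F w) = 0"
begin

abbreviation "D \<equiv> box_nbhd N p d"
abbreviation "h \<equiv> hf a k"
abbreviation K where "K z w \<equiv> hf a' N' (F z) (F w)"

lemma p_in: "p \<in> D" using p d by (simp add: box_nbhd_center)

lemma ak: "a \<le> k" using ka by simp

lemma F_ne_zero:
  assumes "z \<in> D" "\<And>i. i < N' \<Longrightarrow> F z i = 0"
  shows False
  using assms F_nonzero by blast

lemma common_radius:
  fixes L :: nat
  assumes "b \<in> D" "\<And>j. j < L \<Longrightarrow> u j \<in> cvec N"
  obtains e :: real where "e > 0" "\<And>j. j < L \<Longrightarrow> (\<lambda>i. b i + of_real e * u j i) \<in> D"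
proof -
  have "\<forall>j<L. \<forall>\<^sub>F t in nhds 0. (\<lambda>i. b i + t * u j i) \<in> D"
    using eventually_line_box assms by blast
  then have "\<forall>\<^sub>F t in nhds 0. \<forall>j\<in>{..<L}. (\<lambda>i. b i + t * u j i) \<in> D"
    by (intro eventually_ball_finite) auto
  then obtain r where r: "r > 0" "\<And>t j. dist t 0 < r \<Longrightarrow> j < L \<Longrightarrow> (\<lambda>i. b i + t * u j i) \<in> D"
    unfolding eventually_nhds_metric by auto
  show ?thesis
  proof (rule that[of "r / 2"])
    show "(\<lambda>i. b i + complex_of_real (r / 2) * u j i) \<in> D" if "j < L" for j
      by (rule r(2)[OF _ that]) (use r(1) in simp)
  qed (use r(1) in simp)
qed

text \<open>Two orthogonality conditions cost two of the \<open>a\<close> positive directions. The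
  orthonormal vectors are carried into the box by adding \<open>b\<close>, which is null and
  orthogonal to them, so their products are only rescaled.\<close>

lemma positive_frame_near:
  assumes "b \<in> D" "h b b = 0" "h b y = 0"
  obtains e where "\<And>j. j < a - 2 \<Longrightarrow> e j \<in> D" "\<And>j. j < a - 2 \<Longrightarrow> 0 < Re (h (e j) (e j))"
    "\<And>i j. i < a - 2 \<Longrightarrow> j < a - 2 \<Longrightarrow> i \<noteq> j \<Longrightarrow> h (e i) (e j) = 0"
    "\<And>j. j < a - 2 \<Longrightarrow> h (e j) b = 0" "\<And>j. j < a - 2 \<Longrightarrow> h (e j) y = 0"
proof -
  obtain u where u: "\<And>j i. j < a - 2 \<Longrightarrow> a \<le> i \<Longrightarrow> u j i = 0"
     "\<And>j l. j < a - 2 \<Longrightarrow> l < (2::nat) \<Longrightarrow> h (u j) (if l = 0 then b else y) = 0"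
     "\<And>i j. i < a - 2 \<Longrightarrow> j < a - 2 \<Longrightarrow> h (u i) (u j) = (if i = j then 1 else 0)"
    by (rule positive_orthonormal_vectors[OF ak, of 2 "a - 2" "\<lambda>l. if l = (0::nat) then b else y"])
      (use a2 in simp, rule that)
  note u = u(1) u(2)[of _ 0, simplified] u(2)[of _ 1, simplified] u(3)
  have ub: "h b (u j) = 0" if "j < a - 2" for j by (rule hf_zero_sym[OF u(2)[OF that]])
  have uc: "u j \<in> cvec N" if "j < a - 2" for j using u(1)[OF that] ak kN by (auto simp: cvec_def)
  obtain e :: real where e: "e > 0" "\<And>j. j < a - 2 \<Longrightarrow> (\<lambda>i. b i + of_real e * u j i) \<in> D"
    by (rule common_radius[OF assms(1), of "a - 2" u]) (use uc in blast, rule that)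
  have z: "h (\<lambda>l. b l + of_real e * u i l) (\<lambda>l. b l + of_real e * u j l) = of_real (e * e) * (if i = j then 1 else 0)"
    if "i < a - 2" "j < a - 2" for i j
    using assms(2) u(2)[OF that(1)] ub[OF that(2)] u(4)[OF that]
    by (simp only: hf_linear) simp
  show ?thesis
  proof (rule that[of "\<lambda>j i. b i + of_real e * u j i"])
    fix j assume j: "j < a - 2"
    show "0 < Re (h (\<lambda>i. b i + of_real e * u j i) (\<lambda>i. b i + of_real e * u j i))"
      using z[OF j j] e(1) by simp
    show "h (\<lambda>i. b i + of_real e * u j i) b = 0" "h (\<lambda>i. b i + of_real e * u j i) y = 0"
      using assms u(2,3)[OF j] by (simp_all only: hf_linear) simp_all
  qed (use e(2) z in auto)
qed

text \<open>A complex line through the null point \<open>b\<close> that is positive on a half plane,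
  and \<open>a - 1\<close> positive vectors of the box orthogonal to the whole line. With any
  positive point of the line they form a maximal positive orthogonal family.\<close>

lemma tangent_frame:
  assumes b: "b \<in> D" "h b b = 0"
  obtains v \<rho> z where "v \<in> cvec N" "\<rho> > 0" "h v b = 1"
    "\<And>t. t \<in> ball 0 \<rho> \<Longrightarrow> (\<lambda>i. b i + t * v i) \<in> D"
    "\<And>t. 0 < Re t \<Longrightarrow> 0 < Re (h (\<lambda>i. b i + t * v i) (\<lambda>i. b i + t * v i))"
    "\<And>j. j < a - 1 \<Longrightarrow> z j \<in> D" "\<And>j. j < a - 1 \<Longrightarrow> 0 < Re (h (z j) (z j))"
    "\<And>i j. i < a - 1 \<Longrightarrow> j < a - 1 \<Longrightarrow> i \<noteq> j \<Longrightarrow> h (z i) (z j) = 0"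
    "\<And>j. j < a - 1 \<Longrightarrow> h b (z j) = 0"
    "\<And>j t. j < a - 1 \<Longrightarrow> h (\<lambda>i. b i + t * v i) (z j) = 0"
proof -
  obtain u where u: "\<And>j i. j < a - 1 \<Longrightarrow> a \<le> i \<Longrightarrow> u j i = 0"
     "\<And>j l. j < a - 1 \<Longrightarrow> l < (1::nat) \<Longrightarrow> h (u j) b = 0"
     "\<And>i j. i < a - 1 \<Longrightarrow> j < a - 1 \<Longrightarrow> h (u i) (u j) = (if i = j then 1 else 0)"
    by (rule positive_orthonormal_vectors[OF ak, of 1 "a - 1" "\<lambda>_. b"]) (use a2 in simp, rule that)
  note u = u(1) u(2)[OF _ zero_less_one] u(3)
  have ub: "h b (u j) = 0" if "j < a - 1" for j by (rule hf_zero_sym[OF u(2)[OF that]])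
  have uc: "u j \<in> cvec N" if "j < a - 1" for j using u(1)[OF that] ak kN by (auto simp: cvec_def)
  obtain e :: real where e: "e > 0" "\<And>j. j < a - 1 \<Longrightarrow> (\<lambda>i. b i + of_real e * u j i) \<in> D"
    by (rule common_radius[OF b(1), of "a - 1" u]) (use uc in blast, rule that)
  obtain b' where b': "b' \<in> cvec N" "h b' b = 1" "\<And>i. a \<le> i \<Longrightarrow> b' i = 0"
    "\<forall>u. (\<forall>i\<ge>a. u i = 0) \<longrightarrow> h b u = 0 \<longrightarrow> h b' u = 0"
    by (rule dual_vector[where y = b, OF i0(1) ak kN i0(2)[OF b(1)]]) (rule that)
  have b'u: "h b' (u j) = 0" if "j < a - 1" for j using b'(4) u(1) ub that by blast
  \<comment> \<open>The correction gives \<open>h v (u j) = - 1 / e\<close>, which cancels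
    \<open>h v b = 1\<close> in the product of \<open>v\<close> with \<open>b + e * u j\<close>.
    Being supported in the positive block, \<open>v\<close> keeps \<open>h v v\<close>
    nonnegative.\<close>
  define v where "v = (\<lambda>i. b' i - (\<Sum>j<a - 1. u j i) / of_real e)"
  have vb: "h v b = 1"
    unfolding v_def using u(2) by (simp add: hf_linear b'(2))
  have vu: "h v (u j) = - 1 / of_real e" if "j < a - 1" for j
    unfolding v_def using that b'u[OF that] u(3) by (simp add: hf_linear)
  have v0: "v i = 0" if "a \<le> i" for i using that u(1) by (simp add: v_def b'(3))
  have vc: "v \<in> cvec N" using v0 ak kN by (auto simp: cvec_def)
  have vv: "0 \<le> Re (h v v)"
    unfolding Re_hf_self by (intro sum_nonneg) (use v0 in auto)
  have bv: "h b v = 1" using vb hf_cnj[of a k v b] by simp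
  obtain \<rho> where \<rho>: "\<rho> > 0" "\<And>t. cmod t < \<rho> \<Longrightarrow> (\<lambda>i. b i + t * v i) \<in> D"
    using line_box_ball[OF b(1) vc] by blast
  show ?thesis
  proof (rule that[of v \<rho> "\<lambda>j i. b i + of_real e * u j i"])
    show "0 < Re (h (\<lambda>i. b i + t * v i) (\<lambda>i. b i + t * v i))" if t: "0 < Re t" for t
    proof -
      have "h (\<lambda>i. b i + t * v i) (\<lambda>i. b i + t * v i) = t + cnj t + t * cnj t * h v v"
        by (simp only: hf_linear b vb bv) (simp add: algebra_simps)
      also have "\<dots> = of_real (2 * Re t + (cmod t)\<^sup>2 * Re (h v v))"
        by (subst hf_self_eq) (simp add: complex_add_cnj complex_norm_square[symmetric])
      finally have "Re (h (\<lambda>i. b i + t * v i) (\<lambda>i. b i + t * v i)) = 2 * Re t + (cmod t)\<^sup>2 * Re (h v v)"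
        by (simp only: Re_complex_of_real)
      then show ?thesis using t vv by (simp add: add_pos_nonneg)
    qed
    show "h (\<lambda>i. b i + t * v i) (\<lambda>i. b i + of_real e * u j i) = 0" if "j < a - 1" for j t
      using e(1) vu[OF that] ub[OF that] b by (simp only: hf_linear) (simp add: bv vb)
    have z: "h (\<lambda>l. b l + of_real e * u i l) (\<lambda>l. b l + of_real e * u j l) = of_real (e * e) * (if i = j then 1 else 0)"
      if "i < a - 1" "j < a - 1" for i j
      using b(2) u(2)[OF that(1)] ub[OF that(2)] u(3)[OF that]
      by (simp only: hf_linear) simp
    fix j assume j: "j < a - 1"
    show "0 < Re (h (\<lambda>i. b i + of_real e * u j i) (\<lambda>i. b i + of_real e * u j i))"
      using z[OF j j] e(1) by simp
    show "h b (\<lambda>i. b i + of_real e * u j i) = 0"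
      using b(2) ub[OF j] by (simp only: hf_linear) simp
    show "h (\<lambda>l. b l + of_real e * u i l) (\<lambda>l. b l + of_real e * u j l) = 0" if "i < a - 1" "i \<noteq> j" for i
      using z[OF that(1) j] that(2) by simp
  qed (use e(2) \<rho> vc vb in auto)
qed

lemma index_eq: "a' = a"
proof (rule ccontr)
  assume "a' \<noteq> a"
  then have lt: "a' < a" using a'a by simp
  obtain v \<rho> z where v: "v \<in> cvec N" "\<rho> > 0" "h v p = 1"
    "\<And>t. t \<in> ball 0 \<rho> \<Longrightarrow> (\<lambda>i. p i + t * v i) \<in> D"
    "\<And>t. 0 < Re t \<Longrightarrow> 0 < Re (h (\<lambda>i. p i + t * v i) (\<lambda>i. p i + t * v i))"
    "\<And>j. j < a - 1 \<Longrightarrow> z j \<in> D" "\<And>j. j < a - 1 \<Longrightarrow> 0 < Re (h (z j) (z j))"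
    "\<And>i j. i < a - 1 \<Longrightarrow> j < a - 1 \<Longrightarrow> i \<noteq> j \<Longrightarrow> h (z i) (z j) = 0"
    "\<And>j. j < a - 1 \<Longrightarrow> h p (z j) = 0"
    "\<And>j t. j < a - 1 \<Longrightarrow> h (\<lambda>i. p i + t * v i) (z j) = 0"
    by (fact tangent_frame[OF p_in p(2)])
  define x where "x = (\<lambda>i. p i + of_real (\<rho> / 2) * v i)"
  have x: "x \<in> D" "0 < Re (h x x)" "\<And>j. j < a - 1 \<Longrightarrow> h x (z j) = 0"
    unfolding x_def using v(2) by (intro v(4) v(5) v(10); simp)+
  define X where "X j = (if j < a - 1 then z j else x)" for j
  have zx: "h (z j) x = 0" if "j < a - 1" for j by (rule hf_zero_sym[OF x(3)[OF that]])
  have XD: "X j \<in> D" and Xpos: "0 < Re (h (X j) (X j))" for j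
    using x v(6,7) by (auto simp: X_def)
  have "h (X i) (X j) = 0" if "i < a" "j < a" "i \<noteq> j" for i j
    using that x(3) zx v(8) by (auto simp: X_def)
  then have "\<exists>c. (\<exists>j<a. c j \<noteq> 0) \<and> (\<forall>i<N'. (\<Sum>j<a. c j * F (X j) i) = 0) \<and>
    (\<forall>j<a. 0 < Re (hf a' N' (F (X j)) (F (X j))) \<longrightarrow> c j = 0)"
    using lt XD Xpos F_pos by (intro orthogonal_nonneg_dependent) (auto intro: F_orth less_imp_le)
  then show False using F_pos[OF XD Xpos] by blast
qed

text \<open>\<open>K\<close> with second argument \<open>y\<close> vanishes on the vectors of the
  box orthogonal to \<open>y\<close>, so its differential at \<open>b\<close> kills the directions
  orthogonal to \<open>y\<close> and is a multiple of \<open>h v y\<close>. The factor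
  \<open>q\<close> is the value Q(b, y) of the overview.\<close>

lemma K_derivative:
  assumes b: "b \<in> D" and y: "y \<in> D" "h b y = 0"
  obtains q where "\<And>v. v \<in> cvec N \<Longrightarrow>
    ((\<lambda>t. K (\<lambda>i. b i + t * v i) y) has_field_derivative q * h v y) (at 0)"
proof -
  obtain A where A: "\<And>v. v \<in> cvec N \<Longrightarrow>
    ((\<lambda>t. K (\<lambda>i. b i + t * v i) y) has_field_derivative (\<Sum>i<N. A i * v i)) (at 0)"
    using hol_on_linear_derivative[OF hol_on_hf_left[of N' N D F a' "F y", OF F] b] by blast
  have ker: "(\<Sum>i<N. A i * v i) = 0" if v: "v \<in> cvec N" "h v y = 0" for v
  proof (rule DERIV_eventually_zero[OF A[OF v(1)]])
    show "\<forall>\<^sub>F t in nhds 0. K (\<lambda>i. b i + t * v i) y = 0"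
      using eventually_line_box[OF b v(1)]
      by (rule eventually_mono) (intro F_orth y(1); simp add: hf_linear v y)
  qed
  obtain v0 where v0: "v0 \<in> cvec N" "h v0 y = 1"
    by (rule dual_vector[where y = y, OF i0(1) ak kN i0(2)[OF y(1)]]) (rule that)
  show ?thesis
  proof (rule that[of "\<Sum>i<N. A i * v0 i"])
    fix v assume v: "v \<in> cvec N"
    define v' where "v' = (\<lambda>i. v i - h v y * v0 i)"
    have "v' \<in> cvec N" using v v0(1) by (auto simp: cvec_def v'_def)
    moreover have "h v' y = 0" unfolding v'_def by (simp only: hf_diff_left hf_scale_left v0) simp
    ultimately have "(\<Sum>i<N. A i * v' i) = 0" by (rule ker)
    then have "(\<Sum>i<N. A i * v i) = (\<Sum>i<N. A i * v0 i) * h v y"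
      by (simp add: v'_def right_diff_distrib sum_subtractf sum_distrib_right sum_distrib_left mult_ac)
    then show "((\<lambda>t. K (\<lambda>i. b i + t * v i) y) has_field_derivative (\<Sum>i<N. A i * v0 i) * h v y) (at 0)"
      using A[OF v] by simp
  qed
qed

lemma K_holomorphic_line:
  assumes "b \<in> cvec N" "v \<in> cvec N"
  shows "(\<lambda>t. hf a' N' (F (\<lambda>i. b i + t * v i)) y) holomorphic_on {t. (\<lambda>i. b i + t * v i) \<in> D}"
  by (rule hol_on_line[OF hol_on_hf_left[OF F] assms])

text \<open>Transversality: the derivative of \<open>K(\<sqdot>, b)\<close> at a null point \<open>b\<close> does not vanish, by the Hopf lemma.\<close>

lemma K_derivative_nonzero:
  assumes b: "b \<in> D" "h b b = 0"
    and q: "\<And>v. v \<in> cvec N \<Longrightarrow>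
      ((\<lambda>t. K (\<lambda>i. b i + t * v i) b) has_field_derivative q * h v b) (at 0)"
  shows "q \<noteq> 0"
proof
  assume q0: "q = 0"
  obtain v \<rho> z where v: "v \<in> cvec N" "\<rho> > 0" "h v b = 1"
    "\<And>t. t \<in> ball 0 \<rho> \<Longrightarrow> (\<lambda>i. b i + t * v i) \<in> D"
    "\<And>t. 0 < Re t \<Longrightarrow> 0 < Re (h (\<lambda>i. b i + t * v i) (\<lambda>i. b i + t * v i))"
    "\<And>j. j < a - 1 \<Longrightarrow> z j \<in> D" "\<And>j. j < a - 1 \<Longrightarrow> 0 < Re (h (z j) (z j))"
    "\<And>i j. i < a - 1 \<Longrightarrow> j < a - 1 \<Longrightarrow> i \<noteq> j \<Longrightarrow> h (z i) (z j) = 0"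
    "\<And>j. j < a - 1 \<Longrightarrow> h b (z j) = 0"
    "\<And>j t. j < a - 1 \<Longrightarrow> h (\<lambda>i. b i + t * v i) (z j) = 0"
    by (fact tangent_frame[OF b])
  define x where "x t = (\<lambda>i. b i + t * v i)" for t
  have xD: "x t \<in> D" if "t \<in> ball 0 \<rho>" for t using v(4)[OF that] by (simp add: x_def)
  have Kbb: "K b b = 0" by (rule F_orth[OF b(1,1,2)])
  \<comment> \<open>For \<open>t\<close> in the half plane these are \<open>a' = a\<close> positive
    orthogonal vectors, hence a maximal family in the target; only its first member moves with
    \<open>t\<close>.\<close>
  define frame where "frame t j = (if j = 0 then F (x t) else F (z (j - 1)))" for t j
  have xz: "K (x t) (z j) = 0" if "t \<in> ball 0 \<rho>" "j < a - 1" for t j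
    by (rule F_orth[OF xD v(6)]) (use that v(10) in \<open>auto simp: x_def\<close>)
  have zx: "K (z j) (x t) = 0" if "t \<in> ball 0 \<rho>" "j < a - 1" for t j
    by (rule hf_zero_sym[OF xz[OF that]])
  have frame_pos: "0 < Re (hf a' N' (frame t j) (frame t j))" if "j < a'" "t \<in> ball 0 \<rho>" "0 < Re t" for j t
  proof (cases "j = 0")
    case True
    then show ?thesis using F_pos[OF xD[OF that(2)]] v(5)[OF that(3)] by (simp add: frame_def x_def)
  next
    case False
    then have "j - 1 < a - 1" using that(1) index_eq by simp
    then show ?thesis using F_pos[OF v(6,7)] False by (simp add: frame_def)
  qed
  have frame_orth: "hf a' N' (frame t i) (frame t j) = 0"
    if "i < a'" "j < a'" "i \<noteq> j" "t \<in> ball 0 \<rho>" for i j t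
  proof -
    have "K (z (i - 1)) (z (j - 1)) = 0" if "i \<noteq> 0" "j \<noteq> 0"
      by (intro F_orth v(6) v(8)) (use \<open>i < a'\<close> \<open>j < a'\<close> \<open>i \<noteq> j\<close> that index_eq in auto)
    then show ?thesis using that xz[of t "j - 1"] zx[of t "i - 1"] index_eq by (auto simp: frame_def)
  qed
  have bz: "K b (z j) = 0" if "j < a - 1" for j by (rule F_orth[OF b(1) v(6,9)]) (use that in auto)
  \<comment> \<open>Otherwise the null vector \<open>F b\<close> would be orthogonal to the whole
    maximal family, hence zero.\<close>
  have Kb: "K b (x t) \<noteq> 0" if t: "t \<in> ball 0 \<rho>" "0 < Re t" for t
  proof
    assume 0: "K b (x t) = 0"
    have "F b i = 0" if "i < N'" for i
    proof (rule orthogonal_positive_nonneg_zero[of a' N' "frame t"])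
      show "hf a' N' (F b) (frame t j) = 0" if "j < a'" for j
        using 0 bz[of "j - 1"] that index_eq by (auto simp: frame_def)
    qed (use frame_pos frame_orth t Kbb that in auto)
    then show False using F_ne_zero[OF b(1)] by blast
  qed
  define e where "e = x (of_real (\<rho> / 2))"
  have t0: "of_real (\<rho> / 2) \<in> ball (0::complex) \<rho>" "0 < Re (of_real (\<rho> / 2))" using v(2) by auto
  have Kbe: "K b e \<noteq> 0" unfolding e_def by (rule Kb[OF t0])
  define G where "G t = K (x t) b" for t
  define E where "E t = K (x t) e" for t
  have hol: "(\<lambda>t. hf a' N' (F (x t)) y) holomorphic_on ball 0 \<rho>" for y
    unfolding x_def by (rule holomorphic_on_subset[OF K_holomorphic_line])
      (use v box_nbhd_cvec[OF b(1)] in auto)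
  have x0: "x 0 = b" by (simp add: x_def)
  have "continuous_on (ball 0 \<rho>) E" unfolding E_def using hol holomorphic_on_imp_continuous_on by blast
  then have "isCont E 0" using v(2) by (simp add: continuous_on_eq_continuous_at)
  moreover have "E 0 \<noteq> 0" using Kbe by (simp add: E_def x0)
  ultimately obtain s where s: "s > 0" "\<And>t. dist 0 t < s \<Longrightarrow> E t \<noteq> 0"
    using continuous_at_avoid[of 0 E 0] by auto
  define r where "r = min s \<rho>"
  have r: "r > 0" "ball 0 r \<subseteq> ball (0::complex) \<rho>" using s(1) v(2) by (auto simp: r_def)
  have Enz: "E t \<noteq> 0" if "t \<in> ball 0 r" for t using s(2)[of t] that by (auto simp: r_def)
  \<comment> \<open>The reversed Cauchy-Schwarz inequality bounds the real part of
    \<open>G t * K b e * cnj (E t)\<close>. Dividing by \<open>E t\<close> differs from this by a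
    positive factor and is holomorphic; the quotient \<open>K b e / E t\<close> is 1 at 0.\<close>
  define H where "H t = G t * (K b e / E t)" for t
  have Ghol: "G holomorphic_on ball 0 r" and Ehol: "E holomorphic_on ball 0 r"
    unfolding G_def E_def by (rule holomorphic_on_subset[OF hol r(2)])+
  have "\<not> (H has_field_derivative 0) (at 0)"
  proof (rule hopf_half_plane)
    show "H holomorphic_on ball 0 r"
      unfolding H_def using Enz by (intro holomorphic_intros Ghol Ehol) auto
    show "H 0 = 0" by (simp add: H_def G_def x0 Kbb)
    show "of_real (r / 2) \<in> ball (0::complex) r" using r(1) by simp
    have "K (x (of_real (r / 2))) b \<noteq> 0"
    proof
      assume "K (x (of_real (r / 2))) b = 0"
      then have "K b (x (of_real (r / 2))) = 0" by (rule hf_zero_sym)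
      moreover have "of_real (r / 2) \<in> ball (0::complex) \<rho>" using r by (auto simp: r_def)
      ultimately show False using Kb[of "of_real (r / 2)"] r(1) by simp
    qed
    then show "H (of_real (r / 2)) \<noteq> 0"
      using Enz[of "of_real (r / 2)"] Kbe r(1) by (simp add: H_def G_def)
    fix t assume t: "t \<in> ball 0 r" "0 < Re t"
    have tr: "t \<in> ball 0 \<rho>" using t r by auto
    have "0 \<le> Re (K (x t) b * hf a' N' (F b) (frame (of_real (\<rho> / 2)) 0)
        * hf a' N' (frame (of_real (\<rho> / 2)) 0) (F (x t)))"
    proof (rule triple_product_nonneg[OF a' frame_pos[OF _ t0] frame_orth[OF _ _ _ t0(1)]])
      show "hf a' N' (F (x t)) (frame (complex_of_real (\<rho> / 2)) j) = 0" if "0 < j" "j < a'" for j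
        using xz[OF tr, of "j - 1"] that index_eq by (auto simp: frame_def)
      show "hf a' N' (F b) (frame (complex_of_real (\<rho> / 2)) j) = 0" if "0 < j" "j < a'" for j
        using bz[of "j - 1"] that index_eq by (auto simp: frame_def)
      show "0 \<le> Re (K (x t) (x t))"
        using F_pos[OF xD[OF tr]] v(5)[OF t(2)] by (auto simp: x_def)
    qed (simp_all add: Kbb)
    then have *: "0 \<le> Re (G t * K b e * cnj (E t))"
      by (simp add: frame_def e_def G_def E_def hf_cnj)
    have "H t = G t * K b e * cnj (E t) / of_real ((cmod (E t))\<^sup>2)"
      using Enz[OF t(1)] unfolding complex_norm_square by (simp add: H_def field_simps)
    then have "Re (H t) = Re (G t * K b e * cnj (E t)) / (cmod (E t))\<^sup>2" by (simp only: Re_divide_of_real)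
    then show "0 \<le> Re (H t)" using * by simp
  qed (use r in auto)
  moreover have "(H has_field_derivative 0) (at 0)"
  proof -
    have 1: "(G has_field_derivative 0) (at 0)"
      using q[OF v(1)] q0 unfolding G_def x_def by simp
    have "(\<lambda>t. K b e / E t) holomorphic_on ball 0 r"
      using Enz by (intro holomorphic_intros Ehol) auto
    then obtain m where 2: "((\<lambda>t. K b e / E t) has_field_derivative m) (at 0)"
      using r(1) by (meson centre_in_ball holomorphic_derivI open_ball)
    from DERIV_mult[OF 1 2] show ?thesis
      unfolding H_def by (simp add: G_def x0 Kbb)
  qed
  ultimately show False by blast
qed

end

lemma line_identity:
  assumes "b \<in> cvec N" "v \<in> cvec N" "f holomorphic_on {t. (\<lambda>i. b i + t * v i) \<in> box_nbhd N p d}"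
    and t0: "(\<lambda>i. b i + t0 * v i) \<in> box_nbhd N p d" and ev: "\<forall>\<^sub>F t in nhds t0. f t = 0"
    and t1: "(\<lambda>i. b i + t1 * v i) \<in> box_nbhd N p d"
  shows "f t1 = 0"
proof -
  let ?S = "{t. (\<lambda>i. b i + t * v i) \<in> box_nbhd N p d}"
  obtain V where V: "open V" "t0 \<in> V" "\<And>t. t \<in> V \<Longrightarrow> f t = 0"
    using ev unfolding eventually_nhds by blast
  have S: "open ?S" "connected ?S"
    using open_line_box convex_line_box assms(1,2) convex_connected by blast+
  have "f t1 = (\<lambda>_. 0) t1"
    by (rule analytic_continuation_open[of "V \<inter> ?S" ?S]) (use V S t0 t1 assms(3) in auto)
  then show ?thesis .
qed

lemma isCont_tendsto_nhds: "isCont f x \<Longrightarrow> (f \<longlongrightarrow> f x) (nhds x)"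
  by (simp add: isCont_def tendsto_at_iff_tendsto_nhds)

lemma holomorphic_zero_at_puncture:
  assumes "f holomorphic_on S" "open S" "x \<in> S" and zero: "\<And>t. t \<in> S \<Longrightarrow> t \<noteq> x \<Longrightarrow> f t = 0"
  shows "f x = 0"
proof -
  have "isCont f x"
    using assms(1-3) holomorphic_on_imp_continuous_on continuous_on_eq_continuous_at by metis
  moreover have "\<forall>\<^sub>F t in at x. f t = 0"
    unfolding eventually_at_topological using assms(2,3) zero by blast
  ultimately show ?thesis
    using LIM_unique[of f "f x" x 0] tendsto_eventually by (auto simp: isCont_def)
qed

section \<open>Totally null lines and the relation between null vectors\<close>

context orthogonal_map
begin

text \<open>Since \<open>b i0\<close> is nonzero, independence of \<open>b\<close> and
  \<open>y\<close> modulo the radical shows in a minor with column \<open>i0\<close>. The vector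
  \<open>v1\<close> represents this minor: it is orthogonal to \<open>b\<close> but not to
  \<open>y\<close>, and so adjusts the second value freely.\<close>

lemma independent_dual:
  assumes b: "b \<in> D" and y: "i < k" "y i * b i0 \<noteq> y i0 * b i"
  obtains v where "v \<in> cvec N" "h v b = x" "h v y = x'"
proof -
  have b0: "b i0 \<noteq> 0" by (rule i0(2)[OF b])
  define e where "e j = (\<lambda>l. if l = j then (1::complex) else 0)" for j :: nat
  define s where "s j = (if j < a then (1::complex) else - 1)" for j
  have ss: "s j * s j = 1" for j by (simp add: s_def)
  have he: "h (e j) w = s j * cnj (w j)" if "j < k" for j w
    using hf_unit_left[OF that] by (simp add: e_def s_def)
  have i0k: "i0 < k" using i0(1) ak by simp
  have ec: "e j \<in> cvec N" if "j < k" for j using that kN by (auto simp: e_def cvec_def)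
  define v1 where "v1 = (\<lambda>l. s i * cnj (b i0) * e i l - s i0 * cnj (b i) * e i0 l)"
  have v1: "h v1 w = cnj (b i0 * w i - b i * w i0)" for w
  proof -
    have "h v1 w = cnj (b i0) * (s i * s i) * cnj (w i) - cnj (b i) * (s i0 * s i0) * cnj (w i0)"
      unfolding v1_def by (simp only: hf_linear he[OF y(1)] he[OF i0k] mult_ac)
    then show ?thesis by (simp only: ss) simp
  qed
  have v1c: "v1 \<in> cvec N" using ec[OF y(1)] ec[OF i0k] by (simp add: v1_def cvec_def)
  have v1b: "h v1 b = 0" by (simp add: v1 mult.commute)
  have v1y: "h v1 y \<noteq> 0" using y(2) by (simp add: v1 mult.commute flip: complex_cnj_diff complex_cnj_mult)
  obtain v0 where v0: "v0 \<in> cvec N" "h v0 b = 1"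
    by (rule dual_vector[where y = b, OF i0(1) ak kN b0]) (rule that)
  show ?thesis
  proof (rule that)
    let ?v = "\<lambda>l. x * v0 l + (x' - x * h v0 y) / h v1 y * v1 l"
    show "?v \<in> cvec N" using v0 v1c by (simp add: cvec_def)
    show "h ?v b = x" by (simp only: hf_linear v0 v1b) simp
    show "h ?v y = x'" using v1y by (simp only: hf_linear) simp
  qed
qed

text \<open>The \<open>a - 2\<close> positive vectors orthogonal to the line, together with its
  three points, give \<open>a + 1\<close> orthogonal images, one more than the positive index
  allows. The coefficients of the positive images vanish, which leaves the three points.\<close>

lemma null_line_dependent:
  assumes b: "b \<in> D" "h b b = 0" and y: "y \<in> D" "h y y = 0" and "h b y = 0"
    and z: "(\<lambda>i. b i + t * (y i - b i)) \<in> D"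
  obtains \<alpha> \<beta> \<gamma> where "\<alpha> \<noteq> 0 \<or> \<beta> \<noteq> 0 \<or> \<gamma> \<noteq> 0"
    "\<And>i. i < N' \<Longrightarrow> \<alpha> * F b i + \<beta> * F y i + \<gamma> * F (\<lambda>i. b i + t * (y i - b i)) i = 0"
proof -
  obtain e where e: "\<And>j. j < a - 2 \<Longrightarrow> e j \<in> D" "\<And>j. j < a - 2 \<Longrightarrow> 0 < Re (h (e j) (e j))"
    "\<And>i j. i < a - 2 \<Longrightarrow> j < a - 2 \<Longrightarrow> i \<noteq> j \<Longrightarrow> h (e i) (e j) = 0"
    "\<And>j. j < a - 2 \<Longrightarrow> h (e j) b = 0" "\<And>j. j < a - 2 \<Longrightarrow> h (e j) y = 0"
    by (fact positive_frame_near[OF b(1,2) assms(5)])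
  let ?z = "\<lambda>i. b i + t * (y i - b i)"
  have yb: "h y b = 0" by (rule hf_zero_sym[OF assms(5)])
  have hz: "h ?z b = 0" "h ?z y = 0" "h ?z ?z = 0"
    by (simp_all only: hf_linear b y yb assms(5)) simp_all
  have ez: "h (e j) ?z = 0" if "j < a - 2" for j
    by (simp only: hf_linear e(4,5)[OF that]) simp
  define X where "X j = (if j < a - 2 then e j else if j = a - 2 then b else if j = a - 1 then y else ?z)" for j
  have XD: "X j \<in> D" for j using e b y z by (auto simp: X_def)
  have Xorth: "h (X i) (X j) = 0" if "i \<noteq> j" "i < a + 1" "j < a + 1" for i j
  proof -
    have 1: "h (X i) (X j) = 0" if "i < j" "j < a + 1" for i j
      using that a2 hf_zero_sym[OF hz(1)] hf_zero_sym[OF hz(2)] e(3,4,5) ez assms(5)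
      by (auto simp: X_def)
    show ?thesis using 1[of i j] hf_zero_sym[OF 1[of j i]] that by (cases "i < j") auto
  qed
  have Xnonneg: "0 \<le> Re (K (X j) (X j))" for j
  proof (cases "j < a - 2")
    case True
    then show ?thesis using F_pos[OF e(1,2)[OF True]] by (simp add: X_def)
  next
    case False
    then have "h (X j) (X j) = 0" using b y hz by (auto simp: X_def)
    then show ?thesis using F_orth[OF XD XD] by simp
  qed
  have "\<exists>c. (\<exists>j<a + 1. c j \<noteq> 0) \<and> (\<forall>i<N'. (\<Sum>j<a + 1. c j * F (X j) i) = 0) \<and>
    (\<forall>j<a + 1. 0 < Re (K (X j) (X j)) \<longrightarrow> c j = 0)"
    using Xnonneg by (intro orthogonal_nonneg_dependent F_orth XD Xorth) (auto simp: index_eq)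
  then obtain c where c: "\<exists>j<a + 1. c j \<noteq> 0" "\<And>i. i < N' \<Longrightarrow> (\<Sum>j<a + 1. c j * F (X j) i) = 0"
    "\<And>j. j < a + 1 \<Longrightarrow> 0 < Re (K (X j) (X j)) \<Longrightarrow> c j = 0" by auto
  have c0: "c j = 0" if "j < a - 2" for j
    using c(3)[of j] F_pos[OF e(1,2)[OF that]] that by (simp add: X_def)
  obtain a0 where a0: "a = Suc (Suc a0)" using a2 by (metis add_2_eq_Suc le_Suc_ex)
  have sum: "(\<Sum>j<a + 1. c j * F (X j) i) = c (a - 2) * F b i + c (a - 1) * F y i + c a * F ?z i" for i
    using c0 by (simp add: a0 X_def)
  show ?thesis
  proof (rule that)
    show "c (a - 2) \<noteq> 0 \<or> c (a - 1) \<noteq> 0 \<or> c a \<noteq> 0"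
      using c(1) c0 by (auto simp: a0 less_Suc_eq)
    show "c (a - 2) * F b i + c (a - 1) * F y i + c a * F ?z i = 0" if "i < N'" for i
      using c(2)[OF that] unfolding sum .
  qed
qed

text \<open>In the notation of the overview this is Q(y, w) Q(b, b) = Q(y, b) Q(b, w), multiplied by
  \<open>h b w * h y w\<close>; here \<open>qb\<close> is Q(b, b) and \<open>cnj qy\<close> is Q(y,
  b).\<close>

lemma null_relation:
  assumes b: "b \<in> D" "h b b = 0" and y: "y \<in> D" "h y y = 0" and hby: "h b y = 0"
    and indep: "i < k" "y i * b i0 \<noteq> y i0 * b i"
    and qb: "\<And>v. v \<in> cvec N \<Longrightarrow> ((\<lambda>t. K (\<lambda>i. b i + t * v i) b) has_field_derivative qb * h v b) (at 0)"
    and qy: "\<And>v. v \<in> cvec N \<Longrightarrow> ((\<lambda>t. K (\<lambda>i. b i + t * v i) y) has_field_derivative qy * h v y) (at 0)"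
    and w: "w \<in> D"
  shows "K y w * h b w * cnj qb = cnj qy * K b w * h y w"
proof -
  have qb0: "qb \<noteq> 0" by (rule K_derivative_nonzero[OF b qb])
  have hyb: "h y b = 0" by (rule hf_zero_sym[OF hby])
  have bc: "b \<in> cvec N" and yc: "y \<in> cvec N" and wc: "w \<in> cvec N" using b y w box_nbhd_cvec by blast+
  define z where "z t = (\<lambda>i. b i + t * (y i - b i))" for t
  have ybc: "(\<lambda>i. y i - b i) \<in> cvec N" using bc yc by (simp add: cvec_def)
  text \<open>The relation holds where the line through \<^term>\<open>b\<close> and \<^term>\<open>y\<close> meets the orthogonal complement of \<^term>\<open>w\<close> inside
    \<^term>\<open>D\<close>: the dependence of the images gives the ratio \<open>K y w / K b w\<close>, and its derivative along a
    direction orthogonal to \<^term>\<open>z t\<close> expresses this ratio by \<^term>\<open>qb\<close> and \<^term>\<open>qy\<close>.\<close>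
  have core: "K y w * h b w * cnj qb = cnj qy * K b w * h y w"
    if w: "w \<in> D" and zt: "z t \<in> D" and t0: "t \<noteq> 0" and tw: "(1 - t) * h b w + t * h y w = 0" for w t
  proof -
    obtain \<alpha> \<beta> \<gamma> where abc: "\<alpha> \<noteq> 0 \<or> \<beta> \<noteq> 0 \<or> \<gamma> \<noteq> 0"
      and dep: "\<And>i. i < N' \<Longrightarrow> \<alpha> * F b i + \<beta> * F y i + \<gamma> * F (z t) i = 0"
      by (rule null_line_dependent[OF b y hby zt[unfolded z_def], folded z_def]) (rule that)
    have dep': "\<alpha> * K b x + \<beta> * K y x + \<gamma> * K (z t) x = 0" for x
    proof -
      have "\<alpha> * K b x + \<beta> * K y x + \<gamma> * K (z t) x = hf a' N' (\<lambda>i. \<alpha> * F b i + \<beta> * F y i + \<gamma> * F (z t) i) (F x)"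
        by (simp only: hf_linear)
      also have "\<dots> = hf a' N' (\<lambda>i. 0) (F x)" using dep by (intro hf_cong) auto
      finally show ?thesis by (simp only: hf_linear)
    qed
    have "h (z t) w = (1 - t) * h b w + t * h y w"
      unfolding z_def by (simp only: hf_linear) (simp add: algebra_simps)
    then have "K (z t) w = 0" using tw by (intro F_orth zt w) simp
    then have rel: "\<alpha> * K b w = - \<beta> * K y w" using dep'[of w] by (simp add: eq_neg_iff_add_eq_0)
    \<comment> \<open>These two values make \<open>v\<close> orthogonal to \<open>z t\<close>, the
      combination of \<open>b\<close> and \<open>y\<close> with weights \<open>1 - t\<close> and
      \<open>t\<close>.\<close>
    obtain v where v: "v \<in> cvec N" "h v b = cnj t" "h v y = - (1 - cnj t)"
      by (rule independent_dual[OF b(1) indep]) 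
    have bz: "h b (z t) = 0"
      unfolding z_def by (simp only: hf_linear b hby) simp
    have vz: "h v (z t) = 0"
      unfolding z_def by (simp only: hf_linear v) (simp add: algebra_simps)
    have conj_dep: "cnj \<alpha> * K x b + cnj \<beta> * K x y = 0" if "K x (z t) = 0" for x
      using arg_cong[OF dep'[of x], of cnj] that by (simp add: hf_cnj)
    have "((\<lambda>t. cnj \<alpha> * K (\<lambda>i. b i + t * v i) b + cnj \<beta> * K (\<lambda>i. b i + t * v i) y)
        has_field_derivative (cnj \<alpha> * (qb * h v b) + cnj \<beta> * (qy * h v y))) (at 0)"
      by (intro DERIV_add DERIV_cmult qb qy v(1))
    then have "cnj \<alpha> * (qb * h v b) + cnj \<beta> * (qy * h v y) = 0"
    proof (rule DERIV_eventually_zero)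
      show "\<forall>\<^sub>F s in nhds 0. cnj \<alpha> * K (\<lambda>i. b i + s * v i) b + cnj \<beta> * K (\<lambda>i. b i + s * v i) y = 0"
        using eventually_line_box[OF b(1) v(1)]
      proof (rule eventually_mono)
        fix s assume "(\<lambda>i. b i + s * v i) \<in> D"
        then show "cnj \<alpha> * K (\<lambda>i. b i + s * v i) b + cnj \<beta> * K (\<lambda>i. b i + s * v i) y = 0"
          by (intro conj_dep F_orth zt) (simp_all only: hf_linear bz vz, simp)
      qed
    qed
    then have "cnj \<alpha> * qb * cnj t = cnj \<beta> * qy * (1 - cnj t)"
      unfolding v(2,3) by (simp add: algebra_simps)
    from arg_cong[OF this, of cnj]
    have q: "\<alpha> * cnj qb * t = \<beta> * cnj qy * (1 - t)" by simp
    \<comment> \<open>With \<open>\<beta>\<close> zero the relation just found forces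
      \<open>\<alpha>\<close> to vanish because \<open>qb\<close> does not, so the dependence would
      say that \<open>F (z t)\<close> is zero.\<close>
    have "\<beta> \<noteq> 0"
    proof
      assume "\<beta> = 0"
      then have "\<alpha> = 0" using q qb0 t0 by simp
      then have "\<gamma> \<noteq> 0" "\<And>i. i < N' \<Longrightarrow> F (z t) i = 0" using abc dep \<open>\<beta> = 0\<close> by auto
      then show False using F_ne_zero[OF zt] by blast
    qed
    have "\<beta> * t * (K y w * h b w * cnj qb) = - (\<alpha> * K b w) * (t * h b w * cnj qb)"
      unfolding rel by (simp add: algebra_simps)
    also have "\<dots> = - (\<alpha> * cnj qb * t) * (K b w * h b w)" by (simp add: algebra_simps)
    also have "\<dots> = - \<beta> * cnj qy * K b w * ((1 - t) * h b w)" unfolding q by (simp add: algebra_simps)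
    also have "\<dots> = - \<beta> * cnj qy * K b w * (- (t * h y w))"
    proof -
      have "(1 - t) * h b w = - (t * h y w)" using tw by (simp only: eq_neg_iff_add_eq_0)
      then show ?thesis by (simp only:)
    qed
    also have "\<dots> = \<beta> * t * (cnj qy * K b w * h y w)" by (simp add: algebra_simps)
    finally show ?thesis using \<open>\<beta> \<noteq> 0\<close> t0 by simp
  qed
  \<comment> \<open>Opposite values at \<open>b\<close> and \<open>y\<close> make
    \<open>w0 = b + \<theta> * v\<close> orthogonal to their midpoint, which lies in the box by
    convexity. So \<open>core\<close> applies near \<open>w0\<close>, and the identity theorem on
    the line from \<open>w0\<close> to \<open>w\<close> does the rest.\<close>
  obtain v where v: "v \<in> cvec N" "h v b = 1" "h v y = - 1"
    by (rule independent_dual[OF b(1) indep])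
  obtain s where s: "s > 0" "\<And>t. cmod t < s \<Longrightarrow> (\<lambda>i. b i + t * v i) \<in> D"
    by (rule line_box_ball[OF b(1) v(1)]) (rule that)
  define \<theta> where "\<theta> = complex_of_real (s / 2)"
  have \<theta>: "\<theta> \<noteq> 0" "cmod \<theta> < s" "cnj \<theta> = \<theta>" using s(1) by (auto simp: \<theta>_def)
  define w0 where "w0 = (\<lambda>i. b i + \<theta> * v i)"
  have w0: "w0 \<in> D" unfolding w0_def by (rule s(2)[OF \<theta>(2)])
  have w0c: "w0 \<in> cvec N" using w0 box_nbhd_cvec by blast
  have bv: "h b v = 1" "h y v = - 1" using hf_cnj[of a k v b] hf_cnj[of a k v y] v by simp_all
  have bw0: "h b w0 = \<theta>" "h y w0 = - \<theta>"
    unfolding w0_def by (simp_all only: hf_linear b hyb bv \<theta>(3)) simp_all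
  define w' where "w' t = (\<lambda>i. w0 i + t * (w i - w0 i))" for t
  have ww0c: "(\<lambda>i. w i - w0 i) \<in> cvec N" using wc w0c by (simp add: cvec_def)
  define f where "f t = K (w' t) y * h (w' t) b * qb - qy * K (w' t) b * h (w' t) y" for t
  have "f 1 = 0"
  proof (rule line_identity[OF w0c ww0c, of f p d 0 1])
    show "f holomorphic_on {t. (\<lambda>i. w0 i + t * (w i - w0 i)) \<in> D}"
      unfolding f_def w'_def
      by (intro holomorphic_intros K_holomorphic_line w0c ww0c; simp only: hf_linear; intro holomorphic_intros)
    define B where "B t = h b (w' t)" for t
    define Y where "Y t = h y (w' t)" for t
    \<comment> \<open>The parameter at which the line through \<open>b\<close> and \<open>y\<close>
      meets the complement of \<open>w' t\<close>; it stays close to 1/2 for small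
      \<open>t\<close>.\<close>
    define \<tau> where "\<tau> t = B t / (B t - Y t)" for t
    have B_eq: "B t = h b w0 + cnj t * h b (\<lambda>i. w i - w0 i)" "Y t = h y w0 + cnj t * h y (\<lambda>i. w i - w0 i)" for t
      unfolding B_def Y_def w'_def by (simp_all only: hf_add_right hf_scale_right)
    have cont: "isCont B 0" "isCont Y 0" unfolding B_eq[abs_def] by (intro continuous_intros)+
    have B0: "B 0 = \<theta>" "Y 0 = - \<theta>" by (simp_all add: B_eq bw0)
    have cont\<tau>: "isCont \<tau> 0"
      unfolding \<tau>_def using \<theta>(1) by (intro continuous_intros cont) (simp add: B0)
    have \<tau>0: "\<tau> 0 = 1 / 2" using \<theta>(1) by (simp add: \<tau>_def B0)
    have half: "1 / 2 \<in> {t. z t \<in> D}"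
    proof -
      have c: "convex {t. z t \<in> D}" unfolding z_def by (rule convex_line_box[OF bc ybc])
      have "(1 / 2) *\<^sub>R (0::complex) + (1 / 2) *\<^sub>R 1 \<in> {t. z t \<in> D}"
        by (rule convexD[OF c]) (use b y in \<open>auto simp: z_def\<close>)
      then show ?thesis by (simp add: scaleR_conv_of_real)
    qed
    have op: "open {t. z t \<in> D}" unfolding z_def by (rule open_line_box[OF bc ybc])
    have "\<forall>\<^sub>F t in nhds 0. \<tau> t \<in> {t. z t \<in> D}"
      using topological_tendstoD[OF isCont_tendsto_nhds[OF cont\<tau>] op] half \<tau>0 by simp
    moreover have "\<forall>\<^sub>F t in nhds 0. B t \<in> - {0}"
      using topological_tendstoD[OF isCont_tendsto_nhds[OF cont(1)], of "- {0}"] B0 \<theta>(1) by (simp add: open_Compl)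
    moreover have "\<forall>\<^sub>F t in nhds 0. B t - Y t \<in> - {0}"
      using topological_tendstoD[OF isCont_tendsto_nhds[of 0 "\<lambda>t. B t - Y t"], of "- {0}"]
        continuous_diff[OF cont] B0 \<theta>(1) by (simp add: open_Compl)
    moreover have "\<forall>\<^sub>F t in nhds 0. w' t \<in> D"
      using eventually_line_box[OF w0 ww0c] by (simp add: w'_def)
    ultimately show "\<forall>\<^sub>F t in nhds 0. f t = 0"
    proof eventually_elim
      case (elim t)
      then have nz: "B t \<noteq> 0" "B t - Y t \<noteq> 0" by auto
      have "(1 - \<tau> t) * B t + \<tau> t * Y t = 0" using nz by (simp add: \<tau>_def field_simps)
      then have "K y (w' t) * h b (w' t) * cnj qb = cnj qy * K b (w' t) * h y (w' t)"
        using elim nz by (intro core[of _ "\<tau> t"]) (auto simp: B_def Y_def \<tau>_def)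
      from arg_cong[OF this, of cnj] show ?case by (simp add: f_def hf_cnj)
    qed
    show "(\<lambda>i. w0 i + 0 * (w i - w0 i)) \<in> D" "(\<lambda>i. w0 i + 1 * (w i - w0 i)) \<in> D"
      using w w0 by simp_all
  qed
  then have "K w y * h w b * qb = qy * K w b * h w y" by (simp add: f_def w'_def)
  from arg_cong[OF this, of cnj] show ?thesis by (simp add: hf_cnj)
qed

end

lemma infinite_circle:
  fixes c :: complex
  assumes "0 < r"
  shows "infinite (sphere c r)"
proof
  assume "finite (sphere c r)"
  moreover have "connected (sphere c r)" by (rule connected_sphere) simp
  moreover have "c + of_real r \<in> sphere c r" "c - of_real r \<in> sphere c r"
    using assms by (auto simp: dist_norm)
  moreover have "c + of_real r \<noteq> c - of_real r"
  proof
    assume "c + of_real r = c - of_real r"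
    then have "2 * complex_of_real r = 0" by (simp add: algebra_simps)
    then show False using assms by simp
  qed
  ultimately show False
    using connected_finite_iff_sing by (metis empty_iff singletonD)
qed

context orthogonal_map
begin

text \<open>One vector \<open>G\<close> serves for all second arguments \<open>x\<close>, so the
  conjugate of the derivative becomes a holomorphic function when \<open>x\<close> is the image of a
  moving point.\<close>

lemma K_derivative_hf:
  assumes b: "b \<in> D" and v: "v \<in> cvec N"
  obtains G where "\<And>x. ((\<lambda>t. hf a' N' (F (\<lambda>i. b i + t * v i)) x) has_field_derivative hf a' N' G x) (at 0)"
proof -
  have "\<exists>g. ((\<lambda>t. F (\<lambda>i. b i + t * v i) j) has_field_derivative g) (at 0)" if "j < N'" for j
    by (rule hol_on_linear_derivative[OF F[OF that] b]) (use v in blast)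
  then obtain G where G: "\<And>j. j < N' \<Longrightarrow> ((\<lambda>t. F (\<lambda>i. b i + t * v i) j) has_field_derivative G j) (at 0)"
    by metis
  show ?thesis
  proof (rule that)
    fix x
    show "((\<lambda>t. hf a' N' (F (\<lambda>i. b i + t * v i)) x) has_field_derivative hf a' N' G x) (at 0)"
      unfolding hf_def by (intro DERIV_sum DERIV_cmult DERIV_cmult_right G) auto
  qed
qed

text \<open>Moving \<^term>\<open>y\<close> in a negative direction orthogonal to \<^term>\<open>b\<close>, one meets null vectors along a whole circle;
  so the relation for null vectors extends to \<^term>\<open>y\<close> by the identity theorem.\<close>

lemma orthogonal_relation:
  assumes b: "b \<in> box_nbhd N p (d / (6 * k))" "h b b = 0"
    and y: "y \<in> box_nbhd N p (d / (6 * k))" "h b y = 0" "0 < Re (h y y)"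
  shows "\<exists>c. \<forall>w\<in>D. K y w * h b w = c * K b w * h y w"
proof -
  \<comment> \<open>Below, \<open>cmod g\<close> is at most \<open>2 * k * d'\<close> and
    \<open>R\<close> at most \<open>3 * k * d'\<close>, so the circle lies in
    \<open>cmod t \<le> 5 * k * d'\<close>, where \<open>Y t\<close> stays within
    \<open>d' + 5 * k * d' \<le> d\<close> of \<open>p\<close>.\<close>
  define d' where "d' = d / (6 * k)"
  have k1: "real k \<ge> 1" using ka a2 by simp
  have d': "d' > 0" "6 * k * d' = d" using k1 d by (auto simp: d'_def)
  have d'd: "d' \<le> d"
    using d' k1 by (simp flip: d'(2))
  have in_D: "x \<in> D" if "x \<in> box_nbhd N p d'" for x
    using that d'd by (force simp: box_nbhd_def)
  have bD: "b \<in> D" and yD: "y \<in> D" using in_D b(1) y(1) unfolding d'_def by blast+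
  have bc: "b \<in> cvec N" and yc: "y \<in> cvec N" using bD yD box_nbhd_cvec by blast+
  have hyb: "h y b = 0" by (rule hf_zero_sym[OF y(2)])
  obtain u :: "nat \<Rightarrow> nat \<Rightarrow> complex" where u: "\<And>j i. j < 1 \<Longrightarrow> i \<notin> {a..<k} \<Longrightarrow> u j i = 0"
    "\<And>j l. j < 1 \<Longrightarrow> l < (1::nat) \<Longrightarrow> h (u j) b = 0"
    "\<And>j l. j < 1 \<Longrightarrow> l < 1 \<Longrightarrow> h (u j) (u l) = (if j = l then - 1 else 0)"
    by (rule negative_orthonormal_vectors[of 1 1 k a "\<lambda>_. b"]) (use ka in simp, rule that)
  define f where "f = u (0::nat)"
  have f: "\<And>i. i \<notin> {a..<k} \<Longrightarrow> f i = 0" "h f b = 0" "h f f = - 1"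
    using u(1)[OF zero_less_one] u(2)[OF zero_less_one zero_less_one] u(3)[OF zero_less_one zero_less_one]
    by (simp_all add: f_def)
  have hbf: "h b f = 0" by (rule hf_zero_sym[OF f(2)])
  have fc: "f \<in> cvec N" using f(1) kN by (auto simp: cvec_def)
  have f1: "cmod (f i) \<le> 1" for i
  proof (cases "i \<in> {a..<k}")
    case True
    have "h f f = - (\<Sum>i=a..<k. f i * cnj (f i))" by (rule hf_neg_support(1)[OF f(1)])
    also have "\<dots> = - of_real (\<Sum>i=a..<k. (cmod (f i))\<^sup>2)" by (simp only: of_real_sum complex_norm_square)
    finally have "complex_of_real (\<Sum>i=a..<k. (cmod (f i))\<^sup>2) = of_real 1" using f(3) by simp
    then have "(\<Sum>i=a..<k. (cmod (f i))\<^sup>2) = 1" by (simp only: of_real_eq_iff)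
    moreover have "(cmod (f i))\<^sup>2 \<le> (\<Sum>i=a..<k. (cmod (f i))\<^sup>2)"
      using True by (intro member_le_sum) auto
    ultimately show ?thesis using power2_le_imp_le[of "cmod (f i)" 1] by simp
  next
    case False
    then show ?thesis using f(1) by simp
  qed
  define Y where "Y t = (\<lambda>i. y i + t * f i)" for t
  define g where "g = h f y"
  have hyf: "h y f = cnj g" unfolding g_def by (simp add: hf_cnj)
  define A where "A = Re (h y y)"
  have hyy: "h y y = of_real A" unfolding A_def by (rule hf_self_eq)
  \<comment> \<open>Completing the square turns \<open>h (Y t) (Y t)\<close> into \<open>R^2\<close>
    minus the squared distance from \<open>t\<close> to \<open>cnj g\<close>, which explains the
    circle.\<close>
  define R where "R = sqrt (A + (cmod g)\<^sup>2)"
  have R: "R > 0" "R\<^sup>2 = A + (cmod g)\<^sup>2"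
    using y(3) by (auto simp: R_def A_def add_pos_nonneg)
  have yb: "cmod (y i - b i) \<le> 2 * d'" for i
  proof (cases "i < N")
    case True
    then have "cmod (y i - p i) < d'" "cmod (b i - p i) < d'" using b(1) y(1) by (auto simp: box_nbhd_def d'_def)
    then show ?thesis using norm_triangle_ineq4[of "y i - p i" "b i - p i"] by simp
  next
    case False
    then show ?thesis using bc yc d'(1) by (simp add: cvec_def)
  qed
  have "cmod g = cmod (h f (\<lambda>i. y i - b i))" unfolding g_def by (simp only: hf_linear f) simp
  also have "\<dots> \<le> real k * 1 * (2 * d')" by (rule norm_hf_le_bound) (use f1 yb in auto)
  finally have g_le: "cmod g \<le> 2 * k * d'" by simp
  have "A \<le> cmod (h y y)" unfolding A_def by (rule complex_Re_le_cmod)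
  also have "h y y = h (\<lambda>i. y i - b i) (\<lambda>i. y i - b i)" by (simp only: hf_linear b y(2) hyb) simp
  also have "cmod \<dots> \<le> real k * (2 * d') * (2 * d')" by (rule norm_hf_le_bound) (use d'(1) yb in auto)
  also have "\<dots> \<le> real k * (real k * (2 * d') * (2 * d'))"
    using k1 mult_right_mono[of 1 "real k" "real k * (2 * d') * (2 * d')"] by simp
  finally have "A \<le> (2 * k * d')\<^sup>2" by (simp add: power2_eq_square mult_ac)
  moreover have "(cmod g)\<^sup>2 \<le> (2 * k * d')\<^sup>2" using g_le by (intro power_mono) auto
  ultimately have "R\<^sup>2 \<le> 2 * (2 * k * d')\<^sup>2" by (simp add: R(2))
  also have "\<dots> \<le> (3 * k * d')\<^sup>2" by (simp add: power_mult_distrib)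
  finally have R_le: "R \<le> 3 * k * d'" by (rule power2_le_imp_le) (use d'(1) in simp)
  have YD: "Y t \<in> D" if t: "cmod t \<le> 5 * k * d'" for t
    unfolding box_nbhd_def
  proof safe
    show "Y t \<in> cvec N" unfolding Y_def by (rule cvec_line[OF yc fc])
    fix i assume "i < N"
    then have "cmod (y i - p i) < d'" using y(1) by (auto simp: box_nbhd_def d'_def)
    moreover have "cmod (t * f i) \<le> (5 * k * d') * 1" unfolding norm_mult using t f1[of i] d'(1) k1
      by (intro mult_mono) auto
    moreover have "cmod (Y t i - p i) \<le> cmod (y i - p i) + cmod (t * f i)"
      using norm_triangle_ineq[of "y i - p i" "t * f i"] by (simp add: Y_def algebra_simps)
    moreover have "1 * d' \<le> real k * d'" using d'(1) k1 by (intro mult_right_mono) auto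
    then have "d' + 5 * k * d' \<le> d" using d'(2) by simp
    ultimately show "cmod (Y t i - p i) < d" by linarith
  qed
  define S where "S = {t. Y t \<in> D}"
  have opS: "open S" unfolding S_def Y_def by (rule open_line_box[OF yc fc])
  have conS: "connected S" unfolding S_def Y_def by (rule convex_connected[OF convex_line_box[OF yc fc]])
  have circ: "sphere (cnj g) R \<subseteq> S"
  proof
    fix t assume "t \<in> sphere (cnj g) R"
    then have "cmod (t - cnj g) = R" by (simp add: dist_norm norm_minus_commute)
    then have "cmod t \<le> R + cmod g" using norm_triangle_ineq[of "t - cnj g" "cnj g"] by simp
    then show "t \<in> S" unfolding S_def using YD[of t] R_le g_le by simp
  qed
  have null: "h (Y t) (Y t) = 0" if "t \<in> sphere (cnj g) R" for t
  proof -
    have t: "cmod (t - cnj g) = R" using that by (simp add: dist_norm norm_minus_commute)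
    have "h (Y t) (Y t) = of_real A + t * g + cnj t * cnj g - t * cnj t"
      unfolding Y_def by (simp only: hf_linear hyy f(3) hyf g_def[symmetric]) (simp add: algebra_simps)
    also have "\<dots> = of_real A + g * cnj g - (t - cnj g) * cnj (t - cnj g)" by (simp add: algebra_simps)
    also have "\<dots> = of_real (A + (cmod g)\<^sup>2 - (cmod (t - cnj g))\<^sup>2)"
      by (simp only: of_real_add of_real_diff complex_norm_square)
    also have "\<dots> = 0" unfolding t by (simp add: R(2))
    finally show ?thesis .
  qed
  have bY: "h b (Y t) = 0" for t unfolding Y_def by (simp only: hf_linear y(2) hbf) simp
  \<comment> \<open>\<open>null_relation\<close> needs \<open>Y t\<close> to be independent of
    \<open>b\<close>. As \<open>f\<close> is nonzero on the first \<open>k\<close> coordinates but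
    \<open>f i0 = 0\<close>, this fails for at most one parameter.\<close>
  define E where "E = {t. \<forall>i<k. Y t i * b i0 = Y t i0 * b i}"
  have E: "t1 = t2" if t: "t1 \<in> E" "t2 \<in> E" for t1 t2
  proof (rule ccontr)
    assume ne: "t1 \<noteq> t2"
    have b0: "b i0 \<noteq> 0" by (rule i0(2)[OF bD])
    have f0: "f i0 = 0" using f(1) i0(1) by simp
    have "f i = 0" if "i < k" for i
    proof -
      have "(t1 - t2) * f i * b i0 = (Y t1 i - Y t2 i) * b i0" by (simp add: Y_def algebra_simps)
      also have "\<dots> = (Y t1 i0 - Y t2 i0) * b i" using t that by (simp add: E_def algebra_simps)
      also have "\<dots> = 0" by (simp add: Y_def f0)
      finally show ?thesis using ne b0 by simp
    qed
    then have "h f f = h (\<lambda>i. 0) (\<lambda>i. 0)" by (intro hf_cong) auto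
    then show False using f(3) by (simp add: hf_linear)
  qed
  have finE: "finite E"
  proof (cases "E = {}")
    case False
    then obtain e where "e \<in> E" by blast
    then have "E \<subseteq> {e}" using E by blast
    then show ?thesis by (rule finite_subset) simp
  qed simp
  define V where "V = sphere (cnj g) R - E"
  have "infinite V" unfolding V_def using infinite_circle[OF R(1)] finE by simp
  moreover have "V \<subseteq> sphere (cnj g) R" by (auto simp: V_def)
  ultimately obtain \<xi> where \<xi>: "\<xi> \<in> sphere (cnj g) R" "\<xi> islimpt V"
    using compact_sphere[of "cnj g" R] unfolding compact_eq_Bolzano_Weierstrass by blast
  obtain qb where qb: "\<And>v. v \<in> cvec N \<Longrightarrow>
      ((\<lambda>t. K (\<lambda>i. b i + t * v i) b) has_field_derivative qb * h v b) (at 0)"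
    by (rule K_derivative[OF bD bD b(2)]) (rule that)
  have qb0: "qb \<noteq> 0" by (rule K_derivative_nonzero[OF bD b(2) qb])
  \<comment> \<open>The scalar \<open>qy\<close> of \<open>null_relation\<close> depends on
    \<open>t\<close> in an uncontrolled way. Testing along one fixed \<open>v\<close> replaces
    \<open>cnj qy * h (Y t) v\<close> by the product of \<open>F (Y t)\<close> with
    \<open>G\<close>, which is holomorphic in \<open>t\<close>; and \<open>h y v = 1\<close> removes
    the extra factor at \<open>t = 0\<close>.\<close>
  obtain v where v: "v \<in> cvec N" "h v y = 1"
    by (rule dual_vector[where y = y, OF i0(1) ak kN i0(2)[OF yD]]) (rule that)
  have yv: "h y v = 1" using v(2) hf_cnj[of a k v y] by simp
  obtain G where G: "\<And>x. ((\<lambda>t. hf a' N' (F (\<lambda>i. b i + t * v i)) x) has_field_derivative hf a' N' G x) (at 0)"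
    by (rule K_derivative_hf[OF bD v(1)]) (rule that)
  have rel: "K (Y t) w * h b w * cnj qb * h (Y t) v = hf a' N' (F (Y t)) G * K b w * h (Y t) w"
    if t: "t \<in> V" and w: "w \<in> D" for t w
  proof -
    have tS: "t \<in> sphere (cnj g) R" using t by (simp add: V_def)
    have YtD: "Y t \<in> D" using circ tS by (auto simp: S_def)
    obtain qy where qy: "\<And>v. v \<in> cvec N \<Longrightarrow>
      ((\<lambda>s. K (\<lambda>i. b i + s * v i) (Y t)) has_field_derivative qy * h v (Y t)) (at 0)"
      by (rule K_derivative[OF bD YtD bY]) (rule that)
    obtain i where i: "i < k" "Y t i * b i0 \<noteq> Y t i0 * b i" using t by (auto simp: V_def E_def)
    have 1: "K (Y t) w * h b w * cnj qb = cnj qy * K b w * h (Y t) w"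
      by (rule null_relation[OF bD b(2) YtD null[OF tS] bY i qb qy w])
    have "qy * h v (Y t) = hf a' N' G (F (Y t))"
      by (rule DERIV_unique[OF qy[OF v(1)] G])
    from arg_cong[OF this, of cnj] have 2: "cnj qy * h (Y t) v = hf a' N' (F (Y t)) G"
      by (simp add: hf_cnj)
    have "K (Y t) w * h b w * cnj qb * h (Y t) v = (cnj qy * h (Y t) v) * K b w * h (Y t) w"
      unfolding 1 by (simp add: mult_ac)
    then show ?thesis unfolding 2 .
  qed
  have "K y w * h b w = (hf a' N' (F y) G / cnj qb) * K b w * h y w" if w: "w \<in> D" for w
  proof -
    define \<phi> where "\<phi> t = K (Y t) w * h b w * cnj qb * h (Y t) v - hf a' N' (F (Y t)) G * K b w * h (Y t) w" for t
    have "\<phi> holomorphic_on S"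
      unfolding \<phi>_def S_def Y_def
      by (intro holomorphic_intros K_holomorphic_line yc fc; simp only: hf_linear; intro holomorphic_intros)
    then have "\<phi> 0 = 0"
    proof (rule analytic_continuation[OF _ opS conS, where \<xi> = \<xi>])
      show "V \<subseteq> S" using circ by (auto simp: V_def)
      show "\<xi> \<in> S" using \<xi>(1) circ by blast
      show "0 \<in> S" using yD by (simp add: S_def Y_def)
      show "\<phi> t = 0" if "t \<in> V" for t using rel[OF that w] by (simp add: \<phi>_def)
    qed (rule \<xi>(2))
    then show ?thesis using qb0 yv by (simp add: \<phi>_def Y_def field_simps)
  qed
  then show ?thesis by blast
qed

end

section \<open>Rank one and linearity\<close>

lemma continuous_on_hf_left: "continuous_on S (\<lambda>z. hf a k z y)"
  unfolding hf_def by (intro continuous_intros continuous_on_product_coordinates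
    continuous_on_subset[OF continuous_on_product_coordinates subset_UNIV])

lemma continuous_on_hf_self: "continuous_on S (\<lambda>z. hf a k z z)"
  unfolding hf_def by (intro continuous_intros continuous_on_product_coordinates
    continuous_on_subset[OF continuous_on_product_coordinates subset_UNIV])

context orthogonal_map
begin

text \<open>For \<^term>\<open>y\<close> in some open set there is a null vector \<^term>\<open>b\<close> orthogonal to both \<^term>\<open>p\<close> and \<^term>\<open>y\<close>;
  the relations of \<^term>\<open>y\<close> with \<^term>\<open>b\<close> and of \<^term>\<open>b\<close> with \<^term>\<open>p\<close> combine.\<close>

lemma relation_with_center:
  obtains y0 e where "e > 0" "y0 \<in> box_nbhd N y0 e" "box_nbhd N y0 e \<subseteq> D"
    "\<And>y. y \<in> box_nbhd N y0 e \<Longrightarrow> 0 < Re (h y y) \<and> h y p \<noteq> 0 \<and> h y y0 \<noteq> 0 \<and>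
      (\<exists>c. \<forall>w\<in>D. K y w * h p w = c * K p w * h y w)"
proof -
  define d' where "d' = d / (6 * k)"
  have k1: "real k \<ge> 1" using ka a2 by simp
  have d': "d' > 0" "6 * k * d' = d" using k1 d by (auto simp: d'_def)
  have d'd: "d' \<le> d" using d' k1 by (simp flip: d'(2))
  have in_D: "x \<in> D" if "x \<in> box_nbhd N p d'" for x
    using that d'd by (force simp: box_nbhd_def)
  have pd': "p \<in> box_nbhd N p d'" using p d' by (simp add: box_nbhd_center)
  obtain u :: "nat \<Rightarrow> nat \<Rightarrow> complex" where u: "\<And>j i. j < 1 \<Longrightarrow> a \<le> i \<Longrightarrow> u j i = 0"
    "\<And>j l. j < 1 \<Longrightarrow> l < (1::nat) \<Longrightarrow> h (u j) p = 0"
    "\<And>j l. j < 1 \<Longrightarrow> l < 1 \<Longrightarrow> h (u j) (u l) = (if j = l then 1 else 0)"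
    by (rule positive_orthonormal_vectors[OF ak, of 1 1 "\<lambda>_. p"]) (use a2 in simp, rule that)
  obtain w :: "nat \<Rightarrow> nat \<Rightarrow> complex" where w: "\<And>j i. j < 1 \<Longrightarrow> i \<notin> {a..<k} \<Longrightarrow> w j i = 0"
    "\<And>j l. j < 1 \<Longrightarrow> l < (1::nat) \<Longrightarrow> h (w j) p = 0"
    "\<And>j l. j < 1 \<Longrightarrow> l < 1 \<Longrightarrow> h (w j) (w l) = (if j = l then - 1 else 0)"
    by (rule negative_orthonormal_vectors[of 1 1 k a "\<lambda>_. p"]) (use ka in simp, rule that)
  define u0 where "u0 = u 0"
  define f0 where "f0 = w 0"
  have u0: "\<And>i. a \<le> i \<Longrightarrow> u0 i = 0" "h u0 p = 0" "h u0 u0 = 1"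
    using u(1)[OF zero_less_one] u(2)[OF zero_less_one zero_less_one] u(3)[OF zero_less_one zero_less_one]
    by (simp_all add: u0_def)
  have f0: "\<And>i. i \<notin> {a..<k} \<Longrightarrow> f0 i = 0" "h f0 p = 0" "h f0 f0 = - 1"
    using w(1)[OF zero_less_one] w(2)[OF zero_less_one zero_less_one] w(3)[OF zero_less_one zero_less_one]
    by (simp_all add: f0_def)
  have uf: "h u0 f0 = 0"
  proof -
    have "h u0 f0 = (\<Sum>i<a. u0 i * cnj (f0 i))" by (rule hf_pos_support(1)[OF ak]) (use u0(1) in auto)
    also have "\<dots> = 0" by (rule sum.neutral) (use f0(1) in auto)
    finally show ?thesis .
  qed
  have fu: "h f0 u0 = 0" by (rule hf_zero_sym[OF uf])
  have pu: "h p u0 = 0" and pf: "h p f0 = 0" by (rule hf_zero_sym[OF u0(2)], rule hf_zero_sym[OF f0(2)])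
  have u0c: "u0 \<in> cvec N" and f0c: "f0 \<in> cvec N" using u0(1) f0(1) ak kN by (auto simp: cvec_def)
  \<comment> \<open>A sum of orthogonal unit vectors of opposite sign, both orthogonal to
    \<open>p\<close>: a null direction at \<open>p\<close>, so every \<open>p + \<beta> * g\<close>
    is null.\<close>
  define g where "g = (\<lambda>i. u0 i + f0 i)"
  have gc: "g \<in> cvec N" using u0c f0c by (simp add: g_def cvec_def)
  have g: "h g g = 0" "h g p = 0" "h p g = 0" "h g u0 = 1" "h u0 g = 1"
    unfolding g_def by (simp_all only: hf_linear u0 f0 uf fu pu pf) simp_all
  obtain \<eta> where \<eta>: "\<eta> > 0" "\<And>t. cmod t < \<eta> \<Longrightarrow> (\<lambda>i. p i + t * g i) \<in> box_nbhd N p d'"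
    by (rule line_box_ball[OF pd' gc]) (rule that)
  obtain s where s: "s > 0" "\<And>t. cmod t < s \<Longrightarrow> (\<lambda>i. p i + t * u0 i) \<in> box_nbhd N p d'"
    by (rule line_box_ball[OF pd' u0c]) (rule that)
  define y1 where "y1 = (\<lambda>i. p i + of_real (s / 2) * u0 i)"
  have y1: "y1 \<in> box_nbhd N p d'" unfolding y1_def by (rule s(2)) (use s(1) in simp)
  have y1h: "h y1 y1 = of_real ((s / 2)\<^sup>2)" "h y1 p = 0" "h y1 g = of_real (s / 2)"
    unfolding y1_def by (simp_all only: hf_linear p u0 pu g) (simp_all add: power2_eq_square)
  \<comment> \<open>The inequality says that the \<open>\<beta>\<close> for which
    \<open>p + \<beta> * g\<close> is orthogonal to \<open>y\<close> is smaller than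
    \<open>\<eta>\<close>, so this null vector lies in the small box. The point \<open>y1\<close>,
    orthogonal to \<open>p\<close> but not to \<open>g\<close>, shows that the set is
    nonempty.\<close>
  define O1 where "O1 = {y \<in> box_nbhd N p d'. 0 < Re (h y y) \<and> cmod (h y p) < \<eta> * cmod (h y g)}"
  have opn: "openin (top_of_set (cvec N)) {y \<in> box_nbhd N q r. 0 < \<psi> y}"
    if "continuous_on UNIV \<psi>" for q r and \<psi> :: "_ \<Rightarrow> real"
  proof -
    have "{y \<in> box_nbhd N q r. 0 < \<psi> y} = box_nbhd N q r \<inter> {y. 0 < \<psi> y}" by auto
    moreover have "open {y. 0 < \<psi> y}" by (rule open_Collect_less[OF continuous_on_const that])
    ultimately show ?thesis by (simp add: openin_Int_open openin_box_nbhd)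
  qed
  have O1: "openin (top_of_set (cvec N)) O1"
  proof -
    have "O1 = {y \<in> box_nbhd N p d'. 0 < Re (h y y)} \<inter> {y \<in> box_nbhd N p d'. 0 < \<eta> * cmod (h y g) - cmod (h y p)}"
      by (auto simp: O1_def)
    moreover have "openin (top_of_set (cvec N)) {y \<in> box_nbhd N p d'. 0 < Re (h y y)}"
      by (rule opn) (intro continuous_intros continuous_on_hf_self)
    moreover have "openin (top_of_set (cvec N)) {y \<in> box_nbhd N p d'. 0 < \<eta> * cmod (h y g) - cmod (h y p)}"
      by (rule opn) (intro continuous_intros continuous_on_hf_left)
    ultimately show ?thesis by (simp add: openin_Int)
  qed
  have "0 < Re (h y1 y1)" unfolding y1h(1) Re_complex_of_real using s(1) by simp
  moreover have "0 < cmod (h y1 g)" unfolding y1h(3) norm_of_real using s(1) by simp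
  ultimately have "y1 \<in> O1" using y1 y1h(2) s(1) \<eta>(1) by (simp add: O1_def)
  from openin_cvec_contains_box[OF O1 this] obtain e1 where e1: "e1 > 0" "box_nbhd N y1 e1 \<subseteq> O1" by blast
  have y1c: "y1 \<in> cvec N" using y1 box_nbhd_cvec by blast
  obtain v where v: "v \<in> cvec N" "h v p = 1"
    by (rule dual_vector[where y = p, OF i0(1) ak kN i0(2)[OF p_in]]) (rule that)
  obtain s1 where s1: "s1 > 0" "\<And>t. cmod t < s1 \<Longrightarrow> (\<lambda>i. y1 i + t * v i) \<in> box_nbhd N y1 e1"
    by (rule line_box_ball[OF box_nbhd_center[OF y1c e1(1)] v(1)]) (rule that)
  \<comment> \<open>\<open>y1\<close> is orthogonal to \<open>p\<close>; a small push along
    \<open>v\<close> makes \<open>h y0 p\<close> nonzero, which keeps \<open>b\<close> different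
    from \<open>p\<close> and allows division by \<open>h w p\<close> later.\<close>
  define y0 where "y0 = (\<lambda>i. y1 i + of_real (s1 / 2) * v i)"
  have y0: "y0 \<in> box_nbhd N y1 e1" unfolding y0_def by (rule s1(2)) (use s1(1) in simp)
  have y0p: "h y0 p \<noteq> 0" unfolding y0_def using s1(1) by (simp only: hf_linear y1h v) simp
  have y0O: "y0 \<in> O1" using y0 e1 by blast
  then have y0pos: "0 < Re (h y0 y0)" by (simp add: O1_def)
  define O2 where "O2 = {y \<in> box_nbhd N y1 e1. 0 < cmod (h y p) * cmod (h y y0)}"
  have O2: "openin (top_of_set (cvec N)) O2"
    unfolding O2_def by (rule opn) (intro continuous_intros continuous_on_hf_left)
  have "h y0 y0 \<noteq> 0" using y0pos by auto
  then have "y0 \<in> O2" using y0 y0p by (simp add: O2_def)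
  from openin_cvec_contains_box[OF O2 this] obtain e where e: "e > 0" "box_nbhd N y0 e \<subseteq> O2" by blast
  have y0c: "y0 \<in> cvec N" using y0 box_nbhd_cvec by blast
  have sub: "box_nbhd N y0 e \<subseteq> O1" using e(2) e1(2) by (auto simp: O2_def)
  show ?thesis
  proof (rule that[of e y0])
    show "box_nbhd N y0 e \<subseteq> D" using sub in_D by (auto simp: O1_def)
    fix y assume yb: "y \<in> box_nbhd N y0 e"
    then have yO: "y \<in> O1" "y \<in> O2" using sub e(2) by auto
    then have y: "y \<in> box_nbhd N p d'" "0 < Re (h y y)" "cmod (h y p) < \<eta> * cmod (h y g)"
       "h y p \<noteq> 0" "h y y0 \<noteq> 0" by (auto simp: O1_def O2_def)
    have yD: "y \<in> D" by (rule in_D[OF y(1)])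
    have yg: "h y g \<noteq> 0" using y(3) by auto
    define \<beta> where "\<beta> = cnj (- h y p / h y g)"
    have \<beta>0: "\<beta> \<noteq> 0" using y(4) yg by (simp add: \<beta>_def)
    have "cmod \<beta> < \<eta>" using y(3) yg by (simp add: \<beta>_def norm_divide pos_divide_less_eq)
    define b where "b = (\<lambda>i. p i + \<beta> * g i)"
    have b: "b \<in> box_nbhd N p d'" unfolding b_def by (rule \<eta>(2)) fact
    have bD: "b \<in> D" by (rule in_D[OF b])
    have bb: "h b b = 0" "h p b = 0" "h b u0 = \<beta>"
      unfolding b_def by (simp_all only: hf_linear p g pu) simp_all
    have yb0: "h y b = 0"
      unfolding b_def using yg by (simp only: hf_linear) (simp add: \<beta>_def)
    have by0: "h b y = 0" by (rule hf_zero_sym[OF yb0])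
    obtain c where c: "\<And>w. w \<in> D \<Longrightarrow> K y w * h b w = c * K b w * h y w"
      using orthogonal_relation[of b y] b y(1,2) bb(1) by0 unfolding d'_def by blast
    \<comment> \<open>\<open>u0\<close> tells them apart: it is orthogonal to \<open>p\<close>,
      while \<open>h b u0 = \<beta>\<close> is nonzero.\<close>
    have "\<exists>i<k. b i * p i0 \<noteq> b i0 * p i"
    proof (rule ccontr)
      assume "\<not> ?thesis"
      then have eq: "p i0 * b i = b i0 * p i" if "i < k" for i using that by (simp add: mult.commute)
      have "p i0 * h b u0 = h (\<lambda>i. p i0 * b i) u0" by (simp only: hf_linear)
      also have "\<dots> = h (\<lambda>i. b i0 * p i) u0" by (rule hf_cong) (use eq in auto)
      also have "\<dots> = b i0 * h p u0" by (simp only: hf_linear)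
      finally show False using bb(3) pu \<beta>0 i0(2)[OF p_in] by simp
    qed
    then obtain i where i: "i < k" "b i * p i0 \<noteq> b i0 * p i" by blast
    obtain qp where qp: "\<And>v. v \<in> cvec N \<Longrightarrow>
      ((\<lambda>t. K (\<lambda>i. p i + t * v i) p) has_field_derivative qp * h v p) (at 0)"
      by (rule K_derivative[OF p_in p_in p(2)]) (rule that)
    obtain qb where qb: "\<And>v. v \<in> cvec N \<Longrightarrow>
      ((\<lambda>t. K (\<lambda>i. p i + t * v i) b) has_field_derivative qb * h v b) (at 0)"
      by (rule K_derivative[OF p_in bD bb(2)]) (rule that)
    have qp0: "qp \<noteq> 0" by (rule K_derivative_nonzero[OF p_in p(2) qp])
    have c': "K b w * h p w * cnj qp = cnj qb * K p w * h b w" if "w \<in> D" for w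
      by (rule null_relation[OF p_in p(2) bD bb(1,2) i qp qb that])
    define c2 where "c2 = c * cnj qb / cnj qp"
    have rel: "K y w * h p w = c2 * K p w * h y w" if w: "w \<in> D" "h b w \<noteq> 0" for w
    proof -
      have "cnj qp * h b w * (K y w * h p w) = (K y w * h b w) * (h p w * cnj qp)" by (simp add: mult_ac)
      also have "\<dots> = c * h y w * (K b w * h p w * cnj qp)" unfolding c[OF w(1)] by (simp add: mult_ac)
      also have "\<dots> = cnj qp * h b w * (c2 * K p w * h y w)"
        unfolding c'[OF w(1)] c2_def using qp0 by simp
      finally show ?thesis using w(2) qp0 by simp
    qed
    \<comment> \<open>Eliminating \<open>b\<close> cancelled the factor \<open>h b w\<close>. For
      \<open>w\<close> orthogonal to \<open>b\<close> the relation is recovered by continuity along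
      a direction that leaves this complement.\<close>
    have "K y w * h p w = c2 * K p w * h y w" if w: "w \<in> D" for w
    proof (cases "h b w = 0")
      case True
      obtain v where v: "v \<in> cvec N" "h v b = 1"
        by (rule dual_vector[where y = b, OF i0(1) ak kN i0(2)[OF bD]]) (rule that)
      have bv: "h b v = 1" using hf_cnj[of a k v b] v(2) by simp
      have wc: "w \<in> cvec N" using w box_nbhd_cvec by blast
      define S where "S = {t. (\<lambda>i. w i + t * v i) \<in> D}"
      define \<phi> where "\<phi> t = K (\<lambda>i. w i + t * v i) y * h (\<lambda>i. w i + t * v i) p
        - cnj c2 * K (\<lambda>i. w i + t * v i) p * h (\<lambda>i. w i + t * v i) y" for t
      have "\<phi> 0 = 0"
      proof (rule holomorphic_zero_at_puncture[where f = \<phi> and S = S and x = 0])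
        show "\<phi> holomorphic_on S"
          unfolding \<phi>_def S_def
          by (intro holomorphic_intros K_holomorphic_line wc v; simp only: hf_linear; intro holomorphic_intros)
        show "open S" unfolding S_def by (rule open_line_box[OF wc v(1)])
        show "0 \<in> S" using w by (simp add: S_def)
        fix t assume t: "t \<in> S" "t \<noteq> 0"
        let ?w = "\<lambda>i. w i + t * v i"
        have "h b ?w \<noteq> 0" using t by (simp only: hf_linear True bv) simp
        then have "K y ?w * h p ?w = c2 * K p ?w * h y ?w" using t by (intro rel) (auto simp: S_def)
        from arg_cong[OF this, of cnj] show "\<phi> t = 0" by (simp add: \<phi>_def hf_cnj)
      qed
      then have "K w y * h w p = cnj c2 * K w p * h w y" by (simp add: \<phi>_def)
      from arg_cong[OF this, of cnj] show ?thesis by (simp add: hf_cnj)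
    qed (rule rel[OF w])
    then show "0 < Re (h y y) \<and> h y p \<noteq> 0 \<and> h y y0 \<noteq> 0 \<and>
      (\<exists>c. \<forall>w\<in>D. K y w * h p w = c * K p w * h y w)"
      using y by blast
  qed (use e(1) y0c box_nbhd_center in auto)
qed

text \<open>The \<open>C j\<close> are the columns of the linear map, normalised so that they form
  an orthonormal frame, which can be completed to an automorphism. That only the first
  \<open>k\<close> coordinates of \<open>w\<close> occur says that the radical is forgotten.\<close>

theorem linear_up_to_factor:
  obtains C y0 e where "e > 0" "y0 \<in> box_nbhd N y0 e" "box_nbhd N y0 e \<subseteq> D"
    "\<And>i j. i < k \<Longrightarrow> j < k \<Longrightarrow> hf a' N' (C i) (C j) = (if i = j then if i < a then 1 else - 1 else 0)"
    "\<And>w. w \<in> box_nbhd N y0 e \<Longrightarrow> \<exists>c. c \<noteq> 0 \<and> (\<forall>i<N'. F w i = c * (\<Sum>j<k. w j * C j i))"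
proof -
  obtain y0 e where e: "e > 0" "y0 \<in> box_nbhd N y0 e" "box_nbhd N y0 e \<subseteq> D"
    and y: "\<And>y. y \<in> box_nbhd N y0 e \<Longrightarrow> 0 < Re (h y y) \<and> h y p \<noteq> 0 \<and> h y y0 \<noteq> 0 \<and>
      (\<exists>c. \<forall>w\<in>D. K y w * h p w = c * K p w * h y w)"
    by (rule relation_with_center) (rule that)
  let ?B = "box_nbhd N y0 e"
  have BD: "w \<in> D" if "w \<in> ?B" for w using that e(3) by blast
  have "\<forall>y. \<exists>c. y \<in> ?B \<longrightarrow> (\<forall>w\<in>D. K y w * h p w = c * K p w * h y w)" using y by blast
  then obtain c where "\<forall>y. y \<in> ?B \<longrightarrow> (\<forall>w\<in>D. K y w * h p w = c y * K p w * h y w)"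
    by (rule choice[THEN exE])
  then have c: "K y w * h p w = c y * K p w * h y w" if "y \<in> ?B" "w \<in> D" for y w using that by blast
  \<comment> \<open>This is Q(w, p), the scalar by which \<open>F\<close> is divided;
    \<open>c y\<close> carries the other factor of the rank-one relation.\<close>
  define \<kappa> where "\<kappa> w = K w p / h w p" for w
  have hwp: "h w p \<noteq> 0" if "w \<in> ?B" for w using y[OF that] by blast
  have cnj\<kappa>: "cnj (\<kappa> w) = K p w / h p w" for w by (simp add: \<kappa>_def hf_cnj)
  have Kc: "K y w = c y * cnj (\<kappa> w) * h y w" if "y \<in> ?B" "w \<in> ?B" for y w
  proof -
    have "h p w \<noteq> 0" using hwp[OF that(2)] hf_zero_sym by blast
    then show ?thesis using c[OF that(1) BD[OF that(2)]] by (simp add: cnj\<kappa> field_simps)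
  qed
  have \<kappa>0: "\<kappa> w \<noteq> 0" if "w \<in> ?B" for w
  proof
    assume "\<kappa> w = 0"
    then have "K w w = 0" using Kc[OF that that] by simp
    then show False using F_pos[OF BD[OF that]] y[OF that] by simp
  qed
  define G where "G w = (\<lambda>i. F w i / \<kappa> w)" for w
  define \<mu> where "\<mu> y = c y / \<kappa> y" for y
  have G\<mu>: "hf a' N' (G y) (G w) = \<mu> y * h y w" if "y \<in> ?B" "w \<in> ?B" for y w
    unfolding G_def using Kc[OF that] \<kappa>0[OF that(1)] \<kappa>0[OF that(2)]
    by (simp only: hf_linear) (simp add: \<mu>_def field_simps)
  \<comment> \<open>Hermitian symmetry. Comparing with \<open>y0\<close>, to which no vector of the
    small box is orthogonal, makes the factor real and constant.\<close>
  have \<mu>sym: "\<mu> y = cnj (\<mu> w)" if "y \<in> ?B" "w \<in> ?B" "h y w \<noteq> 0" for y w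
  proof -
    have "\<mu> y * h y w = cnj (\<mu> w * h w y)"
      unfolding G\<mu>[OF that(1,2), symmetric] G\<mu>[OF that(2,1), symmetric] by (simp add: hf_cnj)
    then show ?thesis using that(3) by (simp add: hf_cnj)
  qed
  define m where "m = Re (\<mu> y0)"
  have y00: "h y0 y0 \<noteq> 0" using y[OF e(2)] by auto
  have "\<mu> y0 = of_real m"
    using \<mu>sym[OF e(2,2) y00] unfolding m_def by (simp add: complex_eq_iff)
  then have \<mu>: "\<mu> y = of_real m" if "y \<in> ?B" for y
    using \<mu>sym[OF that e(2)] y[OF that] by simp
  have Gm: "hf a' N' (G y) (G w) = of_real m * h y w" if "y \<in> ?B" "w \<in> ?B" for y w
    using G\<mu>[OF that] \<mu>[OF that(1)] by simp
  have "m > 0"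
  proof -
    have "hf a' N' (G y0) (G y0) = K y0 y0 / (\<kappa> y0 * cnj (\<kappa> y0))"
      unfolding G_def by (simp only: hf_linear) simp
    also have "\<dots> = of_real (Re (K y0 y0) / (cmod (\<kappa> y0))\<^sup>2)"
      by (subst hf_self_eq) (simp only: of_real_divide complex_norm_square)
    finally have "of_real m * of_real (Re (h y0 y0)) = complex_of_real (Re (K y0 y0) / (cmod (\<kappa> y0))\<^sup>2)"
      using Gm[OF e(2,2)] hf_self_eq[of a k y0] by simp
    then have "m * Re (h y0 y0) = Re (K y0 y0) / (cmod (\<kappa> y0))\<^sup>2"
      by (simp only: of_real_mult[symmetric] of_real_eq_iff)
    moreover have "0 < Re (K y0 y0) / (cmod (\<kappa> y0))\<^sup>2"
      using F_pos[OF BD[OF e(2)]] y[OF e(2)] \<kappa>0[OF e(2)] by simp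
    ultimately have "0 < m * Re (h y0 y0)" by (simp only:)
    then show ?thesis using y[OF e(2)] by (blast intro: zero_less_mult_pos2)
  qed
  define \<epsilon> where "\<epsilon> j = (\<lambda>l. if l = j then (1::complex) else 0)" for j :: nat
  define \<eta> where "\<eta> = complex_of_real (e / 2)"
  have \<eta>: "\<eta> \<noteq> 0" "cmod \<eta> < e" "cnj \<eta> = \<eta>" using e(1) by (auto simp: \<eta>_def)
  define Y where "Y j = (\<lambda>i. y0 i + \<eta> * \<epsilon> j i)" for j
  have Y: "Y j \<in> ?B" if "j < k" for j
  proof -
    have "Y j \<in> cvec N" using that kN box_nbhd_cvec[OF e(2)] by (auto simp: Y_def \<epsilon>_def cvec_def)
    then show ?thesis using \<eta>(2) e(1) by (auto simp: box_nbhd_def Y_def \<epsilon>_def)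
  qed
  \<comment> \<open>If \<open>G\<close> is linear, this difference quotient is its value on the unit
    vector with index \<open>j\<close>. The step \<open>\<eta>\<close> is real so that it passes
    unchanged through the second slot.\<close>
  define C where "C j = (\<lambda>i. (G (Y j) i - G y0 i) / \<eta>)" for j
  have CG: "hf a' N' (C j) (G w) = of_real m * h (\<epsilon> j) w" if "j < k" "w \<in> ?B" for j w
  proof -
    have "hf a' N' (C j) (G w) = (of_real m * h (Y j) w - of_real m * h y0 w) / \<eta>"
      unfolding C_def by (simp only: hf_linear Gm[OF Y[OF that(1)] that(2)] Gm[OF e(2) that(2)])
    also have "h (Y j) w = h y0 w + \<eta> * h (\<epsilon> j) w" unfolding Y_def by (simp only: hf_linear)
    finally show ?thesis using \<eta>(1) by (simp add: field_simps)
  qed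
  have CC: "hf a' N' (C i) (C j) = of_real m * h (\<epsilon> i) (\<epsilon> j)" if "i < k" "j < k" for i j
  proof -
    have "hf a' N' (C i) (C j) = (of_real m * h (\<epsilon> i) (Y j) - of_real m * h (\<epsilon> i) y0) / \<eta>"
      unfolding C_def[of j] by (simp only: hf_linear CG[OF that(1) Y[OF that(2)]] CG[OF that(1) e(2)] \<eta>(3))
    also have "h (\<epsilon> i) (Y j) = h (\<epsilon> i) y0 + \<eta> * h (\<epsilon> i) (\<epsilon> j)" unfolding Y_def by (simp only: hf_linear \<eta>(3))
    finally show ?thesis using \<eta>(1) by (simp add: field_simps)
  qed
  have \<epsilon>\<epsilon>: "h (\<epsilon> i) (\<epsilon> j) = (if i = j then if i < a then 1 else - 1 else 0)" if "i < k" for i j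
    unfolding \<epsilon>_def by (subst hf_unit_left[OF that]) auto
  have GC: "G w i = (\<Sum>j<k. w j * C j i)" if w: "w \<in> ?B" and i: "i < N'" for w i
  proof -
    \<comment> \<open>The defect of linearity is orthogonal to every \<open>G y\<close>, hence to
      every \<open>C j\<close> and to itself. A null vector orthogonal to the \<open>a'\<close>
      positive columns is zero.\<close>
    define X where "X = (\<lambda>i. G w i - (\<Sum>j<k. w j * C j i))"
    have hw: "h w y = (\<Sum>j<k. w j * h (\<epsilon> j) y)" for y
      by (subst hf_def, rule sum.cong) (auto simp: \<epsilon>_def hf_unit_left)
    have XG: "hf a' N' X (G y) = 0" if "y \<in> ?B" for y
    proof -
      have "hf a' N' X (G y) = of_real m * h w y - (\<Sum>j<k. w j * hf a' N' (C j) (G y))"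
        unfolding X_def by (simp only: hf_linear Gm[OF w that])
      also have "(\<Sum>j<k. w j * hf a' N' (C j) (G y)) = of_real m * h w y"
        unfolding hw sum_distrib_left by (rule sum.cong) (use CG that in auto)
      finally show ?thesis by simp
    qed
    have XC: "hf a' N' X (C j) = 0" if "j < k" for j
      unfolding C_def by (simp only: hf_linear XG[OF Y[OF that]] XG[OF e(2)]) simp
    have "hf a' N' X X = hf a' N' X (G w) - (\<Sum>j<k. cnj (w j) * hf a' N' X (C j))"
      by (subst (2) X_def) (simp only: hf_linear)
    also have "\<dots> = 0" using XG[OF w] XC by simp
    finally have XX: "hf a' N' X X = 0" .
    have "X i = 0"
    proof (rule orthogonal_positive_nonneg_zero[OF _ _ _ _ i, of a' C])
      have ja: "j < a" "j < k" if "j < a'" for j using that ak index_eq by auto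
      show "0 < Re (hf a' N' (C j) (C j))" if "j < a'" for j
        using \<open>m > 0\<close> ja[OF that] by (simp add: CC \<epsilon>\<epsilon>)
      show "hf a' N' (C i) (C j) = 0" if "i < a'" "j < a'" "i \<noteq> j" for i j
        using ja[OF that(1)] ja[OF that(2)] that(3) by (simp add: CC \<epsilon>\<epsilon>)
      show "hf a' N' X (C j) = 0" if "j < a'" for j by (rule XC[OF ja(2)[OF that]])
    qed (simp add: XX)
    then show ?thesis by (simp add: X_def)
  qed
  define \<sigma> where "\<sigma> = complex_of_real (sqrt m)"
  have \<sigma>: "\<sigma> \<noteq> 0" "\<sigma> * cnj \<sigma> = of_real m" using \<open>m > 0\<close> by (auto simp: \<sigma>_def simp flip: of_real_mult)
  show ?thesis
  proof (rule that[of e y0 "\<lambda>j i. C j i / \<sigma>"])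
    show "hf a' N' (\<lambda>l. C i l / \<sigma>) (\<lambda>l. C j l / \<sigma>) = (if i = j then if i < a then 1 else - 1 else 0)"
      if "i < k" "j < k" for i j
    proof -
      have "hf a' N' (\<lambda>l. C i l / \<sigma>) (\<lambda>l. C j l / \<sigma>) = hf a' N' (C i) (C j) / (\<sigma> * cnj \<sigma>)"
        by (simp only: hf_linear) simp
      then show ?thesis using \<open>m > 0\<close> that by (simp add: \<sigma>(2) CC \<epsilon>\<epsilon>)
    qed
    show "\<exists>c. c \<noteq> 0 \<and> (\<forall>i<N'. F w i = c * (\<Sum>j<k. w j * (C j i / \<sigma>)))" if w: "w \<in> ?B" for w
    proof (intro exI[of _ "\<kappa> w * \<sigma>"] conjI allI impI)
      show "\<kappa> w * \<sigma> \<noteq> 0" using \<kappa>0[OF w] \<sigma>(1) by simp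
      fix i assume i: "i < N'"
      have "F w i = \<kappa> w * G w i" using \<kappa>0[OF w] by (simp add: G_def)
      also have "\<dots> = \<kappa> w * (\<Sum>j<k. w j * C j i)" unfolding GC[OF w i] ..
      also have "\<dots> = \<kappa> w * \<sigma> * (\<Sum>j<k. w j * (C j i / \<sigma>))" using \<sigma>(1) by (simp add: sum_distrib_left)
      finally show "F w i = \<kappa> w * \<sigma> * (\<Sum>j<k. w j * (C j i / \<sigma>))" .
    qed
  qed (use e in auto)
qed

end

section \<open>Local lifts of maps of projective spaces\<close>

lemma openin_scaled_box: "openin (top_of_set (cvec N)) {z \<in> cvec N. \<forall>i<N. cmod (c * z i - p i) < d}"
proof -
  have "{z \<in> cvec N. \<forall>i<N. cmod (c * z i - p i) < d} = cvec N \<inter> (\<Inter>i\<in>{..<N}. {z. cmod (c * z i - p i) < d})"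
    by auto
  moreover have "open (\<Inter>i\<in>{..<N}. {z. cmod (c * z i - p i) < d})"
    by (intro open_INT ballI open_Collect_less continuous_intros continuous_on_product_coordinates) auto
  ultimately show ?thesis by (simp only: openin_open_Int)
qed

lemma openin_hcoords: "openin (top_of_set (cvec (Suc n))) (hcoords n)"
proof -
  have "hcoords n = cvec (Suc n) \<inter> (\<Union>i. {z. z i \<noteq> 0})"
    by (auto simp: hcoords_def fun_eq_iff)
  moreover have "open (\<Union>i. {z :: nat \<Rightarrow> complex. z i \<noteq> 0})"
    by (intro open_UN ballI open_Collect_neq continuous_intros continuous_on_product_coordinates)
  ultimately show ?thesis by (simp only: openin_open_Int)
qed

lemma hcoords_cvec: "z \<in> hcoords n \<Longrightarrow> z \<in> cvec (Suc n)"
  by (simp add: hcoords_def)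

lemma hcoordsI: "z \<in> cvec (Suc n) \<Longrightarrow> z i \<noteq> 0 \<Longrightarrow> z \<in> hcoords n"
  by (auto simp: hcoords_def)

lemma hcoords_nonzero:
  assumes "z \<in> hcoords n"
  obtains i where "i \<le> n" "z i \<noteq> 0"
proof -
  obtain i where "z i \<noteq> 0" using assms by (auto simp: hcoords_def fun_eq_iff)
  moreover from this have "i \<le> n" using assms by (force simp: hcoords_def cvec_def not_less_eq_eq)
  ultimately show ?thesis using that by blast
qed

lemma hpt_scale: "c \<noteq> 0 \<Longrightarrow> hpt (\<lambda>i. c * z i) = hpt z"
  by (metis hpt_eq_iff)

lemma openin_pspace_contains_box:
  assumes "openin (pspace n) W" "z \<in> hcoords n" "hpt z \<in> W"
  obtains d where "d > 0" "box_nbhd (Suc n) z d \<subseteq> hcoords n" "\<And>w. w \<in> box_nbhd (Suc n) z d \<Longrightarrow> hpt w \<in> W"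
proof -
  have "openin (top_of_set (cvec (Suc n))) {z \<in> hcoords n. hpt z \<in> W}"
    using assms(1) openin_hcoords openin_trans unfolding openin_pspace by blast
  from openin_cvec_contains_box[OF this, of z] assms(2,3)
  obtain d where "d > 0" "box_nbhd (Suc n) z d \<subseteq> {z \<in> hcoords n. hpt z \<in> W}" by auto
  then show ?thesis using that[of d] by blast
qed

lemma openin_pspace_Collect:
  assumes P: "openin (top_of_set (cvec (Suc n))) {z \<in> cvec (Suc n). P z}"
    and scale: "\<And>c z. c \<noteq> 0 \<Longrightarrow> P z \<Longrightarrow> P (\<lambda>i. c * z i)"
  shows "openin (pspace n) {hpt z | z. z \<in> hcoords n \<and> P z}"
proof -
  have "{z \<in> hcoords n. hpt z \<in> {hpt z | z. z \<in> hcoords n \<and> P z}} = hcoords n \<inter> {z \<in> cvec (Suc n). P z}"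
  proof (intro equalityI subsetI)
    fix z assume z: "z \<in> {z \<in> hcoords n. hpt z \<in> {hpt z | z. z \<in> hcoords n \<and> P z}}"
    then obtain w where w: "w \<in> hcoords n" "P w" "hpt w = hpt z" by auto
    then obtain c where "c \<noteq> 0" "z = (\<lambda>i. c * w i)" by (auto simp: hpt_eq_iff)
    then show "z \<in> hcoords n \<inter> {z \<in> cvec (Suc n). P z}" using scale[of c w] w z hcoords_cvec by auto
  qed (auto simp: hcoords_def)
  moreover have "openin (top_of_set (cvec (Suc n))) (hcoords n \<inter> {z \<in> cvec (Suc n). P z})"
    by (intro openin_Int openin_hcoords P)
  moreover have "hcoords n \<subseteq> cvec (Suc n)" by (auto simp: hcoords_def)
  ultimately show ?thesis unfolding openin_pspace
    by (auto intro: openin_subset_trans)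
qed

text \<open>The points over the image of a box form the union of all rescalings of the box by
  nonzero scalars, and this union is open.\<close>

lemma openin_hpt_box:
  assumes "box_nbhd (Suc n) z d \<subseteq> hcoords n"
  shows "openin (pspace n) (hpt ` box_nbhd (Suc n) z d)"
proof -
  define P where "P w \<longleftrightarrow> (\<exists>c. c \<noteq> 0 \<and> (\<lambda>i. c * w i) \<in> box_nbhd (Suc n) z d)" for w
  have "{w \<in> cvec (Suc n). P w} = (\<Union>c\<in>-{0}. {w \<in> cvec (Suc n). \<forall>i<Suc n. cmod (c * w i - z i) < d})"
    by (auto simp: P_def box_nbhd_def cvec_def)
  moreover have "openin (top_of_set (cvec (Suc n))) \<dots>" by (intro openin_Union) (auto simp: openin_scaled_box)
  ultimately have 1: "openin (top_of_set (cvec (Suc n))) {w \<in> cvec (Suc n). P w}" by simp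
  have 2: "P (\<lambda>i. c * w i)" if c: "c \<noteq> 0" "P w" for c w
  proof -
    obtain c' where c': "c' \<noteq> 0" "(\<lambda>i. c' * w i) \<in> box_nbhd (Suc n) z d" using c(2) by (auto simp: P_def)
    then have "(\<lambda>i. (c' / c) * (c * w i)) \<in> box_nbhd (Suc n) z d" using c(1) by simp
    then show ?thesis using c'(1) c(1) unfolding P_def by (intro exI[of _ "c' / c"]) auto
  qed
  have "{hpt w | w. w \<in> hcoords n \<and> P w} = hpt ` box_nbhd (Suc n) z d"
  proof (intro equalityI subsetI)
    fix x assume "x \<in> {hpt w | w. w \<in> hcoords n \<and> P w}"
    then obtain w c where w: "x = hpt w" "c \<noteq> 0" "(\<lambda>i. c * w i) \<in> box_nbhd (Suc n) z d"
      by (auto simp: P_def)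
    then show "x \<in> hpt ` box_nbhd (Suc n) z d"
      using hpt_scale[OF w(2), of w] by (metis image_eqI)
  next
    fix x assume "x \<in> hpt ` box_nbhd (Suc n) z d"
    then obtain w where w: "x = hpt w" "w \<in> box_nbhd (Suc n) z d" by auto
    then have "P w" unfolding P_def by (intro exI[of _ 1]) simp
    then show "x \<in> {hpt w | w. w \<in> hcoords n \<and> P w}" using w assms by blast
  qed
  then show ?thesis using openin_pspace_Collect[OF 1 2] by simp
qed

section \<open>The balls and their boundaries in terms of the form\<close>

lemma Re_hf_self_gball:
  "Re (hf (Suc r) (Suc (r + s)) z z) = (\<Sum>i=0..r. (cmod (z i))\<^sup>2) - (\<Sum>j=r+1..r+s. (cmod (z j))\<^sup>2)"
proof -
  have "{..<Suc (r + s)} = {0..r} \<union> {r+1..r+s}" by auto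
  then have "Re (hf (Suc r) (Suc (r + s)) z z)
      = (\<Sum>i=0..r. (if i < Suc r then 1 else - 1) * (cmod (z i))\<^sup>2)
      + (\<Sum>i=r+1..r+s. (if i < Suc r then 1 else - 1) * (cmod (z i))\<^sup>2)"
    unfolding Re_hf_self by (simp only:) (rule sum.union_disjoint, auto)
  also have "(\<Sum>i=0..r. (if i < Suc r then 1 else - 1) * (cmod (z i))\<^sup>2) = (\<Sum>i=0..r. (cmod (z i))\<^sup>2)"
    by (rule sum.cong) auto
  also have "(\<Sum>i=r+1..r+s. (if i < Suc r then 1 else - 1) * (cmod (z i))\<^sup>2) = - (\<Sum>i=r+1..r+s. (cmod (z i))\<^sup>2)"
    unfolding sum_negf[symmetric] by (rule sum.cong) auto
  finally show ?thesis by simp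
qed

lemma hpt_in_gball_iff_hf:
  "z \<in> hcoords n \<Longrightarrow> hpt z \<in> gball n r s \<longleftrightarrow> 0 < Re (hf (Suc r) (Suc (r + s)) z z)"
  by (simp add: hpt_in_gball_iff Re_hf_self_gball)

lemma gball_eq_hf: "gball n r s = {hpt z | z. z \<in> hcoords n \<and> 0 < Re (hf (Suc r) (Suc (r + s)) z z)}"
  by (auto simp: gball_def Re_hf_self_gball)

lemma hf_self_scale: "Re (hf a k (\<lambda>i. c * z i) (\<lambda>i. c * z i)) = (cmod c)\<^sup>2 * Re (hf a k z z)"
  by (simp add: Re_hf_self norm_mult power_mult_distrib sum_distrib_left mult_ac)

lemma openin_cvec_Collect_less:
  fixes \<psi> :: "(nat \<Rightarrow> complex) \<Rightarrow> real"
  assumes "continuous_on UNIV \<psi>"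
  shows "openin (top_of_set (cvec N)) {z \<in> cvec N. 0 < \<psi> z}"
proof -
  have "{z \<in> cvec N. 0 < \<psi> z} = cvec N \<inter> {z. 0 < \<psi> z}" by auto
  then show ?thesis using open_Collect_less[OF continuous_on_const assms] by (simp add: openin_open_Int)
qed

text \<open>Both signs of the form are open and scale-invariant conditions, so neither can hold at a
  boundary point.\<close>

lemma gball_bd_imp_null:
  assumes z: "z \<in> hcoords n" and bd: "hpt z \<in> gball_bd n r s"
  shows "hf (Suc r) (Suc (r + s)) z z = 0"
proof -
  let ?h = "\<lambda>z. Re (hf (Suc r) (Suc (r + s)) z z)"
  have op: "openin (pspace n) {hpt z | z. z \<in> hcoords n \<and> 0 < ?h z}"
    by (intro openin_pspace_Collect openin_cvec_Collect_less continuous_intros continuous_on_hf_self)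
      (simp add: hf_self_scale)
  have op': "openin (pspace n) {hpt z | z. z \<in> hcoords n \<and> 0 < - ?h z}"
    by (intro openin_pspace_Collect openin_cvec_Collect_less continuous_intros continuous_on_hf_self)
      (simp add: hf_self_scale mult_pos_neg)
  have fr: "hpt z \<in> pspace n closure_of gball n r s" "hpt z \<notin> pspace n interior_of gball n r s"
    using bd by (auto simp: gball_bd_def frontier_of_def)
  have "\<not> 0 < ?h z"
    using fr(2) z interior_of_openin[OF op] by (auto simp: gball_eq_hf)
  moreover have "\<not> ?h z < 0"
  proof
    assume "?h z < 0"
    define E where "E = {hpt z | z. z \<in> hcoords n \<and> 0 < - ?h z}"
    have "hpt z \<in> E" using \<open>?h z < 0\<close> z by (auto simp: E_def)
    moreover have "openin (pspace n) E" using op' by (simp only: E_def)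
    ultimately have "\<exists>y. y \<in> gball n r s \<and> y \<in> E" using fr(1) by (simp add: in_closure_of)
    then obtain y where "y \<in> hcoords n" "hpt y \<in> gball n r s" "0 < - ?h y" by (auto simp: E_def)
    then show False using hpt_in_gball_iff_hf[of y n r s] by simp
  qed
  ultimately have "?h z = 0" by linarith
  then show ?thesis using hf_self_eq by (metis of_real_0)
qed

text \<open>Outside the radical there is a direction \<open>v\<close> dual to \<open>z\<close> with
  \<open>hf v v\<close> nonnegative; moving a little along it makes the form positive, so
  \<open>z\<close> is a limit of points of the ball.\<close>

lemma null_imp_gball_bd:
  assumes z: "z \<in> hcoords n" and null: "hf (Suc r) (Suc (r + s)) z z = 0" and "r + s \<le> n"
    and i: "i \<le> r" "z i \<noteq> 0"
  shows "hpt z \<in> gball_bd n r s"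
proof -
  let ?h = "hf (Suc r) (Suc (r + s))"
  have zc: "z \<in> cvec (Suc n)" by (rule hcoords_cvec[OF z])
  obtain v where v: "v \<in> cvec (Suc n)" "?h v z = 1" "\<And>i. Suc r \<le> i \<Longrightarrow> v i = 0"
    by (rule dual_vector[of i "Suc r" "Suc (r + s)" "Suc n" z, OF _ _ _ i(2)])
      (use i(1) in simp, simp, use assms(3) in simp, rule that)
  have zv: "?h z v = 1" using hf_cnj[of "Suc r" "Suc (r + s)" v z] v(2) by simp
  have vv: "0 \<le> Re (?h v v)" unfolding Re_hf_self by (intro sum_nonneg) (use v(3) in auto)
  have "hpt z \<in> pspace n closure_of gball n r s"
    unfolding in_closure_of
  proof (intro conjI allI impI)
    show "hpt z \<in> topspace (pspace n)" using z by (simp add: topspace_pspace)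
    fix W assume W: "hpt z \<in> W \<and> openin (pspace n) W"
    obtain d where d: "d > 0" "box_nbhd (Suc n) z d \<subseteq> hcoords n" "\<And>w. w \<in> box_nbhd (Suc n) z d \<Longrightarrow> hpt w \<in> W"
      by (rule openin_pspace_contains_box[of n W z]) (use W z that in auto)
    obtain e where e: "e > 0" "\<And>t. cmod t < e \<Longrightarrow> (\<lambda>i. z i + t * v i) \<in> box_nbhd (Suc n) z d"
      by (rule line_box_ball[OF box_nbhd_center[OF zc d(1)] v(1)]) (rule that)
    let ?t = "complex_of_real (e / 2)"
    let ?w = "\<lambda>i. z i + ?t * v i"
    have w: "?w \<in> box_nbhd (Suc n) z d" by (rule e(2)) (use e(1) in simp)
    have "?h ?w ?w = ?t + cnj ?t + ?t * cnj ?t * ?h v v"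
      by (simp only: hf_linear null zv v(2)) (simp add: algebra_simps)
    also have "\<dots> = of_real (e + (e / 2)\<^sup>2 * Re (?h v v))"
      by (subst hf_self_eq) (simp add: power2_eq_square)
    finally have "Re (?h ?w ?w) = e + (e / 2)\<^sup>2 * Re (?h v v)" by (simp only: Re_complex_of_real)
    then have "0 < Re (?h ?w ?w)" using e(1) vv by (simp add: add_pos_nonneg)
    then have "hpt ?w \<in> gball n r s" using hpt_in_gball_iff_hf[of ?w n r s] subsetD[OF d(2) w] by simp
    then show "\<exists>y. y \<in> gball n r s \<and> y \<in> W" using d(3)[OF w] by (intro exI[of _ "hpt ?w"]) simp
  qed
  moreover have "hpt z \<notin> gball n r s" using hpt_in_gball_iff_hf[OF z] null by simp
  then have "hpt z \<notin> pspace n interior_of gball n r s" using interior_of_subset[of "pspace n" "gball n r s"] by auto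
  ultimately show ?thesis by (simp add: gball_bd_def frontier_of_def)
qed

section \<open>Affine charts and lifts\<close>

lemma aff_pt_chart_coords:
  assumes "z k \<noteq> 0"
  shows "aff_pt k (\<lambda>i. (if i < k then z i else z (Suc i)) / z k) = hpt z"
  unfolding aff_pt_def hpt_eq_iff
  by (rule exI[of _ "z k"]) (use assms in \<open>auto simp: fun_eq_iff\<close>)

lemma hol_on_chart:
  assumes \<phi>: "hol_on n T \<phi>" and "k \<le> n"
    and D: "\<And>z. z \<in> D \<Longrightarrow> z k \<noteq> 0 \<and> (\<lambda>i. (if i < k then z i else z (Suc i)) / z k) \<in> T"
  shows "hol_on (Suc n) D (\<lambda>z. \<phi> (\<lambda>i. (if i < k then z i else z (Suc i)) / z k))"
  unfolding hol_on_def
proof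
  fix z assume z: "z \<in> D"
  define \<iota> where "\<iota> i = (if i < k then i else Suc i)" for i
  define W where "W z = (\<lambda>i. z (\<iota> i) / z k)" for z :: "nat \<Rightarrow> complex"
  have W: "(\<lambda>i. (if i < k then z i else z (Suc i)) / z k) = W z" for z
    by (auto simp: W_def \<iota>_def)
  note D = D[unfolded W]
  have zk: "z k \<noteq> 0" "W z \<in> T" using D[OF z] by auto
  obtain a where a: "has_curve_derivative n T \<phi> (W z) a"
    using \<phi> zk(2) unfolding hol_on_def by blast
  \<comment> \<open>Quotient rule: the chart coordinate \<open>z (\<iota> i) / z k\<close> depends
    on the two coordinates \<open>\<iota> i\<close> and \<open>k\<close>.\<close>
  define A where "A j = (\<Sum>i<n. a i * ((if j = \<iota> i then 1 / z k else 0) - (if j = k then z (\<iota> i) / (z k * z k) else 0)))" for j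
  have "has_curve_derivative (Suc n) D (\<lambda>z. \<phi> (W z)) z A"
  proof (rule has_curve_derivativeI)
    fix g g' t\<^sub>0
    assume g: "\<And>i. i < Suc n \<Longrightarrow> ((\<lambda>t. g t i) has_field_derivative g' i) (at t\<^sub>0)" "g t\<^sub>0 = z"
      "\<forall>\<^sub>F t in nhds t\<^sub>0. g t \<in> D"
    define w' where "w' i = (g' (\<iota> i) * z k - z (\<iota> i) * g' k) / (z k * z k)" for i
    have \<iota>: "\<iota> i < Suc n" if "i < n" for i using that by (auto simp: \<iota>_def)
    have "((\<lambda>t. \<phi> (W (g t))) has_field_derivative (\<Sum>i<n. a i * w' i)) (at t\<^sub>0)"
    proof (rule has_curve_derivativeD[OF a])
      show "((\<lambda>t. W (g t) i) has_field_derivative w' i) (at t\<^sub>0)" if "i < n" for i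
        unfolding W_def w'_def g(2)[symmetric]
        by (rule DERIV_divide) (use g(1,2) \<iota>[OF that] \<open>k \<le> n\<close> zk in auto)
      show "W (g t\<^sub>0) = W z" by (simp add: g(2))
      show "\<forall>\<^sub>F t in nhds t\<^sub>0. W (g t) \<in> T"
        by (rule eventually_mono[OF g(3)]) (use D in auto)
    qed
    also have "(\<Sum>i<n. a i * w' i) = (\<Sum>j<Suc n. A j * g' j)"
    proof -
      have "(\<Sum>j<Suc n. ((if j = \<iota> i then 1 / z k else 0) - (if j = k then z (\<iota> i) / (z k * z k) else 0)) * g' j) = w' i"
        if "i < n" for i
      proof -
        have "(\<Sum>j<Suc n. ((if j = \<iota> i then 1 / z k else 0) - (if j = k then z (\<iota> i) / (z k * z k) else 0)) * g' j)
          = (\<Sum>j<Suc n. if j = \<iota> i then g' j / z k else 0) - (\<Sum>j<Suc n. if j = k then z (\<iota> i) / (z k * z k) * g' j else 0)"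
          unfolding sum_subtractf[symmetric] by (rule sum.cong) (auto simp: left_diff_distrib)
        also have "\<dots> = g' (\<iota> i) / z k - z (\<iota> i) / (z k * z k) * g' k"
          using \<iota>[OF that] \<open>k \<le> n\<close> by (simp only: sum.delta' sum.delta finite_lessThan lessThan_iff) simp
        also have "\<dots> = w' i" using zk by (simp add: w'_def field_simps)
        finally show ?thesis .
      qed
      then have "(\<Sum>i<n. a i * w' i) = (\<Sum>i<n. \<Sum>j<Suc n. a i * (((if j = \<iota> i then 1 / z k else 0) - (if j = k then z (\<iota> i) / (z k * z k) else 0)) * g' j))"
        unfolding sum_distrib_left[symmetric] by (intro sum.cong) auto
      also have "\<dots> = (\<Sum>j<Suc n. A j * g' j)"
        unfolding A_def sum_distrib_right by (subst sum.swap) (simp only: mult.assoc)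
      finally show ?thesis .
    qed
    finally show "((\<lambda>t. \<phi> (W (g t))) has_field_derivative (\<Sum>j<Suc n. A j * g' j)) (at t\<^sub>0)" .
  qed
  then show "\<exists>a. has_curve_derivative (Suc n) D (\<lambda>z. \<phi> (\<lambda>i. (if i < k then z i else z (Suc i)) / z k)) z a"
    unfolding W by blast
qed

lemma hol_on_const: "hol_on N D (\<lambda>z. c)"
  unfolding hol_on_def has_curve_derivative_def by (intro ballI exI[of _ "\<lambda>_. 0"]) simp

lemma hol_on_cong:
  assumes eq: "\<And>z. z \<in> D \<Longrightarrow> \<phi> z = \<psi> z" and "hol_on N D \<psi>"
  shows "hol_on N D \<phi>"
  unfolding hol_on_def
proof
  fix z assume "z \<in> D"
  then obtain a where a: "has_curve_derivative N D \<psi> z a" using assms(2) unfolding hol_on_def by blast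
  have "has_curve_derivative N D \<phi> z a"
  proof (rule has_curve_derivativeI)
    fix g g' t\<^sub>0
    assume g: "\<And>i. i < N \<Longrightarrow> ((\<lambda>t. g t i) has_field_derivative g' i) (at t\<^sub>0)" "g t\<^sub>0 = z"
      "\<forall>\<^sub>F t in nhds t\<^sub>0. g t \<in> D"
    have "\<forall>\<^sub>F t in nhds t\<^sub>0. \<phi> (g t) = \<psi> (g t)"
      by (rule eventually_mono[OF g(3)]) (rule eq)
    then show "((\<lambda>t. \<phi> (g t)) has_field_derivative (\<Sum>i<N. a i * g' i)) (at t\<^sub>0)"
      using has_curve_derivativeD[OF a, of g g' t\<^sub>0] g by (subst DERIV_cong_ev) auto
  qed
  then show "\<exists>a. has_curve_derivative N D \<phi> z a" by blast
qed

text \<open>In a target chart around \<open>f (hpt p)\<close> the lift has one coordinate equal to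
  1, so it never vanishes. Its other coordinates are chart coordinates of \<open>f\<close>, whose
  holomorphy passes from the source chart to homogeneous coordinates by the chain rule.\<close>

lemma local_lift:
  assumes f: "holo_map n m U f" and U: "openin (pspace n) U" and p: "p \<in> hcoords n" "hpt p \<in> U"
  obtains d F where "d > 0" "box_nbhd (Suc n) p d \<subseteq> hcoords n"
    "\<And>z. z \<in> box_nbhd (Suc n) p d \<Longrightarrow> hpt z \<in> U \<and> F z \<in> hcoords m \<and> f (hpt z) = hpt (F z)"
    "\<And>j. hol_on (Suc n) (box_nbhd (Suc n) p d) (\<lambda>z. F z j)"
proof -
  have cont: "continuous_map (subtopology (pspace n) U) (pspace m) f"
    using f by (simp add: holo_map_def)
  have top: "topspace (subtopology (pspace n) U) = U"
    using openin_subset[OF U] by (auto simp: topspace_subtopology)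
  have fU: "f x \<in> hpt ` hcoords m" if "x \<in> U" for x
    using continuous_map_image_subset_topspace[OF cont] that unfolding top topspace_pspace by blast
  obtain q where q: "q \<in> hcoords m" "f (hpt p) = hpt q" using fU[OF p(2)] by auto
  obtain l where l: "l \<le> m" "q l \<noteq> 0" by (rule hcoords_nonzero[OF q(1)])
  obtain k where k: "k \<le> n" "p k \<noteq> 0" by (rule hcoords_nonzero[OF p(1)])
  have chart: "openin (pspace N) {hpt z | z. z \<in> hcoords N \<and> z j \<noteq> 0}" for N j
  proof (rule openin_pspace_Collect)
    have "openin (top_of_set (cvec (Suc N))) {z \<in> cvec (Suc N). 0 < cmod (z j)}"
      by (intro openin_cvec_Collect_less continuous_intros continuous_on_product_coordinates)
    then show "openin (top_of_set (cvec (Suc N))) {z \<in> cvec (Suc N). z j \<noteq> 0}" by simp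
  qed simp
  define V where "V = aff_pt l ` cvec m"
  have V: "openin (pspace m) V" unfolding V_def aff_pt_image[OF l(1)] by (rule chart)
  have "openin (subtopology (pspace n) U) {x \<in> U. f x \<in> V}"
    using openin_continuous_map_preimage[OF cont V] unfolding top .
  then have W: "openin (pspace n) {x \<in> U. f x \<in> V}"
    using U openin_open_subtopology by blast
  have opn: "openin (pspace n) ({x \<in> U. f x \<in> V} \<inter> {hpt z | z. z \<in> hcoords n \<and> z k \<noteq> 0})"
    by (rule openin_Int[OF W chart])
  have "f (hpt p) \<in> V" unfolding V_def aff_pt_image[OF l(1)] using q l by blast
  then have pW: "hpt p \<in> {x \<in> U. f x \<in> V} \<inter> {hpt z | z. z \<in> hcoords n \<and> z k \<noteq> 0}" using p k by blast
  obtain d where d: "d > 0" "box_nbhd (Suc n) p d \<subseteq> hcoords n"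
    "\<And>w. w \<in> box_nbhd (Suc n) p d \<Longrightarrow> hpt w \<in> {x \<in> U. f x \<in> V} \<inter> {hpt z | z. z \<in> hcoords n \<and> z k \<noteq> 0}"
    by (rule openin_pspace_contains_box[OF opn p(1) pW]) (rule that)
  let ?D = "box_nbhd (Suc n) p d"
  have zk: "z k \<noteq> 0" if z: "z \<in> ?D" for z
  proof -
    obtain w where "hpt z = hpt w" "w k \<noteq> 0" using d(3)[OF z] by auto
    then show ?thesis by (auto simp: hpt_eq_iff)
  qed
  define \<zeta> where "\<zeta> x = aff_chart m l x" for x
  have zeta: "\<zeta> x \<in> cvec m" "aff_pt l (\<zeta> x) = x" if "x \<in> V" for x
    using that the_inv_into_into[OF inj_on_aff_pt[OF l(1)], of x "cvec m"]
      f_the_inv_into_f[OF inj_on_aff_pt[OF l(1)], of x] by (auto simp: V_def \<zeta>_def aff_chart_def)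
  define F where "F z = (\<lambda>i. if i < l then \<zeta> (f (hpt z)) i else if i = l then 1 else \<zeta> (f (hpt z)) (i - 1))" for z
  show ?thesis
  proof (rule that[OF d(1,2)])
    fix z assume z: "z \<in> ?D"
    then have zV: "f (hpt z) \<in> V" "hpt z \<in> U" using d(3) by blast+
    have "F z \<in> hcoords m"
      by (rule hcoordsI[of _ _ l]) (use zeta(1)[OF zV(1)] l(1) in \<open>auto simp: F_def cvec_def\<close>)
    moreover have "f (hpt z) = hpt (F z)"
      using zeta(2)[OF zV(1)] unfolding aff_pt_def F_def by simp
    ultimately show "hpt z \<in> U \<and> F z \<in> hcoords m \<and> f (hpt z) = hpt (F z)" using zV(2) by blast
  next
    define T where "T = {w \<in> cvec n. aff_pt k w \<in> U \<and> f (aff_pt k w) \<in> aff_pt l ` cvec m}"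
    have holi: "hol_on (Suc n) ?D (\<lambda>z. \<zeta> (f (hpt z)) i)" for i
    proof (cases "i < m")
      case True
      have "holo_fun n T (\<lambda>w. aff_chart m l (f (aff_pt k w)) i)"
        using f k(1) l(1) True unfolding holo_map_def T_def by blast
      then have "hol_on n T (\<lambda>w. aff_chart m l (f (aff_pt k w)) i)"
        by (rule holo_fun_imp_hol_on[rotated]) (auto simp: T_def)
      then have "hol_on (Suc n) ?D (\<lambda>z. aff_chart m l (f (aff_pt k (\<lambda>i. (if i < k then z i else z (Suc i)) / z k))) i)"
      proof (rule hol_on_chart[OF _ k(1)])
        fix z assume z: "z \<in> ?D"
        let ?w = "\<lambda>i. (if i < k then z i else z (Suc i)) / z k"
        have "?w \<in> cvec n" using box_nbhd_cvec[OF z] k(1) by (auto simp: cvec_def)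
        moreover have "aff_pt k ?w = hpt z" by (rule aff_pt_chart_coords[of z k, OF zk[OF z]])
        ultimately show "z k \<noteq> 0 \<and> ?w \<in> T" using zk[OF z] d(3)[OF z] by (simp add: T_def V_def)
      qed
      then show ?thesis
        by (rule hol_on_cong[rotated]) (simp add: aff_pt_chart_coords zk \<zeta>_def)
    next
      \<comment> \<open>\<open>holo_map\<close> speaks only of coordinates below \<open>m\<close>;
        the later ones vanish because \<open>\<zeta>\<close> takes values in
        \<open>cvec m\<close>.\<close>
      case False
      show ?thesis
        by (rule hol_on_cong[OF _ hol_on_const[of _ _ 0]])
          (use zeta(1) d(3) False in \<open>force simp: cvec_def\<close>)
    qed
    show "hol_on (Suc n) ?D (\<lambda>z. F z j)" for j
      unfolding F_def by (cases "j < l"; cases "j = l") (simp_all add: holi hol_on_const)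
  qed
qed

section \<open>Automorphisms from orthonormal frames\<close>

text \<open>The threshold \<open>a\<close> is that of the form: once \<open>a \<le> L\<close>, the
  frame contains a maximal positive family, and every further vector has to be negative.\<close>

definition hf_frame :: "nat \<Rightarrow> nat \<Rightarrow> nat \<Rightarrow> (nat \<Rightarrow> nat \<Rightarrow> complex) \<Rightarrow> bool" where
  "hf_frame a M L E \<longleftrightarrow> (\<forall>i<L. \<forall>j<L. hf a M (E i) (E j) = (if i = j then if i < a then 1 else - 1 else 0))"

lemma hf_frameD:
  "hf_frame a M L E \<Longrightarrow> i < L \<Longrightarrow> j < L \<Longrightarrow> hf a M (E i) (E j) = (if i = j then if i < a then 1 else - 1 else 0)"
  by (simp add: hf_frame_def)

lemma hf_frame_combination:
  assumes "hf_frame a M L E" "K \<le> L" "l < L"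
  shows "hf a M (\<lambda>i. \<Sum>j<K. c j * E j i) (E l) = (if l < K then if l < a then c l else - c l else 0)"
proof -
  have "hf a M (\<lambda>i. \<Sum>j<K. c j * E j i) (E l) = (\<Sum>j<K. if j = l then if l < a then c l else - c l else 0)"
    unfolding hf_linear by (rule sum.cong) (use hf_frameD[OF assms(1), of _ l] assms in auto)
  then show ?thesis by simp
qed

lemma hf_frame_length:
  assumes "hf_frame a M L E"
  shows "L \<le> M"
proof (rule ccontr)
  assume "\<not> L \<le> M"
  then obtain x where x: "\<exists>i\<in>{..<L}. x i \<noteq> 0" "\<forall>j<M. (\<Sum>i<L. E i j * x i) = 0"
    using homogeneous_system[of M "{..<L}" "\<lambda>i j. E j i"] by auto
  have "x l = 0" if "l < L" for l
  proof -
    have "hf a M (\<lambda>i. \<Sum>j<L. x j * E j i) (E l) = hf a M (\<lambda>i. 0) (E l)"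
      by (rule hf_cong) (use x(2) in \<open>auto simp: mult.commute\<close>)
    then show ?thesis using hf_frame_combination[OF assms order_refl that, of x] that
      by (auto simp: hf_zero_left split: if_splits)
  qed
  then show False using x(1) by blast
qed

text \<open>A nonzero vector orthogonal to the frame exists by counting equations. It is negative
  because the frame already exhausts the positive directions, so it can be scaled to length
  -1.\<close>

lemma hf_frame_extend:
  assumes "hf_frame a M L E" "a \<le> L" "L < M"
  shows "\<exists>x. hf_frame a M (Suc L) (E(L := x))"
proof -
  define \<sigma> where "\<sigma> i = (if i < a then (1::complex) else - 1)" for i
  obtain x where x: "\<exists>i\<in>{..<M}. x i \<noteq> 0" "\<forall>j<L. (\<Sum>i<M. \<sigma> i * cnj (E j i) * x i) = 0"
    using homogeneous_system[of L "{..<M}" "\<lambda>j i. \<sigma> i * cnj (E j i)"] assms(3) by auto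
  have xE: "hf a M x (E j) = 0" if "j < L" for j
    using x(2) that by (simp add: hf_def \<sigma>_def mult_ac)
  have Ex: "hf a M (E j) x = 0" if "j < L" for j by (rule hf_zero_sym[OF xE[OF that]])
  have neg: "Re (hf a M x x) < 0"
  proof (rule ccontr)
    assume "\<not> ?thesis"
    then have nonneg: "0 \<le> Re (hf a M x x)" by simp
    have "x i = 0" if "i < M" for i
    proof (rule orthogonal_positive_nonneg_zero[OF _ _ _ _ that, of a E])
      show "0 < Re (hf a M (E j) (E j))" if "j < a" for j
        using hf_frameD[OF assms(1), of j j] that assms(2) by simp
      show "hf a M (E i) (E j) = 0" if "i < a" "j < a" "i \<noteq> j" for i j
        using hf_frameD[OF assms(1), of i j] that assms(2) by simp
      show "hf a M x (E j) = 0" if "j < a" for j using xE that assms(2) by simp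
    qed (rule nonneg)
    then show False using x(1) by blast
  qed
  define c where "c = complex_of_real (1 / sqrt (- Re (hf a M x x)))"
  have "c * cnj c = of_real ((1 / sqrt (- Re (hf a M x x))) * (1 / sqrt (- Re (hf a M x x))))"
    by (simp only: c_def complex_cnj_complex_of_real of_real_mult)
  also have "(1 / sqrt (- Re (hf a M x x))) * (1 / sqrt (- Re (hf a M x x))) = - (1 / Re (hf a M x x))"
    using neg by simp
  finally have c: "c * cnj c = of_real (- (1 / Re (hf a M x x)))" .
  have "hf a M (\<lambda>i. c * x i) (\<lambda>i. c * x i) = (c * cnj c) * hf a M x x"
    by (simp only: hf_linear mult.assoc)
  also have "\<dots> = of_real (- (1 / Re (hf a M x x)) * Re (hf a M x x))"
    unfolding c of_real_mult hf_self_eq[of a M x, symmetric] ..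
  also have "\<dots> = - 1" using neg by simp
  finally have cc: "hf a M (\<lambda>i. c * x i) (\<lambda>i. c * x i) = - 1" .
  have "hf_frame a M (Suc L) (E(L := (\<lambda>i. c * x i)))"
    unfolding hf_frame_def
  proof (intro allI impI)
    fix i j assume "i < Suc L" "j < Suc L"
    moreover have "hf a M (E j) (\<lambda>i. c * x i) = 0" "hf a M (\<lambda>i. c * x i) (E j) = 0" if "j < L" for j
      by (simp_all only: hf_linear xE[OF that] Ex[OF that]) simp_all
    ultimately show "hf a M ((E(L := (\<lambda>i. c * x i))) i) ((E(L := (\<lambda>i. c * x i))) j)
        = (if i = j then if i < a then 1 else - 1 else 0)"
      using cc hf_frameD[OF assms(1), of i j] assms(2) by (auto simp: less_Suc_eq)
  qed
  then show ?thesis by blast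
qed

lemma hf_frame_basis:
  assumes C: "hf_frame a M k C" and "a \<le> k"
  obtains E where "hf_frame a M M E" "\<And>i. i < k \<Longrightarrow> E i = C i"
proof -
  have "\<exists>E. hf_frame a M (k + t) E \<and> (\<forall>i<k. E i = C i)" if "k + t \<le> M" for t
    using that
  proof (induction t)
    case 0
    then show ?case using C by auto
  next
    case (Suc t)
    then obtain E where E: "hf_frame a M (k + t) E" "\<forall>i<k. E i = C i" by auto
    have "a \<le> k + t" "k + t < M" using Suc.prems assms(2) by auto
    from hf_frame_extend[OF E(1) this] obtain x where x: "hf_frame a M (Suc (k + t)) (E(k + t := x))" ..
    show ?case
    proof (intro exI[of _ "E(k + t := x)"] conjI)
      show "hf_frame a M (k + Suc t) (E(k + t := x))" using x by (simp only: add_Suc_right)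
    qed (use E(2) in simp)
  qed
  from this[of "M - k"] hf_frame_length[OF C] show ?thesis using that by auto
qed

text \<open>\<open>x\<close> and the frame are \<open>M + 1\<close> vectors in \<open>M\<close>
  coordinates. Pairing a relation with each \<open>E l\<close> removes the frame vectors from it, so
  \<open>x\<close> is zero.\<close>

lemma hf_frame_complete:
  assumes E: "hf_frame a M M E" and x: "\<And>j. j < M \<Longrightarrow> hf a M x (E j) = 0" "i < M"
  shows "x i = 0"
proof -
  define X where "X j = (if j < M then E j else x)" for j
  obtain c where c: "\<exists>j\<in>{..<Suc M}. c j \<noteq> 0" "\<forall>i<M. (\<Sum>j<Suc M. X j i * c j) = 0"
    using homogeneous_system[of M "{..<Suc M}" "\<lambda>i j. X j i"] by auto
  have comb: "(\<Sum>j<M. c j * E j i) + c M * x i = 0" if "i < M" for i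
    using c(2) that by (simp add: X_def mult.commute)
  have z: "c l = 0" if "l < M" for l
  proof -
    have "hf a M (\<lambda>i. (\<Sum>j<M. c j * E j i) + c M * x i) (E l) = hf a M (\<lambda>i. 0) (E l)"
      by (rule hf_cong) (use comb in auto)
    moreover have "hf a M (\<lambda>i. (\<Sum>j<M. c j * E j i) + c M * x i) (E l) = hf a M (\<lambda>i. \<Sum>j<M. c j * E j i) (E l)"
      unfolding hf_add_left hf_scale_left x(1)[OF that] by simp
    ultimately show ?thesis using hf_frame_combination[OF E order_refl that, of c] that
      by (auto simp: hf_zero_left split: if_splits)
  qed
  then have "c M \<noteq> 0" using c(1) by (auto simp: less_Suc_eq)
  moreover have "(\<Sum>j<M. c j * E j i) = 0" by (rule sum.neutral) (use z in auto)
  ultimately show ?thesis using comb[OF x(2)] by simp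
qed

lemma mat_app_cvec: "mat_app M A z \<in> cvec M"
  by (simp add: mat_app_def cvec_def)

lemma mat_app_scale: "mat_app M A (\<lambda>i. c * z i) = (\<lambda>i. c * mat_app M A z i)"
  by (auto simp: mat_app_def sum_distrib_left mult_ac)

lemma mat_app_diff: "mat_app M A (\<lambda>i. z i - w i) = (\<lambda>i. mat_app M A z i - mat_app M A w i)"
  by (auto simp: mat_app_def sum_subtractf right_diff_distrib)

lemma proj_linear_of_matrix:
  assumes bij: "bij_betw (mat_app (Suc m) A) (cvec (Suc m)) (cvec (Suc m))"
  obtains \<Phi> where "\<Phi> \<in> extensional (topspace (pspace m))" "proj_linear m \<Phi>"
    "\<And>z. z \<in> hcoords m \<Longrightarrow> \<Phi> (hpt z) = hpt (mat_app (Suc m) A z)"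
proof -
  define \<Phi> where "\<Phi> = (\<lambda>x\<in>topspace (pspace m). hpt (mat_app (Suc m) A (SOME z. z \<in> x)))"
  have \<Phi>: "\<Phi> (hpt z) = hpt (mat_app (Suc m) A z)" if z: "z \<in> hcoords m" for z
  proof -
    have "(SOME w. w \<in> hpt z) \<in> hpt z" by (rule someI[of _ z]) (rule hpt_self)
    then obtain c where c: "c \<noteq> 0" "(SOME w. w \<in> hpt z) = (\<lambda>i. c * z i)" by (auto simp: hpt_def)
    have "\<Phi> (hpt z) = hpt (mat_app (Suc m) A (\<lambda>i. c * z i))"
      using z c(2) by (simp add: \<Phi>_def topspace_pspace)
    then show ?thesis by (simp add: mat_app_scale hpt_scale[OF c(1)])
  qed
  show ?thesis
  proof (rule that)
    show "\<Phi> \<in> extensional (topspace (pspace m))" unfolding \<Phi>_def by (rule restrict_extensional)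
    show "proj_linear m \<Phi>" unfolding proj_linear_def using bij \<Phi> by blast
  qed (rule \<Phi>)
qed

text \<open>Complete the frame to a basis and pass to coordinates in it. This preserves the form,
  hence the ball, and undoes the combination of the \<open>C j\<close>.\<close>

lemma automorphism_of_frame:
  assumes C: "hf_frame (Suc r) (Suc m) k C" and k: "Suc r \<le> k" and r: "r \<le> m"
  obtains \<Phi> where "\<Phi> \<in> Aut_gball1 m r"
    "\<And>z. (\<lambda>i. if i < Suc m then \<Sum>j<k. z j * C j i else 0) \<in> hcoords m \<Longrightarrow>
      \<Phi> (hpt (\<lambda>i. if i < Suc m then \<Sum>j<k. z j * C j i else 0)) = hpt (\<lambda>i. if i < k then z i else 0)"
proof -
  define a where "a = Suc r"
  define M where "M = Suc m"
  note C = C[folded a_def M_def] and k = k[folded a_def]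
  obtain E where E: "hf_frame a M M E" "\<And>i. i < k \<Longrightarrow> E i = C i"
    by (rule hf_frame_basis[OF C k]) (rule that)
  have kM: "k \<le> M" by (rule hf_frame_length[OF C])
  define \<sigma> where "\<sigma> i = (if i < a then (1::complex) else - 1)" for i
  \<comment> \<open>With these entries \<open>B x j\<close> is, up to sign, the product of
    \<open>x\<close> with \<open>E j\<close>, that is, the coordinate of \<open>x\<close> along
    \<open>E j\<close>. Its inverse is \<open>P\<close> below, which visibly preserves the
    form.\<close>
  define A where "A j i = \<sigma> j * (\<sigma> i * cnj (E j i))" for j i
  define B where "B = mat_app M A"
  have B: "B x j = (if j < M then \<sigma> j * hf a M x (E j) else 0)" for x j
    by (simp add: B_def mat_app_def A_def hf_def \<sigma>_def sum_distrib_left mult_ac)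
  have BC: "B (\<lambda>i. \<Sum>l<K. z l * E l i) = (\<lambda>j. if j < K then z j else 0)" if "K \<le> M" for z K
  proof
    fix j
    show "B (\<lambda>i. \<Sum>l<K. z l * E l i) j = (if j < K then z j else 0)"
      using that hf_frame_combination[OF E(1) that, of j z] by (auto simp: B \<sigma>_def)
  qed
  have B_cong: "B x = B y" if "\<And>i. i < M \<Longrightarrow> x i = y i" for x y
    unfolding B_def mat_app_def by (rule ext) (use that in auto)
  have B_zero: "x = (\<lambda>_. 0)" if "x \<in> cvec M" "B x = (\<lambda>_. 0)" for x
  proof
    fix i
    have "hf a M x (E j) = 0" if "j < M" for j
      using fun_cong[OF \<open>B x = (\<lambda>_. 0)\<close>, of j] that by (auto simp: B \<sigma>_def split: if_splits)
    then show "x i = 0" using hf_frame_complete[OF E(1), of x i] \<open>x \<in> cvec M\<close> by (cases "i < M") (auto simp: cvec_def)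
  qed
  have inj: "inj_on B (cvec M)"
  proof (rule inj_onI)
    fix x y assume xy: "x \<in> cvec M" "y \<in> cvec M" "B x = B y"
    have "(\<lambda>i. x i - y i) = (\<lambda>_. 0)"
    proof (rule B_zero)
      show "(\<lambda>i. x i - y i) \<in> cvec M" using xy by (simp add: cvec_def)
      show "B (\<lambda>i. x i - y i) = (\<lambda>_. 0)" using xy(3) by (simp add: B_def mat_app_diff)
    qed
    then show "x = y" by (auto simp: fun_eq_iff)
  qed
  define P where "P y = (\<lambda>i. if i < M then \<Sum>l<M. y l * E l i else 0)" for y
  have Pc: "P y \<in> cvec M" for y by (simp add: P_def cvec_def)
  have BP: "B (P y) = y" if "y \<in> cvec M" for y
  proof -
    have "B (P y) = B (\<lambda>i. \<Sum>l<M. y l * E l i)" by (rule B_cong) (simp add: P_def)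
    also have "\<dots> = (\<lambda>j. if j < M then y j else 0)" by (rule BC) simp
    also have "\<dots> = y" using that by (auto simp: cvec_def)
    finally show ?thesis .
  qed
  have Bc: "B x \<in> cvec M" for x unfolding B_def by (rule mat_app_cvec)
  have PB: "P (B x) = x" if "x \<in> cvec M" for x
    by (rule inj_onD[OF inj BP[OF Bc] Pc that])
  have form: "hf a M (P y) (P y) = hf a M y y" for y
  proof -
    have "hf a M (P y) (P y) = hf a M (\<lambda>i. \<Sum>l<M. y l * E l i) (\<lambda>i. \<Sum>l<M. y l * E l i)"
      by (rule hf_cong) (simp_all add: P_def)
    also have "\<dots> = (\<Sum>l<M. cnj (y l) * hf a M (\<lambda>i. \<Sum>l<M. y l * E l i) (E l))"
      by (simp only: hf_sum_right hf_scale_right)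
    also have "\<dots> = hf a M y y"
      unfolding hf_def[of a M y y] by (rule sum.cong) (auto simp: hf_frame_combination[OF E(1)])
    finally show ?thesis .
  qed
  have bij: "bij_betw B (cvec M) (cvec M)"
    using inj BP Pc Bc by (auto simp: bij_betw_def image_iff) metis
  obtain \<Phi> where \<Phi>: "\<Phi> \<in> extensional (topspace (pspace m))" "proj_linear m \<Phi>"
    "\<And>z. z \<in> hcoords m \<Longrightarrow> \<Phi> (hpt z) = hpt (B z)"
    by (rule proj_linear_of_matrix[of m A]) (use bij in \<open>simp add: B_def M_def\<close>, simp add: B_def M_def)
  have ball: "hpt z \<in> gball1 m r \<longleftrightarrow> 0 < Re (hf a M z z)" if "z \<in> hcoords m" for z
    using hpt_in_gball_iff_hf[OF that, of r "m - r"] r by (simp add: a_def M_def)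
  have hc: "z \<in> hcoords m \<longleftrightarrow> z \<in> cvec M \<and> z \<noteq> (\<lambda>_. 0)" for z by (auto simp: hcoords_def M_def)
  have "\<Phi> ` gball1 m r = gball1 m r"
  proof (intro equalityI subsetI)
    fix x assume "x \<in> \<Phi> ` gball1 m r"
    then obtain z where z: "z \<in> hcoords m" "hpt z \<in> gball1 m r" "x = \<Phi> (hpt z)"
      by (auto simp: gball_def)
    have Bz: "B z \<in> hcoords m" using B_zero[of z] Bc z(1) by (auto simp: hc)
    have "hf a M (B z) (B z) = hf a M z z" using form[of "B z"] PB[of z] z(1) by (simp add: hc)
    then show "x \<in> gball1 m r" using z(2,3) ball[OF z(1)] ball[OF Bz] \<Phi>(3)[OF z(1)] by simp
  next
    fix x assume "x \<in> gball1 m r"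
    then obtain y where y: "y \<in> hcoords m" "x = hpt y" "hpt y \<in> gball1 m r" by (auto simp: gball_def)
    have yc: "y \<in> cvec M" using y(1) by (simp add: hc)
    have Py: "P y \<in> hcoords m"
    proof -
      have "P y \<noteq> (\<lambda>_. 0)"
      proof
        assume "P y = (\<lambda>_. 0)"
        then have "y = B (\<lambda>_. 0)" using BP[OF yc] by simp
        then have "y = (\<lambda>_. 0)" by (auto simp: B_def mat_app_def)
        then show False using y(1) by (simp add: hc)
      qed
      then show ?thesis using Pc by (simp add: hc)
    qed
    have "hpt (P y) \<in> gball1 m r" using y(3) ball[OF y(1)] ball[OF Py] form by simp
    moreover have "\<Phi> (hpt (P y)) = x" using \<Phi>(3)[OF Py] BP[OF yc] y(2) by simp
    ultimately show "x \<in> \<Phi> ` gball1 m r" by (metis image_eqI)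
  qed
  then have "\<Phi> \<in> Aut_gball1 m r" using \<Phi>(1,2) by (simp add: Aut_gball1_def)
  then show ?thesis
  proof (rule that)
    fix z
    let ?w = "\<lambda>i. if i < Suc m then \<Sum>j<k. z j * C j i else 0"
    assume w: "?w \<in> hcoords m"
    have "B ?w = B (\<lambda>i. \<Sum>l<k. z l * E l i)" by (rule B_cong) (use E(2) in \<open>auto simp: M_def\<close>)
    then show "\<Phi> (hpt ?w) = hpt (\<lambda>i. if i < k then z i else 0)"
      using \<Phi>(3)[OF w] BC[OF kM] by simp
  qed
qed

section \<open>Rigidity\<close>

text \<open>The given boundary point may lie in the radical, where it has no dual vector. Then a
  small multiple of a null vector with positive part is added: the form stays zero, since only the
  added vector contributes.\<close>

lemma nonradical_null_point:
  assumes rs: "r + s \<le> n" "0 < s" and U: "openin (pspace n) U" and bd: "U \<inter> gball_bd n r s \<noteq> {}"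
  obtains p i where "p \<in> hcoords n" "hpt p \<in> U" "hf (Suc r) (Suc (r + s)) p p = 0" "i \<le> r" "p i \<noteq> 0"
proof -
  let ?h = "hf (Suc r) (Suc (r + s))"
  obtain x where x: "x \<in> U" "x \<in> gball_bd n r s" using bd by blast
  obtain z where z: "z \<in> hcoords n" "x = hpt z" using x(1) openin_subset[OF U] by (auto simp: topspace_pspace)
  have zz: "?h z z = 0" using gball_bd_imp_null[OF z(1)] x(2) z(2) by simp
  show ?thesis
  proof (cases "\<exists>i\<le>r. z i \<noteq> 0")
    case True
    then show ?thesis using that z x(1) zz by blast
  next
    case False
    have "(\<Sum>i=r+1..r+s. (cmod (z i))\<^sup>2) = 0"
      using zz Re_hf_self_gball[of r s z] False by simp
    then have "\<forall>i\<in>{r+1..r+s}. z i = 0" by (subst (asm) sum_nonneg_eq_0_iff) auto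
    then have z0: "z i = 0" if "i < Suc (r + s)" for i using False that by (cases "i \<le> r") auto
    \<comment> \<open>One positive and one negative unit vector; the index \<open>Suc r\<close> is
      available because \<open>s\<close> is positive.\<close>
    define v where "v = (\<lambda>i. if i = 0 \<or> i = Suc r then (1::complex) else 0)"
    have vc: "v \<in> cvec (Suc n)" using rs by (auto simp: v_def cvec_def)
    obtain d where d: "d > 0" "box_nbhd (Suc n) z d \<subseteq> hcoords n" "\<And>w. w \<in> box_nbhd (Suc n) z d \<Longrightarrow> hpt w \<in> U"
      by (rule openin_pspace_contains_box[OF U z(1)]) (use x(1) z(2) in simp, rule that)
    obtain e where e: "e > 0" "\<And>t. cmod t < e \<Longrightarrow> (\<lambda>i. z i + t * v i) \<in> box_nbhd (Suc n) z d"
      by (rule line_box_ball[OF box_nbhd_center[OF hcoords_cvec[OF z(1)] d(1)] vc]) (rule that)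
    define t where "t = complex_of_real (e / 2)"
    define p where "p = (\<lambda>i. z i + t * v i)"
    have p: "p \<in> box_nbhd (Suc n) z d" unfolding p_def t_def by (rule e(2)) (use e(1) in simp)
    have v_eq: "v = (\<lambda>i. (if i = 0 then 1 else 0) + (if i = Suc r then 1 else 0))" by (auto simp: v_def)
    have vv: "?h v v = 0"
      by (subst v_eq) (use rs(2) in \<open>simp add: hf_add_left hf_unit_left v_def\<close>)
    have "?h p p = ?h (\<lambda>i. t * v i) (\<lambda>i. t * v i)" by (rule hf_cong) (auto simp: p_def z0)
    also have "\<dots> = 0" by (simp only: hf_linear vv) simp
    finally have "?h p p = 0" .
    moreover have "p 0 \<noteq> 0" using e(1) z0 by (simp add: p_def v_def t_def)
    ultimately show ?thesis using that[of p 0] p d(2,3) by blast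
  qed
qed

theorem theorem1p1:
  fixes n m r s r' :: nat
    and U :: "ppoint set"
    and f :: "ppoint \<Rightarrow> ppoint"
  assumes "r + s \<le> n" and "r' \<le> m"
    and "1 \<le> r'" and "r' \<le> r" and "r < s"
    and "openin (pspace n) U" and "connectedin (pspace n) U"
    and "U \<inter> gball_bd n r s \<noteq> {}"
    and "holo_map n m U f"
    and "f ` (U \<inter> gball n r s) \<subseteq> gball1 m r'"
    and "f ` (U \<inter> gball_bd n r s) \<subseteq> gball1_bd m r'"
  shows "r = r' \<and>
    (\<exists>\<Phi>\<in>Aut_gball1 m r'. \<forall>z\<in>hcoords n. hpt z \<in> U \<longrightarrow>
       \<Phi> (f (hpt z)) = hpt (\<lambda>i. if i \<le> r + s then z i else 0))"
proof -
  note U = assms(6)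
  let ?B = "box_nbhd (Suc n)" and ?H = "hf (Suc r') (Suc m)"
  define a where "a = Suc r"
  define k where "k = Suc (r + s)"
  have Ul: "z \<in> hcoords n \<Longrightarrow> hpt z \<in> gball n r s \<longleftrightarrow> 0 < Re (hf a k z z)" for z
    unfolding a_def k_def by (rule hpt_in_gball_iff_hf)
  have mr: "Suc (r' + (m - r')) = Suc m" using assms(2) by simp
  obtain p i0 where p: "p \<in> hcoords n" "hpt p \<in> U" "hf a k p p = 0" "i0 \<le> r" "p i0 \<noteq> 0"
    by (rule nonradical_null_point[OF assms(1) _ U assms(8), folded a_def k_def]) (use assms(5) in simp, rule that)
  have pc: "p \<in> cvec (Suc n)" by (rule hcoords_cvec[OF p(1)])
  obtain d1 F where d1: "d1 > 0" "?B p d1 \<subseteq> hcoords n"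
    and F: "\<And>z. z \<in> ?B p d1 \<Longrightarrow> hpt z \<in> U \<and> F z \<in> hcoords m \<and> f (hpt z) = hpt (F z)"
    "\<And>j. hol_on (Suc n) (?B p d1) (\<lambda>z. F z j)"
    by (rule local_lift[OF assms(9) U p(1,2)]) (rule that)
  \<comment> \<open>The second bound keeps coordinate \<open>i0\<close> away from zero, so that null
    vectors of the box give boundary points and polarization applies.\<close>
  define d2 where "d2 = min d1 (cmod (p i0))"
  have d2: "d2 > 0" "d2 \<le> d1" using d1 p(5) by (auto simp: d2_def)
  have sub: "?B p e \<subseteq> ?B p e'" if "e \<le> e'" for e e'
    using that by (force simp: box_nbhd_def)
  have i0n: "i0 < Suc n" using p(4) assms(1) by simp
  have z_i0: "z i0 \<noteq> 0" if "z \<in> ?B p d2" for z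
  proof
    assume "z i0 = 0"
    then have "cmod (p i0) < d2" using that i0n by (force simp: box_nbhd_def)
    then show False by (simp add: d2_def)
  qed
  have pos: "0 < Re (?H (F z) (F z))"
    if z: "z \<in> ?B p d1" "0 < Re (hf a k z z)" for z
  proof -
    have "hpt z \<in> gball n r s" using Ul d1(2) z by blast
    then have "hpt (F z) \<in> gball1 m r'" using assms(10) F(1)[OF z(1)] by force
    then show ?thesis using hpt_in_gball_iff_hf[of "F z" m r' "m - r'"] F(1)[OF z(1)] mr by simp
  qed
  have null: "?H (F z) (F z) = 0"
    if z: "z \<in> ?B p d2" "hf a k z z = 0" for z
  proof -
    have z1: "z \<in> ?B p d1" using z(1) sub[OF d2(2)] by blast
    then have zh: "z \<in> hcoords n" using d1(2) by blast
    have "hpt z \<in> gball_bd n r s"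
      by (rule null_imp_gball_bd[OF zh _ assms(1) p(4) z_i0[OF z(1)]]) (use z(2) in \<open>simp add: a_def k_def\<close>)
    then have "hpt (F z) \<in> gball1_bd m r'" using assms(11) F(1)[OF z1] by force
    then show ?thesis using gball_bd_imp_null[of "F z" m r' "m - r'"] F(1)[OF z1] mr by simp
  qed
  have "\<exists>d'>0. d' \<le> d2 \<and> (\<forall>z\<in>?B p d'. \<forall>w\<in>?B p d'.
    hf a k z w = 0 \<longrightarrow> ?H (F z) (F w) = 0)"
  proof (rule polarization[OF _ null pc p(3) _ p(5) d2(1)])
    show "hol_on (Suc n) (?B p d2) (\<lambda>z. F z j)" for j
      by (rule hol_on_subset[OF F(2) sub[OF d2(2)]])
  qed (use p(4) assms(1) in \<open>auto simp: k_def\<close>)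
  then obtain d where d: "d > 0" "d \<le> d2" and orth: "\<And>z w. z \<in> ?B p d \<Longrightarrow>
     w \<in> ?B p d \<Longrightarrow> hf a k z w = 0 \<Longrightarrow> ?H (F z) (F w) = 0" by blast
  have s1: "?B p d \<subseteq> ?B p d2" "?B p d \<subseteq> ?B p d1"
    using sub d(2) d2(2) by (meson order_trans)+
  interpret L: orthogonal_map a k "Suc n" "Suc r'" "Suc m" i0 p d F
  proof
    show "\<exists>j<Suc m. F z j \<noteq> 0" if "z \<in> ?B p d" for z
    proof -
      have "F z \<in> hcoords m" using F(1) s1(2) that by blast
      then show ?thesis by (rule hcoords_nonzero) (auto simp: less_Suc_eq_le)
    qed
    show "hol_on (Suc n) (?B p d) (\<lambda>z. F z j)" for j
      by (rule hol_on_subset[OF F(2) s1(2)])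
    show "0 < Re (?H (F z) (F z))"
      if "z \<in> ?B p d" "0 < Re (hf a k z z)" for z
      by (rule pos[OF subsetD[OF s1(2) that(1)] that(2)])
  qed (use assms(1-5) p pc d(1) z_i0 s1(1) orth in \<open>auto simp: a_def k_def\<close>)
  have rr: "r' = r" using L.index_eq by (simp add: a_def)
  obtain C y0 e where e: "e > 0" "y0 \<in> ?B y0 e" "?B y0 e \<subseteq> ?B p d"
    and C: "\<And>i j. i < k \<Longrightarrow> j < k \<Longrightarrow> ?H (C i) (C j) = (if i = j then if i < a then 1 else - 1 else 0)"
    and FC: "\<And>w. w \<in> ?B y0 e \<Longrightarrow> \<exists>c. c \<noteq> 0 \<and> (\<forall>i<Suc m. F w i = c * (\<Sum>j<k. w j * C j i))"
    by (rule L.linear_up_to_factor) (rule that)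
  define A where "A z = (\<lambda>i. if i < Suc m then \<Sum>j<k. z j * C j i else 0)" for z
  have A_line: "A (\<lambda>i. b i + t * v i) j = A b j + t * A v j" for b t v j
    by (simp add: A_def algebra_simps sum.distrib sum_distrib_left)
  have A_scale: "A (\<lambda>i. c * z i) j = c * A z j" for c z j
    by (simp add: A_def sum_distrib_left mult_ac)
  \<comment> \<open>Equality of \<open>f (hpt z)\<close> with the point of \<open>A z\<close>,
    written with minors: meaningful before \<open>A z\<close> is known to be nonzero, and a
    holomorphic equation in any lift.\<close>
  define agree where "agree z \<longleftrightarrow> (\<forall>w. f (hpt z) = hpt w \<longrightarrow> (\<forall>i j. w i * A z j = w j * A z i))" for z
  have agreeI: "agree z" if zw: "f (hpt z) = hpt w" "\<And>i j. w i * A z j = w j * A z i" for z w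
    unfolding agree_def
  proof (intro allI impI)
    fix w' i j assume "f (hpt z) = hpt w'"
    then obtain c where "w' = (\<lambda>i. c * w i)" using zw(1) by (auto simp: hpt_eq_iff)
    then show "w' i * A z j = w' j * A z i" using zw(2)[of i j] by simp
  qed
  have agree_scale: "agree (\<lambda>i. c * z i)" if "c \<noteq> 0" "agree z" for c z
    using that(2) unfolding agree_def hpt_scale[OF that(1)] A_scale by auto

  text \<open>By the identity theorem along lines, agreement near one point of a box with a local lift spreads to the box.\<close>
  define E where "E = {x. \<exists>W. openin (pspace n) W \<and> x \<in> W \<and> W \<subseteq> U \<and> (\<forall>z\<in>hcoords n. hpt z \<in> W \<longrightarrow> agree z)}"
  have spread: "agree z"
    if D: "?B q \<delta> \<subseteq> hcoords n"
      and G: "\<And>z. z \<in> ?B q \<delta> \<Longrightarrow> hpt z \<in> U \<and> G z \<in> hcoords m \<and> f (hpt z) = hpt (G z)"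
        "\<And>j. hol_on (Suc n) (?B q \<delta>) (\<lambda>z. G z j)"
      and z1: "z1 \<in> ?B q \<delta>" "hpt z1 \<in> E" and z: "z \<in> ?B q \<delta>" for q \<delta> G z1 z
  proof -
    obtain W where W: "openin (pspace n) W" "hpt z1 \<in> W" "\<forall>z\<in>hcoords n. hpt z \<in> W \<longrightarrow> agree z"
      using z1(2) by (auto simp: E_def)
    have z1h: "z1 \<in> hcoords n" using z1(1) D by blast
    obtain \<epsilon> where \<epsilon>: "\<epsilon> > 0" "?B z1 \<epsilon> \<subseteq> hcoords n" "\<And>w. w \<in> ?B z1 \<epsilon> \<Longrightarrow> hpt w \<in> W"
      by (rule openin_pspace_contains_box[OF W(1) z1h W(2)]) (rule that)
    have cv: "z1 \<in> cvec (Suc n)" "z \<in> cvec (Suc n)" using z1(1) z box_nbhd_cvec by blast+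
    then have vc: "(\<lambda>i. z i - z1 i) \<in> cvec (Suc n)" by (simp add: cvec_def)
    let ?x = "\<lambda>t i. z1 i + t * (z i - z1 i)"
    have "G z i * A z j = G z j * A z i" for i j
    proof -
      define \<psi> where "\<psi> t = G (?x t) i * A (?x t) j - G (?x t) j * A (?x t) i" for t
      have "\<psi> 1 = 0"
      proof (rule line_identity[OF cv(1) vc, of \<psi> q \<delta> 0 1])
        show "\<psi> holomorphic_on {t. ?x t \<in> ?B q \<delta>}"
          unfolding \<psi>_def A_line by (intro holomorphic_intros hol_on_line[OF G(2) cv(1) vc])
        have "\<forall>\<^sub>F t in nhds 0. ?x t \<in> ?B q \<delta>" by (rule eventually_line_box[OF z1(1) vc])
        moreover have "\<forall>\<^sub>F t in nhds 0. ?x t \<in> ?B z1 \<epsilon>"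
          by (rule eventually_line_box[OF box_nbhd_center[OF cv(1) \<epsilon>(1)] vc])
        ultimately show "\<forall>\<^sub>F t in nhds 0. \<psi> t = 0"
        proof eventually_elim
          case (elim t)
          have "agree (?x t)" using W(3) \<epsilon>(2,3) elim(2) by blast
          then show ?case using G(1)[OF elim(1)] unfolding agree_def \<psi>_def by auto
        qed
      qed (use z1(1) z in simp_all)
      then show ?thesis by (simp add: \<psi>_def)
    qed
    then show ?thesis using G(1)[OF z] agreeI by blast
  qed
  have U_sub: "U \<subseteq> hpt ` hcoords n" using openin_subset[OF U] by (simp add: topspace_pspace)
  have E_U: "E \<subseteq> U" by (auto simp: E_def)
  have E_open: "openin (pspace n) E"
    by (subst openin_subopen) (auto simp: E_def)
  have box_in_E: "hpt q \<in> E"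
    if \<delta>: "\<delta> > 0" "?B q \<delta> \<subseteq> hcoords n" "q \<in> hcoords n"
      and ag: "\<And>z. z \<in> ?B q \<delta> \<Longrightarrow> hpt z \<in> U \<and> agree z" for q \<delta>
    unfolding E_def
  proof (intro CollectI exI[of _ "hpt ` ?B q \<delta>"] conjI ballI impI)
    show "openin (pspace n) (hpt ` ?B q \<delta>)" by (rule openin_hpt_box[OF \<delta>(2)])
    show "hpt q \<in> hpt ` ?B q \<delta>" using box_nbhd_center[OF hcoords_cvec[OF \<delta>(3)] \<delta>(1)] by blast
    show "hpt ` ?B q \<delta> \<subseteq> U" using ag by blast
    fix z assume "hpt z \<in> hpt ` ?B q \<delta>"
    then obtain w where w: "w \<in> ?B q \<delta>" "hpt w = hpt z" by auto
    then obtain c where "c \<noteq> 0" "z = (\<lambda>i. c * w i)" by (auto simp: hpt_eq_iff)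
    then show "agree z" using agree_scale[of c w] ag[OF w(1)] by simp
  qed
  \<comment> \<open>A lift box around a point outside \<open>E\<close> cannot meet \<open>E\<close>,
    since agreement would spread from there to the whole box and put its centre into
    \<open>E\<close>. With connectedness this gives \<open>E = U\<close>.\<close>
  have compl_open: "openin (pspace n) (U - E)"
  proof (subst openin_subopen, intro ballI)
    fix x assume x: "x \<in> U - E"
    then obtain q where q: "q \<in> hcoords n" "x = hpt q" using U_sub by blast
    obtain \<delta> G where \<delta>: "\<delta> > 0" "?B q \<delta> \<subseteq> hcoords n"
      and G: "\<And>z. z \<in> ?B q \<delta> \<Longrightarrow> hpt z \<in> U \<and> G z \<in> hcoords m \<and> f (hpt z) = hpt (G z)"
        "\<And>j. hol_on (Suc n) (?B q \<delta>) (\<lambda>z. G z j)"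
      by (rule local_lift[OF assms(9) U q(1)]) (use x q(2) in simp, rule that)
    have "hpt z1 \<notin> E" if "z1 \<in> ?B q \<delta>" for z1
    proof
      assume "hpt z1 \<in> E"
      then have "hpt q \<in> E"
        using spread[OF \<delta>(2) G that] G(1) by (intro box_in_E[OF \<delta> q(1)]) blast
      then show False using x q(2) by simp
    qed
    then show "\<exists>T. openin (pspace n) T \<and> x \<in> T \<and> T \<subseteq> U - E"
      using openin_hpt_box[OF \<delta>(2)] q G(1) box_nbhd_center[OF hcoords_cvec[OF q(1)] \<delta>(1)]
      by (intro exI[of _ "hpt ` ?B q \<delta>"]) auto
  qed
  have y0h: "y0 \<in> hcoords n" using e(2,3) s1(2) d1(2) by blast
  have "hpt y0 \<in> E"
  proof (rule box_in_E[OF e(1) _ y0h])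
    show "?B y0 e \<subseteq> hcoords n" using e(3) s1(2) d1(2) by blast
    fix z assume z: "z \<in> ?B y0 e"
    then have z1: "z \<in> ?B p d1" using e(3) s1(2) by blast
    obtain c where c: "\<And>i. i < Suc m \<Longrightarrow> F z i = c * (\<Sum>j<k. z j * C j i)" using FC[OF z] by blast
    have "F z i = c * A z i" for i
      using c[of i] F(1)[OF z1] by (cases "i < Suc m") (auto simp: A_def hcoords_def cvec_def)
    then show "hpt z \<in> U \<and> agree z" using F(1)[OF z1] by (auto intro!: agreeI[of z "F z"])
  qed
  then have "U \<subseteq> E"
    using assms(7) E_open compl_open E_U unfolding connectedin by blast
  then have agree: "agree z" if "z \<in> hcoords n" "hpt z \<in> U" for z
    using that by (auto simp: E_def)

  have frame: "hf_frame (Suc r') (Suc m) k C" using C by (simp add: hf_frame_def a_def rr)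
  text \<open>A lift at a zero of \<^term>\<open>A\<close> would be parallel to both \<^term>\<open>C 0\<close> and \<^term>\<open>C 1\<close>, as a limit along lines.\<close>
  have A_nonzero: "\<exists>i. A z i \<noteq> 0" if z: "z \<in> hcoords n" "hpt z \<in> U" for z
  proof (rule ccontr)
    assume "\<not> ?thesis"
    then have Az: "A z i = 0" for i by blast
    obtain \<delta> G where \<delta>: "\<delta> > 0" "?B z \<delta> \<subseteq> hcoords n"
      and G: "\<And>w. w \<in> ?B z \<delta> \<Longrightarrow> hpt w \<in> U \<and> G w \<in> hcoords m \<and> f (hpt w) = hpt (G w)"
        "\<And>j. hol_on (Suc n) (?B z \<delta>) (\<lambda>z. G z j)"
      by (rule local_lift[OF assms(9) U z]) (rule that)
    have zc: "z \<in> cvec (Suc n)" by (rule hcoords_cvec[OF z(1)])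
    have zB: "z \<in> ?B z \<delta>" by (rule box_nbhd_center[OF zc \<delta>(1)])
    have par: "G z i * A v j = G z j * A v i" if v: "v \<in> cvec (Suc n)" for v i j
    proof -
      let ?x = "\<lambda>t i. z i + t * v i"
      define S where "S = {t. ?x t \<in> ?B z \<delta>}"
      define \<psi> where "\<psi> t = G (?x t) i * A v j - G (?x t) j * A v i" for t
      have "\<psi> 0 = 0"
      proof (rule holomorphic_zero_at_puncture[where f = \<psi> and S = S and x = 0])
        show "\<psi> holomorphic_on S"
          unfolding \<psi>_def S_def by (intro holomorphic_intros hol_on_line[OF G(2) zc v])
        show "open S" "0 \<in> S" unfolding S_def using open_line_box[OF zc v] zB by auto
        fix t assume t: "t \<in> S" "t \<noteq> 0"
        then have xB: "?x t \<in> ?B z \<delta>" by (simp add: S_def)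
        have "agree (?x t)" using agree \<delta>(2) G(1)[OF xB] xB by blast
        then have "G (?x t) i * A (?x t) j = G (?x t) j * A (?x t) i"
          using G(1)[OF xB] by (simp add: agree_def)
        then have "t * \<psi> t = 0" unfolding A_line Az \<psi>_def by (simp add: algebra_simps)
        then show "\<psi> t = 0" using t(2) by simp
      qed
      then show ?thesis by (simp add: \<psi>_def)
    qed
    obtain l where l: "l \<le> m" "G z l \<noteq> 0" by (rule hcoords_nonzero[of "G z" m]) (use G(1)[OF zB] in simp, rule that)
    \<comment> \<open>Applied to unit vectors, \<open>par\<close> makes each column a multiple of
      \<open>G z\<close>. Two orthogonal columns of nonzero length cannot both be such
      multiples.\<close>
    have Cpar: "\<exists>c. \<forall>i<Suc m. C j i = c * G z i" if j: "j < k" for j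
    proof -
      define v where "v = (\<lambda>i. if i = j then (1::complex) else 0)"
      have "v \<in> cvec (Suc n)" using j assms(1) by (auto simp: v_def k_def cvec_def)
      moreover have "A v i = C j i" if "i < Suc m" for i
      proof -
        have "(\<Sum>j'<k. v j' * C j' i) = (\<Sum>j'<k. if j' = j then C j i else 0)"
          by (rule sum.cong) (auto simp: v_def)
        then show ?thesis using that j by (simp add: A_def)
      qed
      ultimately have "C j i = (C j l / G z l) * G z i" if "i < Suc m" for i
        using par[of v l i] that l by (simp add: field_simps)
      then show ?thesis by blast
    qed
    have k2: "0 < k" "Suc 0 < k" using assms(5) by (auto simp: k_def)
    obtain c0 where c0: "\<And>i. i < Suc m \<Longrightarrow> C 0 i = c0 * G z i" using Cpar[OF k2(1)] by blast
    obtain c1 where c1: "\<And>i. i < Suc m \<Longrightarrow> C (Suc 0) i = c1 * G z i" using Cpar[OF k2(2)] by blast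
    let ?g = "?H (G z) (G z)"
    have "?H (C 0) (C 0) = ?H (\<lambda>i. c0 * G z i) (\<lambda>i. c0 * G z i)"
      "?H (C 0) (C (Suc 0)) = ?H (\<lambda>i. c0 * G z i) (\<lambda>i. c1 * G z i)"
      "?H (C (Suc 0)) (C (Suc 0)) = ?H (\<lambda>i. c1 * G z i) (\<lambda>i. c1 * G z i)"
      by (rule hf_cong; simp add: c0 c1)+
    then have "c0 * (cnj c0 * ?g) = 1" "c0 * (cnj c1 * ?g) = 0" "c1 * (cnj c1 * ?g) \<noteq> 0"
      using C[OF k2(1) k2(1)] C[OF k2(1) k2(2)] C[OF k2(2) k2(2)]
      by (simp_all only: hf_linear) (auto simp: a_def split: if_splits)
    then show False by auto
  qed
  have A_eq: "f (hpt z) = hpt (A z) \<and> A z \<in> hcoords m" if z: "z \<in> hcoords n" "hpt z \<in> U" for z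
  proof -
    obtain \<delta> G where \<delta>: "\<delta> > 0" "?B z \<delta> \<subseteq> hcoords n"
      and G: "\<And>w. w \<in> ?B z \<delta> \<Longrightarrow> hpt w \<in> U \<and> G w \<in> hcoords m \<and> f (hpt w) = hpt (G w)"
        "\<And>j. hol_on (Suc n) (?B z \<delta>) (\<lambda>z. G z j)"
      by (rule local_lift[OF assms(9) U z]) (rule that)
    have G: "G z \<in> hcoords m" "f (hpt z) = hpt (G z)"
      using G(1)[OF box_nbhd_center[OF hcoords_cvec[OF z(1)] \<delta>(1)]] by auto
    obtain l where l: "A z l \<noteq> 0" using A_nonzero[OF z] by blast
    \<comment> \<open>With \<open>A z\<close> nonzero, the vanishing minors become proportionality
      of the lift to \<open>A z\<close>, so \<open>A z\<close> represents the value of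
      \<open>f\<close>.\<close>
    have Gl: "G z i = (G z l / A z l) * A z i" for i
      using agree[OF z] G(2) l unfolding agree_def by (auto simp: field_simps)
    have "G z l / A z l \<noteq> 0"
    proof
      assume "G z l / A z l = 0"
      then have "G z i = 0" for i by (subst Gl) (simp only: mult_zero_left)
      then show False using hcoords_nonzero[OF G(1)] by metis
    qed
    moreover have "G z = (\<lambda>i. (G z l / A z l) * A z i)" using Gl by blast
    ultimately have "hpt (A z) = hpt (G z)" unfolding hpt_eq_iff by blast
    moreover have "A z \<in> hcoords m" by (rule hcoordsI[of "A z" m l, OF _ l]) (simp add: A_def cvec_def)
    ultimately show ?thesis using G(2) by simp
  qed
  obtain \<Phi> where \<Phi>: "\<Phi> \<in> Aut_gball1 m r'"
    "\<And>z. A z \<in> hcoords m \<Longrightarrow> \<Phi> (hpt (A z)) = hpt (\<lambda>i. if i < k then z i else 0)"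
    by (rule automorphism_of_frame[OF frame _ assms(2), folded A_def]) (use rr in \<open>simp add: k_def\<close>, rule that)
  have "\<Phi> (f (hpt z)) = hpt (\<lambda>i. if i \<le> r + s then z i else 0)" if "z \<in> hcoords n" "hpt z \<in> U" for z
    using A_eq[OF that] \<Phi>(2)[of z] by (simp add: k_def less_Suc_eq_le)
  then show ?thesis using rr \<Phi>(1) by blast
qed

end
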